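(* Let $(X_t)_{t\ge0}$ be a diffusion process on $\mathbb{R}^d$ with generator $\sum_{i=1}^db_i(x)\,\partial_i+\sum_{i,j=1}^da_{ij}\,\partial_i\partial_j$, where the drift $b$ does not depend on time and the symmetric nonnegative covariance matrix $a$ depends neither on time nor on location. Let $\|a\|$ denote the Euclidean (operator) norm of $a$. Assume that $b:\mathbb{R}^d\to\mathbb{R}^d$ is continuously differentiable and that its differential $D_xb$ satisfies $$\langle D_xb(x)(u),u\rangle\le-\kappa\|u\|^2\qquad(\ast)$$ for all $x,u\in\mathbb{R}^d$ and some $\kappa\in\mathbb{R}$. Let the initial distribution $\mu_0$ satisfy $\mathrm{GCBS}(D_0)$. Then, for all $t>0$, the law $\mu_t$ of $X_t$ satisfies $\mathrm{GCBS}(D_t)$ with $$D_t=D_0\,e^{-2\kappa t}+\frac{\|a\|}{2\kappa}\left(1-e^{-2\kappa t}\right).$$ Moreover, if $\kappa>0$, then $\mu_t\to\nu$ (weakly) as $t\to+\infty$, where $\nu$ is the unique invariant probability measure, and $\nu$ satisfies $\mathrm{GCBS}(\|a\|/(2\kappa))$. In particular, if $b=-\nabla U$ where $U:\mathbb{R}^d\to\mathbb{R}$ is $\mathcal{C}^2$, then $(\ast)$ reduces to the convexity condition $\langle\nabla\nabla U(x)\,u,u\rangle\ge\kappa\|u\|^2$ for all $x,u\in\mathbb{R}^d$.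
   Context: $(X_t)$ solves $dX_t=b(X_t)\,dt+\sqrt{2a}\,dW_t$ with $W$ a standard $d$-dimensional Brownian motion independent of $X_0$; $a=\frac12\sigma\sigma^{\intercal}$ may be degenerate. $\nabla\nabla U$ denotes the Hessian of $U$. Standing hypotheses on the SDE: with $\sigma=\sqrt{2a}$, $b$ is locally Lipschitz and there exist a constant $c\ge0$ and a nonnegative continuous, monotone increasing, concave function $\hat\beta$ on $\mathbb{R}_+$ with $\int_0^\infty\frac{du}{1+\hat\beta(u)}=\infty$ such that $2\langle x,b(x)\rangle+\|\sigma\|^2\le c\,\hat\beta(\|x\|^2)$ for all $x$ ($\|\sigma\|$ Hilbert-Schmidt norm). $\mathrm{GCBS}(D)$, $D\ge0$: $\log\mu(e^{f-\mu(f)})\le D\,\mathrm{lip}(f)^2$ for all $\mathcal{C}^\infty$ compactly supported $f:\mathbb{R}^d\to\mathbb{R}$, where $\mathrm{lip}(f)$ is the Lipschitz constant for the Euclidean norm and $\mu(f)=\int f\,d\mu$. For $\kappa=0$ the expression $\frac{1-e^{-2\kappa t}}{2\kappa}$ is read as $\int_0^te^{-2\kappa s}\,ds=t$. *)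

theory Defs
  imports "HOL-Probability.Probability"
begin

section \<open>Calculus\<close>

definition partial_deriv :: "'n \<Rightarrow> (real ^ 'n \<Rightarrow> real) \<Rightarrow> real ^ 'n \<Rightarrow> real" where
  "partial_deriv i f x = frechet_derivative f (at x) (axis i 1)"

definition grad :: "(real ^ 'n \<Rightarrow> real) \<Rightarrow> real ^ 'n \<Rightarrow> real ^ 'n" where
  "grad f x = (\<chi> i. partial_deriv i f x)"

definition hessian :: "(real ^ 'n \<Rightarrow> real) \<Rightarrow> real ^ 'n \<Rightarrow> real ^ 'n ^ 'n" where
  "hessian f x = (\<chi> i j. partial_deriv i (partial_deriv j f) x)"

primrec C_k :: "nat \<Rightarrow> (real ^ 'n \<Rightarrow> real) \<Rightarrow> bool" where
  "C_k 0 f \<longleftrightarrow> continuous_on UNIV f"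
| "C_k (Suc k) f \<longleftrightarrow> (\<forall>x. f differentiable (at x)) \<and> (\<forall>i. C_k k (partial_deriv i f))"

definition smooth :: "(real ^ 'n \<Rightarrow> real) \<Rightarrow> bool" where
  "smooth f \<longleftrightarrow> (\<forall>k. C_k k f)"

definition C1_field :: "(real ^ 'n \<Rightarrow> real ^ 'n) \<Rightarrow> bool" where
  "C1_field b \<longleftrightarrow>
     (\<exists>D :: real ^ 'n \<Rightarrow> (real ^ 'n) \<Rightarrow>\<^sub>L (real ^ 'n).
        (\<forall>x. (b has_derivative blinfun_apply (D x)) (at x)) \<and> continuous_on UNIV D)"

definition dissipative :: "real \<Rightarrow> (real ^ 'n \<Rightarrow> real ^ 'n) \<Rightarrow> bool" where
  "dissipative \<kappa> b \<longleftrightarrow>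
     (\<forall>x u. frechet_derivative b (at x) u \<bullet> u \<le> - \<kappa> * (norm u)\<^sup>2)"


section \<open>Gaussian concentration\<close>

text \<open>The infimum is attained, so for a Lipschitz function this is the least Lipschitz
  constant; a smooth compactly supported function is always Lipschitz.\<close>

definition lip :: "('a::metric_space \<Rightarrow> real) \<Rightarrow> real" where
  "lip f = Inf {L. L-lipschitz_on UNIV f}"

definition GCBS :: "real \<Rightarrow> (real ^ 'n) measure \<Rightarrow> bool" where
  "GCBS D \<mu> \<longleftrightarrow> 0 \<le> D \<and>
     (\<forall>f. smooth f \<and> compact (closure {x. f x \<noteq> 0}) \<longrightarrow>
        ln (\<integral>x. exp (f x - (\<integral>y. f y \<partial>\<mu>)) \<partial>\<mu>) \<le> D * (lip f)\<^sup>2)"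

text \<open>The measures \<open>\<mu> t\<close> and \<open>\<nu>\<close> are meant to be Borel probability measures.\<close>

definition weakly_converges ::
    "(real \<Rightarrow> 'a::topological_space measure) \<Rightarrow> 'a measure \<Rightarrow> bool" where
  "weakly_converges \<mu> \<nu> \<longleftrightarrow>
     (\<forall>f :: 'a \<Rightarrow> real. continuous_on UNIV f \<and> bounded (range f) \<longrightarrow>
        ((\<lambda>t. \<integral>x. f x \<partial>\<mu> t) \<longlongrightarrow> (\<integral>x. f x \<partial>\<nu>)) at_top)"


section \<open>Diffusions with additive noise\<close>

definition psd :: "real ^ 'n ^ 'n \<Rightarrow> bool" where
  "psd A \<longleftrightarrow> transpose A = A \<and> (\<forall>u. 0 \<le> (A *v u) \<bullet> u)"

definition is_psd_sqrt :: "real ^ 'n ^ 'n \<Rightarrow> real ^ 'n ^ 'n \<Rightarrow> bool" where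
  "is_psd_sqrt S A \<longleftrightarrow> psd S \<and> S ** S = A"

text \<open>Processes are indexed by \<^typ>\<open>real\<close>, but only times \<open>t \<ge> 0\<close> are ever looked at.\<close>

definition brownian_motion ::
    "'w measure \<Rightarrow> (real \<Rightarrow> 'w \<Rightarrow> real ^ 'n) \<Rightarrow> bool" where
  "brownian_motion M W \<longleftrightarrow> prob_space M \<and>
     (\<forall>t\<ge>0. W t \<in> borel_measurable M) \<and>
     (AE \<omega> in M. W 0 \<omega> = 0) \<and>
     (AE \<omega> in M. continuous_on {0..} (\<lambda>t. W t \<omega>)) \<and>
     (\<forall>s t. 0 \<le> s \<and> s < t \<longrightarrow>
        distributed M lborel (\<lambda>\<omega>. W t \<omega> - W s \<omega>)
          (\<lambda>x. ennreal (\<Prod>i\<in>UNIV. normal_density 0 (sqrt (t - s)) (x $ i)))) \<and>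
     (\<forall>(\<tau> :: nat \<Rightarrow> real) n. 0 \<le> \<tau> 0 \<and> mono \<tau> \<longrightarrow>
        prob_space.indep_vars M (\<lambda>_. borel) (\<lambda>k \<omega>. W (\<tau> (Suc k)) \<omega> - W (\<tau> k) \<omega>) {..<n})"

text \<open>The process \<open>W\<close> as a whole (not just each \<open>W t\<close>) is independent of \<open>Y\<close>.\<close>

definition indep_of_process ::
    "'w measure \<Rightarrow> ('w \<Rightarrow> real ^ 'n) \<Rightarrow> (real \<Rightarrow> 'w \<Rightarrow> real ^ 'n) \<Rightarrow> bool" where
  "indep_of_process M Y W \<longleftrightarrow>
     prob_space.indep_set M
       (sets (vimage_algebra (space M) Y borel))
       (sets (vimage_algebra (space M) (\<lambda>\<omega>. \<lambda>t\<in>{0..}. W t \<omega>) (\<Pi>\<^sub>M t\<in>{0..}. borel)))"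

text \<open>\<open>dX = b(X) dt + \<sigma> dW\<close> with \<open>X 0\<close> independent of \<open>W\<close>. As \<open>\<sigma>\<close> is constant, the stochastic
  integral is \<open>\<sigma> W\<close> and the integrated equation makes sense path by path.\<close>

definition sde_solution ::
    "'w measure \<Rightarrow> (real \<Rightarrow> 'w \<Rightarrow> real ^ 'n) \<Rightarrow> (real ^ 'n \<Rightarrow> real ^ 'n) \<Rightarrow> real ^ 'n ^ 'n
      \<Rightarrow> (real \<Rightarrow> 'w \<Rightarrow> real ^ 'n) \<Rightarrow> bool" where
  "sde_solution M W b \<sigma> X \<longleftrightarrow>
     (\<forall>t\<ge>0. X t \<in> borel_measurable M) \<and>
     indep_of_process M (X 0) W \<and>
     (AE \<omega> in M. continuous_on {0..} (\<lambda>t. X t \<omega>)) \<and>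
     (AE \<omega> in M. \<forall>t\<ge>0.
        X t \<omega> = X 0 \<omega> + integral {0..t} (\<lambda>s. b (X s \<omega>)) + \<sigma> *v (W t \<omega> - W 0 \<omega>))"

text \<open>On \<^typ>\<open>real ^ 'n ^ 'n\<close> the library norm is the Hilbert-Schmidt norm.\<close>

definition sde_standing :: "(real ^ 'n \<Rightarrow> real ^ 'n) \<Rightarrow> real ^ 'n ^ 'n \<Rightarrow> bool" where
  "sde_standing b \<sigma> \<longleftrightarrow>
     (\<forall>x. \<exists>r>0. \<exists>L. L-lipschitz_on (cball x r) b) \<and>
     (\<exists>c\<ge>0. \<exists>\<beta> :: real \<Rightarrow> real.
        (\<forall>u\<ge>0. 0 \<le> \<beta> u) \<and> continuous_on {0..} \<beta> \<and> mono_on {0..} \<beta> \<and> concave_on {0..} \<beta> \<and>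
        (\<integral>\<^sup>+u\<in>{0..}. ennreal (1 / (1 + \<beta> u)) \<partial>lborel) = \<infinity> \<and>
        (\<forall>x. 2 * (x \<bullet> b x) + (norm \<sigma>)\<^sup>2 \<le> c * \<beta> ((norm x)\<^sup>2)))"

text \<open>\<open>P t x\<close> is the law at time \<open>t\<close> of the solution started at \<open>x\<close>. By pathwise uniqueness
  the kernels \<open>P t\<close>, \<open>t \<ge> 0\<close>, are determined by \<open>b\<close> and \<open>\<sigma>\<close>; in particular they do not depend
  on the Brownian motion \<open>W\<close> used to realise the solutions.\<close>

definition transition_kernels ::
    "'w measure \<Rightarrow> (real \<Rightarrow> 'w \<Rightarrow> real ^ 'n) \<Rightarrow> (real ^ 'n \<Rightarrow> real ^ 'n) \<Rightarrow> real ^ 'n ^ 'n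
      \<Rightarrow> (real \<Rightarrow> real ^ 'n \<Rightarrow> (real ^ 'n) measure) \<Rightarrow> bool" where
  "transition_kernels M W b \<sigma> P \<longleftrightarrow>
     (\<forall>t\<ge>0. P t \<in> borel \<rightarrow>\<^sub>M prob_algebra borel) \<and>
     (\<forall>x. \<exists>Y. sde_solution M W b \<sigma> Y \<and> (AE \<omega> in M. Y 0 \<omega> = x) \<and>
        (\<forall>t\<ge>0. P t x = distr M borel (Y t)))"

text \<open>\<open>\<nu> P\<^sub>t = \<nu>\<close> for the transition semigroup. Quantifying \<open>P\<close> existentially makes the existence
  of the semigroup part of the claim that some \<open>\<nu>\<close> is invariant, so that uniqueness of the
  invariant measure cannot hold vacuously.\<close>

definition invariant_measure ::
    "'w measure \<Rightarrow> (real \<Rightarrow> 'w \<Rightarrow> real ^ 'n) \<Rightarrow> (real ^ 'n \<Rightarrow> real ^ 'n) \<Rightarrow> real ^ 'n ^ 'n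
      \<Rightarrow> (real ^ 'n) measure \<Rightarrow> bool" where
  "invariant_measure M W b \<sigma> \<nu> \<longleftrightarrow>
     prob_space \<nu> \<and> sets \<nu> = sets borel \<and>
     (\<exists>P. transition_kernels M W b \<sigma> P \<and> (\<forall>t\<ge>0. Giry_Monad.bind \<nu> (P t) = \<nu>))"

text \<open>\<open>(1 - e\<^sup>-\<^sup>2\<^sup>\<kappa>\<^sup>t) / (2\<kappa>)\<close>, read as \<open>\<integral>\<^sub>0\<^sup>t e\<^sup>-\<^sup>2\<^sup>\<kappa>\<^sup>s ds = t\<close> for \<open>\<kappa> = 0\<close>.\<close>

definition exp_factor :: "real \<Rightarrow> real \<Rightarrow> real" where
  "exp_factor \<kappa> t = (if \<kappa> = 0 then t else (1 - exp (- 2 * \<kappa> * t)) / (2 * \<kappa>))"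

end

theory Submission
  imports Defs "HOL-Real_Asymp.Real_Asymp"
begin

text \<open>Because the noise is additive, the equation can be solved path by path, and everything rests on one
discretisation, the implicit Euler scheme \<open>x \<mapsto> J\<^sub>h (x + \<sigma> \<Delta>W)\<close> with the resolvent
\<open>J\<^sub>h = (I - h b)\<^sup>-\<^sup>1\<close>. The condition on the differential of \<open>b\<close> integrates to
\<open>\<langle>b x - b y, x - y\<rangle> \<le> - \<kappa> |x - y|\<^sup>2\<close>, so \<open>J\<^sub>h\<close> is defined everywhere and is Lipschitz with constant
\<open>1 / (1 + h \<kappa>)\<close>. An exact solution satisfies the scheme up to an error of size \<open>h\<close> times the modulus of
continuity of \<open>s \<mapsto> b (X s)\<close>; hence the scheme converges to it along every continuous driving path
(\<open>implicit_euler_tendsto\<close>), which replaces all stochastic calculus. Applied to arbitrary starting points it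
yields uniqueness, measurability in the starting point, the contraction rate \<open>e\<^sup>-\<^sup>\<kappa>\<^sup>t\<close> and the Markov property.

Concentration is propagated one step at a time. Let \<open>D\<close> be the constant before a step. Adding the
independent increment \<open>\<sigma> \<Delta>W\<close> raises it to \<open>D + \<parallel>a\<parallel> h\<close>, and applying \<open>J\<^sub>h\<close> multiplies it by
\<open>(1 + h \<kappa>)\<^sup>-\<^sup>2\<close>; iterating and letting \<open>h \<rightarrow> 0\<close> gives \<open>D\<^sub>0 e\<^sup>-\<^sup>2\<^sup>\<kappa>\<^sup>t + \<parallel>a\<parallel> \<integral>\<^sub>0\<^sup>t e\<^sup>-\<^sup>2\<^sup>\<kappa>\<^sup>s ds\<close>
(\<open>euler_exp_moment\<close>, \<open>solution_concentration\<close>). The images of test functions under such steps are only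
Lipschitz, so the smooth compactly supported test functions of \<open>GCBS\<close> are first exchanged for bounded
Lipschitz ones by mollification and truncation (\<open>GCBS_iff_lipschitz_concentration\<close>). The sharp Gaussian
constant \<open>1/2\<close> comes from the same idea in its simplest form: cutting a Gaussian increment into many small
independent pieces and using a second-order expansion of \<open>e\<^sup>f\<close> on each (\<open>increment_concentration\<close>).

For \<open>\<kappa> > 0\<close> the flow contracts. Composing independent copies of the time-one map in reversed order
produces an almost surely convergent sequence; the law \<open>\<nu>\<close> of its limit is invariant
(\<open>invariant_for_unit_time\<close>, \<open>invariant_for_all_times\<close>). The series that controls this sequence converges
because concentration around the mean already forces a finite first moment
(\<open>lipschitz_concentration_integrable_norm\<close>). Contraction makes \<open>P\<^sub>t f\<close> asymptotically constant
(\<open>forgets_initial_law\<close>), which gives uniqueness of \<open>\<nu>\<close> and weak convergence to it, and the concentration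
bound passes to the limit. The statement on \<open>b = - \<nabla>U\<close> is the identity between the differential of
\<open>- \<nabla>U\<close> and the negative Hessian.\<close>

section \<open>Smooth functions of several variables\<close>

lemma partial_deriv_eqI: "(f has_derivative f') (at x) \<Longrightarrow> partial_deriv i f x = f' (axis i 1)"
  by (simp add: partial_deriv_def frechet_derivative_at[symmetric])

lemma has_derivative_grad:
  assumes "f differentiable (at x)"
  shows "(f has_derivative (\<lambda>h. grad f x \<bullet> h)) (at x)"
proof -
  have D: "(f has_derivative frechet_derivative f (at x)) (at x)"
    using assms by (simp add: frechet_derivative_works)
  then have lin: "linear (frechet_derivative f (at x))" by (rule has_derivative_linear)
  have "frechet_derivative f (at x) h = grad f x \<bullet> h" for h
  proof -
    have "frechet_derivative f (at x) h = frechet_derivative f (at x) (\<Sum>i\<in>UNIV. h $ i *\<^sub>R axis i 1)"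
      using basis_expansion[of h] by (simp add: scalar_mult_eq_scaleR)
    also have "\<dots> = (\<Sum>i\<in>UNIV. h $ i * partial_deriv i f x)"
      by (simp add: linear_sum[OF lin] linear_cmul[OF lin] partial_deriv_def)
    finally show ?thesis by (simp add: inner_vec_def grad_def mult.commute)
  qed
  then have "frechet_derivative f (at x) = (\<lambda>h. grad f x \<bullet> h)" by blast
  then show ?thesis using D by simp
qed

lemma C_k_continuous: "C_k k f \<Longrightarrow> continuous_on UNIV f"
  by (cases k) (auto intro!: continuous_at_imp_continuous_on differentiable_imp_continuous_within)

lemma C_k_mono_Suc: "C_k (Suc k) f \<Longrightarrow> C_k k f"
proof (induction k arbitrary: f)
  case 0
  then show ?case using C_k_continuous by fastforce
next
  case (Suc k)
  then show ?case by (metis C_k.simps(2))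
qed

text \<open>Membership in \<^const>\<open>C_k\<close> is proved from an explicit derivative, which avoids any computation with
  \<^const>\<open>frechet_derivative\<close>.\<close>

lemma C_k_SucI:
  assumes "\<And>x. (f has_derivative f' x) (at x)" "\<And>i. C_k k (\<lambda>x. f' x (axis i 1))"
  shows "C_k (Suc k) f"
proof -
  have "partial_deriv i f = (\<lambda>x. f' x (axis i 1))" for i
    using partial_deriv_eqI[OF assms(1)] by auto
  then show ?thesis using assms by (auto simp: differentiable_def)
qed

lemma C_k_const: "C_k k (\<lambda>x. c)"
proof (induction k arbitrary: c)
  case (Suc k)
  show ?case by (rule C_k_SucI[where f' = "\<lambda>_ _. 0"]) (auto intro: Suc.IH)
qed auto

lemma C_k_add: "C_k k f \<Longrightarrow> C_k k g \<Longrightarrow> C_k k (\<lambda>x. f x + g x)"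
proof (induction k arbitrary: f g)
  case (Suc k)
  show ?case
  proof (rule C_k_SucI[where f' = "\<lambda>x h. grad f x \<bullet> h + grad g x \<bullet> h"])
    show "((\<lambda>x. f x + g x) has_derivative (\<lambda>h. grad f x \<bullet> h + grad g x \<bullet> h)) (at x)" for x
      using Suc.prems by (intro has_derivative_add has_derivative_grad) auto
    show "C_k k (\<lambda>x. grad f x \<bullet> axis i 1 + grad g x \<bullet> axis i 1)" for i
      using Suc.prems by (simp add: inner_axis grad_def Suc.IH)
  qed
qed (auto intro: continuous_intros)

lemma C_k_mult: "C_k k f \<Longrightarrow> C_k k g \<Longrightarrow> C_k k (\<lambda>x. f x * g x)"
proof (induction k arbitrary: f g)
  case (Suc k)
  show ?case
  proof (rule C_k_SucI[where f' = "\<lambda>x h. f x * (grad g x \<bullet> h) + (grad f x \<bullet> h) * g x"])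
    show "((\<lambda>x. f x * g x) has_derivative (\<lambda>h. f x * (grad g x \<bullet> h) + (grad f x \<bullet> h) * g x)) (at x)" for x
      using Suc.prems by (intro has_derivative_mult has_derivative_grad) auto
    show "C_k k (\<lambda>x. f x * (grad g x \<bullet> axis i 1) + grad f x \<bullet> axis i 1 * g x)" for i
      using Suc.prems C_k_mono_Suc[OF Suc.prems(1)] C_k_mono_Suc[OF Suc.prems(2)]
      by (simp add: inner_axis grad_def Suc.IH C_k_add)
  qed
qed (auto intro: continuous_intros)

lemma C_k_component: "C_k k (\<lambda>x. x $ i)"
proof (cases k)
  case (Suc m)
  show ?thesis unfolding Suc
  proof (rule C_k_SucI[where f' = "\<lambda>x h. h $ i"])
    show "((\<lambda>x. x $ i) has_derivative (\<lambda>h. h $ i)) (at x)" for x :: "real ^ 'a"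
      by (rule bounded_linear_imp_has_derivative[OF bounded_linear_vec_nth])
  qed (rule C_k_const)
qed (auto intro: continuous_intros)

text \<open>The functions \<open>t\<^sup>-\<^sup>k e\<^sup>-\<^sup>1\<^sup>/\<^sup>t\<close>, extended by \<open>0\<close> to \<open>t \<le> 0\<close>. Their linear span is closed under
  differentiation, so that smoothness of \<open>e\<^sup>-\<^sup>1\<^sup>/\<^sup>t\<close> follows by an induction on the order that treats all \<open>k\<close> at once.\<close>

definition flat :: "nat \<Rightarrow> real \<Rightarrow> real" where
  "flat k t = (if 0 < t then (1 / t) ^ k * exp (- (1 / t)) else 0)"

lemma flat_tendsto_0: "(flat k \<longlongrightarrow> 0) (at 0)"
proof -
  have "((\<lambda>t::real. (1 / t) ^ k * exp (- (1 / t))) \<longlongrightarrow> 0) (at_right 0)"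
  proof -
    have "((\<lambda>s::real. s ^ k * exp (- s)) \<longlongrightarrow> 0) at_top"
      using tendsto_power_div_exp_0[of k] by (simp add: exp_minus divide_inverse)
    then have "((\<lambda>t::real. (inverse t) ^ k * exp (- inverse t)) \<longlongrightarrow> 0) (at_right 0)"
      using filterlim_inverse_at_top_right by (rule filterlim_compose)
    then show ?thesis by (simp add: inverse_eq_divide)
  qed
  then have "(flat k \<longlongrightarrow> 0) (at_right 0)"
    by (rule Lim_transform_eventually) (auto simp: flat_def eventually_at_filter)
  moreover have "(flat k \<longlongrightarrow> 0) (at_left 0)"
    by (rule Lim_transform_eventually[OF tendsto_const]) (auto simp: flat_def eventually_at_filter)
  ultimately show ?thesis by (simp add: filterlim_at_split)
qed

lemma DERIV_flat: "DERIV (flat k) t :> - real k * flat (Suc k) t + flat (Suc (Suc k)) t"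
proof -
  consider "t < 0" | "t = 0" | "t > 0" by linarith
  then show ?thesis
  proof cases
    case 1
    have "DERIV (\<lambda>_. 0 :: real) t :> 0" by simp
    then have "DERIV (flat k) t :> 0"
      by (rule has_field_derivative_transform_within_open[of _ _ _ "{..<0}"]) (use 1 in \<open>auto simp: flat_def\<close>)
    then show ?thesis using 1 by (simp add: flat_def)
  next
    case 2
    have "((\<lambda>h. (flat k (0 + h) - flat k 0) / h) \<longlongrightarrow> 0) (at 0)"
    proof (rule Lim_transform_eventually[OF flat_tendsto_0[of "Suc k"]])
      show "\<forall>\<^sub>F h in at 0. flat (Suc k) h = (flat k (0 + h) - flat k 0) / h"
        by (auto simp: flat_def eventually_at_filter)
    qed
    then show ?thesis using 2 by (simp add: DERIV_def flat_def)
  next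
    case 3
    define s where "s = 1 / t"
    have 1: "DERIV (\<lambda>t. 1 / t) t :> - (s\<^sup>2)"
      using 3 by (auto intro!: derivative_eq_intros simp: s_def power2_eq_square)
    have 2: "DERIV (\<lambda>s. s ^ k * exp (- s)) (1 / t) :> real k * s ^ (k - 1) * exp (- s) - s ^ k * exp (- s)"
      by (auto intro!: derivative_eq_intros simp: s_def)
    have "(real k * s ^ (k - 1) * exp (- s) - s ^ k * exp (- s)) * - (s\<^sup>2)
        = - real k * flat (Suc k) t + flat (Suc (Suc k)) t"
      using 3 by (cases k) (simp_all add: flat_def s_def[symmetric] power2_eq_square algebra_simps)
    then have "DERIV (\<lambda>t. (1 / t) ^ k * exp (- (1 / t))) t :> - real k * flat (Suc k) t + flat (Suc (Suc k)) t"
      using DERIV_chain2[OF 2 1] by simp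
    then show ?thesis
      by (rule has_field_derivative_transform_within_open[of _ _ _ "{0<..}"]) (use 3 in \<open>auto simp: flat_def\<close>)
  qed
qed

lemma flat_nonneg: "0 \<le> flat k t" by (simp add: flat_def)

text \<open>With \<open>r = \<epsilon>\<^sup>2\<close> this is a smooth bump supported in the ball of radius \<open>\<epsilon>\<close>.\<close>

lemma C_k_flat_radial: "C_k m (\<lambda>x::real ^ 'n. flat k (r - x \<bullet> x))"
proof (induction m arbitrary: k)
  case 0
  have "continuous_on UNIV (flat k)"
    by (intro continuous_at_imp_continuous_on ballI DERIV_isCont[OF DERIV_flat])
  from continuous_on_compose2[OF this, of UNIV "\<lambda>x::real ^ 'n. r - x \<bullet> x"] show ?case
    by (simp add: continuous_intros)
next
  case (Suc m)
  let ?D = "\<lambda>x::real ^ 'n. - real k * flat (Suc k) (r - x \<bullet> x) + flat (Suc (Suc k)) (r - x \<bullet> x)"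
  show ?case
  proof (rule C_k_SucI[where f' = "\<lambda>x h. ?D x * (- 2 * (x \<bullet> h))"])
    fix x :: "real ^ 'n"
    have 1: "((\<lambda>x. r - x \<bullet> x) has_derivative (\<lambda>h. - 2 * (x \<bullet> h))) (at x)"
      by (auto intro!: derivative_eq_intros simp: inner_commute)
    show "((\<lambda>x. flat k (r - x \<bullet> x)) has_derivative (\<lambda>h. ?D x * (- 2 * (x \<bullet> h)))) (at x)"
      using has_derivative_compose[OF 1 DERIV_flat[unfolded has_field_derivative_def]] by simp
  next
    show "C_k m (\<lambda>x. ?D x * (- 2 * (x \<bullet> axis i 1)))" for i
      unfolding inner_axis
      by (intro C_k_mult C_k_add C_k_const Suc.IH) (simp add: C_k_component)
  qed
qed

lemma continuous_grad:
  assumes "C_k (Suc k) f"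
  shows "continuous_on UNIV (grad f)"
  unfolding grad_def using assms by (intro continuous_intros) (auto dest: C_k_continuous)

text \<open>A convolution inherits the regularity of its smooth factor: derivatives may be taken under the integral,
  which is over a fixed box and therefore over a compact set.\<close>

lemma C_k_convolution:
  fixes f \<rho> :: "real ^ 'n \<Rightarrow> real"
  assumes f: "continuous_on UNIV f" and "C_k k \<rho>"
  shows "C_k k (\<lambda>x. integral (cbox a b) (\<lambda>y. f y * \<rho> (x - y)))"
  using assms(2)
proof (induction k arbitrary: \<rho>)
  case 0
  then have c\<rho>: "continuous_on UNIV \<rho>" by simp
  have "continuous_on (UNIV \<times> cbox a b) (\<lambda>(x, y). f y * \<rho> (x - y))"
    unfolding split_beta
    by (intro continuous_on_mult continuous_on_compose2[OF f] continuous_on_compose2[OF c\<rho>] continuous_intros) auto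
  then show ?case by (simp add: integral_continuous_on_param)
next
  case (Suc k)
  have cg: "continuous_on UNIV (grad \<rho>)" and c\<rho>: "continuous_on UNIV \<rho>"
    using Suc.prems continuous_grad C_k_continuous by blast+
  let ?F = "\<lambda>x y. f y *\<^sub>R blinfun_inner_right (grad \<rho> (x - y))"
  have cF: "continuous_on (UNIV \<times> cbox a b) (\<lambda>(x, y). ?F x y)"
    unfolding split_beta
    by (intro continuous_on_scaleR continuous_on_compose2[OF f] continuous_on_compose2[OF cg]
        bounded_linear.continuous_on[OF bounded_linear_blinfun_inner_right] continuous_intros) auto
  have D: "((\<lambda>x. integral (cbox a b) (\<lambda>y. f y * \<rho> (x - y))) has_derivative
      integral (cbox a b) (?F x)) (at x)" for x
  proof (rule leibniz_rule[where U = UNIV, simplified])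
    fix x y :: "real ^ 'n"
    have "((\<lambda>x. x - y) has_derivative (\<lambda>h. h)) (at x)" by (auto intro!: derivative_eq_intros)
    moreover have "\<rho> differentiable (at (x - y))" using Suc.prems by simp
    ultimately have "((\<lambda>x. \<rho> (x - y)) has_derivative (\<lambda>h. grad \<rho> (x - y) \<bullet> h)) (at x)"
      by (rule has_derivative_compose[OF _ has_derivative_grad])
    from has_derivative_mult_right[OF this, of "f y"]
    show "((\<lambda>x. f y * \<rho> (x - y)) has_derivative blinfun_apply (f y *\<^sub>R blinfun_inner_right (grad \<rho> (x - y)))) (at x)"
      by (simp add: scaleR_blinfun.rep_eq)
  next
    show "(\<lambda>y. f y * \<rho> (x - y)) integrable_on cbox a b" for x
      by (intro integrable_continuous continuous_on_mult continuous_on_compose2[OF f]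
          continuous_on_compose2[OF c\<rho>] continuous_intros) auto
  qed (use cF in auto)
  show ?case
  proof (rule C_k_SucI[OF D])
    fix i
    have "blinfun_apply (integral (cbox a b) (?F x)) (axis i 1)
      = integral (cbox a b) (\<lambda>y. f y * partial_deriv i \<rho> (x - y))" for x
    proof -
      have "continuous_on (cbox a b) (?F x)"
        by (intro continuous_on_scaleR continuous_on_compose2[OF f] continuous_on_compose2[OF cg]
            bounded_linear.continuous_on[OF bounded_linear_blinfun_inner_right] continuous_intros) auto
      then have "?F x integrable_on cbox a b" by (rule integrable_continuous)
      from integral_linear[OF this, of "\<lambda>F. blinfun_apply F (axis i 1)"]
      show ?thesis
        by (simp add: o_def blinfun.bounded_linear_left scaleR_blinfun.rep_eq inner_axis grad_def)
    qed
    moreover have "C_k k (\<lambda>x. integral (cbox a b) (\<lambda>y. f y * partial_deriv i \<rho> (x - y)))"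
      using Suc by simp
    ultimately show "C_k k (\<lambda>x. blinfun_apply (integral (cbox a b) (?F x)) (axis i 1))" by simp
  qed
qed

lemma compact_closure_subset: "compact (closure S) \<Longrightarrow> T \<subseteq> closure S \<Longrightarrow> compact (closure T)"
  using compact_Int_closed[of "closure S" "closure T"] closure_minimal[of T "closure S"]
  by (simp add: Int_absorb1)

lemma compact_support_bounded:
  fixes f :: "'a::metric_space \<Rightarrow> 'b::real_normed_vector"
  assumes "continuous_on UNIV f" "compact (closure {x. f x \<noteq> 0})"
  obtains B where "0 \<le> B" "\<And>x. norm (f x) \<le> B"
proof -
  have "bounded (f ` closure {x. f x \<noteq> 0})"
    using assms by (intro compact_imp_bounded compact_continuous_image) (auto intro: continuous_on_subset)
  then obtain B where B: "B > 0" "\<And>x. x \<in> closure {x. f x \<noteq> 0} \<Longrightarrow> norm (f x) \<le> B"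
    unfolding bounded_pos by auto
  have "norm (f x) \<le> B" for x
    using B closure_subset[of "{x. f x \<noteq> 0}"] by (cases "f x = 0") auto
  then show ?thesis using B(1) that[of B] by auto
qed

text \<open>Off the closed support the function vanishes on a whole neighbourhood.\<close>

lemma grad_zero_outside_support:
  assumes "x \<notin> closure {x. f x \<noteq> 0}"
  shows "grad f x = 0"
proof -
  have "((\<lambda>_. 0::real) has_derivative (\<lambda>_. 0)) (at x)" by simp
  then have "(f has_derivative (\<lambda>_. 0)) (at x)"
    by (rule has_derivative_transform_within_open[of _ _ _ _ "- closure {x. f x \<noteq> 0}"])
       (use assms closure_subset[of "{x. f x \<noteq> 0}"] in auto)
  then show ?thesis by (simp add: grad_def vec_eq_iff partial_deriv_eqI)
qed

lemma compact_support_partial_deriv: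
  assumes "compact (closure {x. f x \<noteq> 0})"
  shows "compact (closure {x. partial_deriv i f x \<noteq> 0})"
proof (rule compact_closure_subset[OF assms])
  show "{x. partial_deriv i f x \<noteq> 0} \<subseteq> closure {x. f x \<noteq> 0}"
    using grad_zero_outside_support[of _ f] by (force simp: grad_def vec_eq_iff)
qed

lemma compact_support_lipschitz:
  assumes f: "C_k 1 f" and supp: "compact (closure {x. f x \<noteq> 0})"
  obtains L where "L-lipschitz_on UNIV f"
proof -
  have cg: "continuous_on UNIV (grad f)" using f continuous_grad[of 0 f] by simp
  have "compact (closure {x. grad f x \<noteq> 0})"
    by (rule compact_closure_subset[OF supp]) (use grad_zero_outside_support[of _ f] in force)
  then obtain B where B: "0 \<le> B" "\<And>x. norm (grad f x) \<le> B"
    using compact_support_bounded[OF cg] by blast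
  have "norm (f x - f y) \<le> B * norm (x - y)" for x y
  proof (rule differentiable_bound[where S = UNIV])
    show "(f has_derivative (\<lambda>h. grad f z \<bullet> h)) (at z within UNIV)" for z
      using f by (auto intro!: has_derivative_grad)
    show "onorm (\<lambda>h. grad f z \<bullet> h) \<le> B" for z
    proof (rule onorm_le)
      fix h show "norm (grad f z \<bullet> h) \<le> B * norm h"
        using Cauchy_Schwarz_ineq2[of "grad f z" h] mult_right_mono[OF B(2)[of z] norm_ge_zero[of h]] by simp
    qed
  qed auto
  then have "B-lipschitz_on UNIV f" using B(1) by (intro lipschitz_onI) (simp_all add: dist_norm)
  then show ?thesis by (rule that)
qed

text \<open>The first partial derivatives are themselves compactly supported and \<open>C\<^sup>1\<close>, hence Lipschitz; the mean value
  theorem turns this into a remainder that is quadratic uniformly in the base point.\<close>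

lemma compact_support_taylor:
  fixes f :: "real ^ 'n \<Rightarrow> real"
  assumes f: "C_k 2 f" and supp: "compact (closure {x. f x \<noteq> 0})"
  obtains K where "0 \<le> K" "\<And>x z. \<bar>f (x + z) - f x - grad f x \<bullet> z\<bar> \<le> K * (norm z)\<^sup>2"
proof -
  have "\<exists>L. L-lipschitz_on UNIV (partial_deriv i f)" for i
  proof -
    have "C_k (Suc 1) f" using f by (simp only: Suc_1)
    then have "C_k 1 (partial_deriv i f)" by (simp only: C_k.simps)
    then show ?thesis using compact_support_lipschitz[OF _ compact_support_partial_deriv[OF supp]] by blast
  qed
  then obtain L where L: "\<And>i. (L i)-lipschitz_on UNIV (partial_deriv i f)" by metis
  define K where "K = sum L UNIV"
  have L0: "L i \<ge> 0" for i using L lipschitz_on_nonneg by blast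
  then have K: "0 \<le> K" unfolding K_def by (intro sum_nonneg) auto
  have gl: "norm (grad f x - grad f y) \<le> K * norm (x - y)" for x y
  proof -
    have "norm (grad f x - grad f y) \<le> (\<Sum>i\<in>UNIV. \<bar>(grad f x - grad f y) $ i\<bar>)" by (rule norm_le_l1_cart)
    also have "\<dots> \<le> (\<Sum>i\<in>UNIV. L i * norm (x - y))"
      using lipschitz_on_normD[OF L] by (intro sum_mono) (simp add: grad_def)
    finally show ?thesis by (simp add: K_def sum_distrib_right)
  qed
  have "\<bar>f (x + z) - f x - grad f x \<bullet> z\<bar> \<le> K * (norm z)\<^sup>2" for x z
  proof -
    have d: "((\<lambda>s. f (x + s *\<^sub>R z)) has_derivative (\<lambda>h. grad f (x + s *\<^sub>R z) \<bullet> (h *\<^sub>R z))) (at s within {0..1})" for s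
    proof -
      have 1: "((\<lambda>s. x + s *\<^sub>R z) has_derivative (\<lambda>h. h *\<^sub>R z)) (at s within {0..1})"
        by (auto intro!: derivative_eq_intros)
      have "f differentiable (at (x + s *\<^sub>R z))" using f by (simp add: numeral_2_eq_2)
      from has_derivative_compose[OF 1 has_derivative_grad[OF this]] show ?thesis .
    qed
    obtain s where s: "s \<in> {0..1}" "f (x + 1 *\<^sub>R z) - f (x + 0 *\<^sub>R z) = grad f (x + s *\<^sub>R z) \<bullet> ((1 - 0) *\<^sub>R z)"
      using mvt_very_simple[of 0 1 "\<lambda>s. f (x + s *\<^sub>R z)", OF _ d] by auto
    then have "f (x + z) - f x - grad f x \<bullet> z = (grad f (x + s *\<^sub>R z) - grad f x) \<bullet> z"
      by (simp add: inner_diff_left)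
    also have "\<bar>\<dots>\<bar> \<le> norm (grad f (x + s *\<^sub>R z) - grad f x) * norm z" by (rule Cauchy_Schwarz_ineq2)
    also have "\<dots> \<le> (K * norm (s *\<^sub>R z)) * norm z"
      using gl[of "x + s *\<^sub>R z" x] by (intro mult_right_mono) auto
    also have "\<dots> \<le> K * (norm z)\<^sup>2"
      using s(1) K mult_left_le_one_le[of "norm z * norm z" "\<bar>s\<bar>"]
      by (auto simp: power2_eq_square mult.assoc intro!: mult_left_mono)
    finally show ?thesis .
  qed
  then show ?thesis using K that by blast
qed

text \<open>The infimum in \<^const>\<open>lip\<close> is attained, because the Lipschitz inequality is closed in the constant.\<close>

lemma lip_is_lipschitz:
  assumes "L-lipschitz_on UNIV f"
  shows "(lip f)-lipschitz_on UNIV f" "lip f \<le> L"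
proof -
  let ?S = "{L. L-lipschitz_on UNIV f}"
  have bdd: "bdd_below ?S" using lipschitz_on_nonneg by (intro bdd_belowI[of _ 0]) auto
  show "lip f \<le> L" unfolding lip_def using assms bdd by (intro cInf_lower) auto
  show "(lip f)-lipschitz_on UNIV f"
  proof (rule lipschitz_onI)
    show "0 \<le> lip f" unfolding lip_def using assms lipschitz_on_nonneg by (intro cInf_greatest) auto
    fix x y
    show "dist (f x) (f y) \<le> lip f * dist x y"
    proof (cases "x = y")
      case False
      have "dist (f x) (f y) / dist x y \<le> lip f" unfolding lip_def
      proof (rule cInf_greatest)
        fix l assume "l \<in> ?S"
        then show "dist (f x) (f y) / dist x y \<le> l"
          using lipschitz_onD[of l UNIV f x y] False by (simp add: divide_le_eq)
      qed (use assms in auto)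
      then show ?thesis using False by (simp add: divide_le_eq)
    qed auto
  qed
qed

text \<open>The differential of \<open>- \<nabla>U\<close> at \<open>x\<close> is \<open>u \<mapsto> - H u\<close> up to transposition of the Hessian \<open>H\<close>, and
  transposition does not change the quadratic form.\<close>

lemma dissipative_grad_iff:
  fixes U :: "real ^ 'n \<Rightarrow> real"
  assumes "C_k 2 U"
  shows "dissipative \<kappa> (\<lambda>x. - grad U x) \<longleftrightarrow> (\<forall>x u. (hessian U x *v u) \<bullet> u \<ge> \<kappa> * (norm u)\<^sup>2)"
proof -
  have d: "partial_deriv j U differentiable (at x)" for j x
    using assms by (simp add: numeral_2_eq_2)
  have "((\<lambda>x. - grad U x) has_derivative (\<lambda>u. - (\<chi> j. grad (partial_deriv j U) x \<bullet> u))) (at x)" for x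
    unfolding grad_def[of U]
    by (intro has_derivative_minus, subst has_derivative_componentwise_within)
       (auto simp: Basis_vec_def inner_axis intro!: has_derivative_grad d)
  then have D: "frechet_derivative (\<lambda>x. - grad U x) (at x) = (\<lambda>u. - (\<chi> j. grad (partial_deriv j U) x \<bullet> u))" for x
    by (rule frechet_derivative_at[symmetric])
  have "(\<chi> j. grad (partial_deriv j U) x \<bullet> u) \<bullet> u = (hessian U x *v u) \<bullet> u" for x u
  proof -
    have "(\<chi> j. grad (partial_deriv j U) x \<bullet> u) \<bullet> u = (\<Sum>j\<in>UNIV. \<Sum>i\<in>UNIV. hessian U x $ i $ j * u $ i * u $ j)"
      by (simp add: inner_vec_def grad_def hessian_def sum_distrib_right)
    also have "\<dots> = (\<Sum>i\<in>UNIV. \<Sum>j\<in>UNIV. hessian U x $ i $ j * u $ i * u $ j)" by (rule sum.swap)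
    also have "\<dots> = (hessian U x *v u) \<bullet> u"
      by (simp add: inner_vec_def matrix_vector_mult_def sum_distrib_right sum_distrib_left mult_ac)
    finally show ?thesis .
  qed
  then show ?thesis unfolding dissipative_def D by auto
qed

text \<open>The exponential moment inequality in a form that is stable under Lipschitz maps, averaging and limits. Any
  Lipschitz constant of \<open>f\<close> is admitted, so that it can be tracked through compositions, and boundedness of \<open>f\<close>
  makes the integrals finite under every probability measure.\<close>

section \<open>Gaussian concentration for bounded Lipschitz functions\<close>

definition lipschitz_concentration :: "real \<Rightarrow> 'a::metric_space measure \<Rightarrow> bool" where
  "lipschitz_concentration D \<mu> \<longleftrightarrow>
     (\<forall>f L B. L-lipschitz_on UNIV f \<and> (\<forall>x. \<bar>f x\<bar> \<le> B) \<longrightarrow>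
        (\<integral>x. exp (f x) \<partial>\<mu>) \<le> exp ((\<integral>x. f x \<partial>\<mu>) + D * L\<^sup>2))"

lemma lipschitz_concentrationD:
  "lipschitz_concentration D \<mu> \<Longrightarrow> L-lipschitz_on UNIV f \<Longrightarrow> (\<And>x. \<bar>f x\<bar> \<le> B) \<Longrightarrow>
     (\<integral>x. exp (f x) \<partial>\<mu>) \<le> exp ((\<integral>x. f x \<partial>\<mu>) + D * L\<^sup>2)"
  unfolding lipschitz_concentration_def by blast

lemma (in prob_space) integrable_bounded:
  fixes f :: "'a \<Rightarrow> real"
  assumes "f \<in> borel_measurable M" "\<And>x. \<bar>f x\<bar> \<le> B"
  shows "integrable M f"
  using assms by (intro integrable_const_bound[where B = B]) auto

lemma (in prob_space) abs_expectation_le: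
  fixes f :: "'a \<Rightarrow> real"
  assumes "f \<in> borel_measurable M" "\<And>x. \<bar>f x\<bar> \<le> B"
  shows "\<bar>\<integral>x. f x \<partial>M\<bar> \<le> B"
proof -
  have "integrable M f" using assms by (rule integrable_bounded)
  then have "(\<integral>x. \<bar>f x\<bar> \<partial>M) \<le> (\<integral>x. B \<partial>M)" using assms(2) by (intro integral_mono) auto
  then show ?thesis by (intro order_trans[OF integral_abs_bound]) (simp add: prob_space)
qed

lemma (in prob_space) integral_tendsto_bounded:
  fixes f :: "nat \<Rightarrow> 'a \<Rightarrow> real"
  assumes "\<And>n. f n \<in> borel_measurable M" "g \<in> borel_measurable M" "\<And>n x. \<bar>f n x\<bar> \<le> B"
    "AE x in M. (\<lambda>n. f n x) \<longlonglongrightarrow> g x"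
  shows "(\<lambda>n. \<integral>x. f n x \<partial>M) \<longlonglongrightarrow> (\<integral>x. g x \<partial>M)"
  using assms by (intro integral_dominated_convergence[where w = "\<lambda>_. B"]) auto

text \<open>Exponential moment bounds survive bounded pointwise limits, by dominated convergence on both sides. The
  mollification, the truncation and the limit of the Euler scheme all pass through this lemma.\<close>

lemma (in prob_space) exp_moment_bound_limit:
  fixes f :: "nat \<Rightarrow> 'a \<Rightarrow> real"
  assumes f: "\<And>n. f n \<in> borel_measurable M" "g \<in> borel_measurable M" "\<And>n x. \<bar>f n x\<bar> \<le> B"
    and lim: "AE x in M. (\<lambda>n. f n x) \<longlonglongrightarrow> g x" and c: "c \<longlonglongrightarrow> c'"
    and le: "\<forall>\<^sub>F n in sequentially. (\<integral>x. exp (f n x) \<partial>M) \<le> exp ((\<integral>x. f n x \<partial>M) + c n)"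
  shows "(\<integral>x. exp (g x) \<partial>M) \<le> exp ((\<integral>x. g x \<partial>M) + c')"
proof (rule tendsto_le[OF sequentially_bot _ _ le])
  show "(\<lambda>n. exp ((\<integral>x. f n x \<partial>M) + c n)) \<longlonglongrightarrow> exp ((\<integral>x. g x \<partial>M) + c')"
    by (intro tendsto_intros c integral_tendsto_bounded[OF f lim])
  show "(\<lambda>n. (\<integral>x. exp (f n x) \<partial>M)) \<longlonglongrightarrow> (\<integral>x. exp (g x) \<partial>M)"
  proof (rule integral_tendsto_bounded[where B = "exp B"])
    show "\<bar>exp (f n x)\<bar> \<le> exp B" for n x using f(3)[of n x] by (simp add: abs_le_iff)
    show "AE x in M. (\<lambda>n. exp (f n x)) \<longlonglongrightarrow> exp (g x)"
      using lim by eventually_elim (rule tendsto_exp)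
  qed (use f in measurable)
qed

lemma (in prob_space) exp_integral_pos:
  fixes f :: "'a \<Rightarrow> real"
  assumes "f \<in> borel_measurable M" "\<And>x. \<bar>f x\<bar> \<le> B"
  shows "0 < (\<integral>x. exp (f x) \<partial>M)"
proof -
  have "exp (- B) = (\<integral>x. exp (- B) \<partial>M)" by (simp add: prob_space)
  also have "\<dots> \<le> (\<integral>x. exp (f x) \<partial>M)"
  proof (rule integral_mono)
    show "integrable M (\<lambda>x. exp (f x))"
      using assms by (intro integrable_bounded[where B = "exp B"]) (auto simp: abs_le_iff)
    show "exp (- B) \<le> exp (f x)" for x using assms(2)[of x] by (simp add: abs_le_iff)
  qed auto
  finally show ?thesis by (rule less_le_trans[rotated]) simp
qed

lemma (in prob_space) ln_exp_moment_iff: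
  fixes f :: "'a \<Rightarrow> real"
  assumes "f \<in> borel_measurable M" "\<And>x. \<bar>f x\<bar> \<le> B"
  shows "ln (\<integral>x. exp (f x - (\<integral>y. f y \<partial>M)) \<partial>M) \<le> c \<longleftrightarrow> (\<integral>x. exp (f x) \<partial>M) \<le> exp ((\<integral>x. f x \<partial>M) + c)"
proof -
  have pos: "0 < (\<integral>x. exp (f x) \<partial>M)" by (rule exp_integral_pos[OF assms])
  have "(\<integral>x. exp (f x - (\<integral>y. f y \<partial>M)) \<partial>M) = (\<integral>x. exp (f x) \<partial>M) / exp (\<integral>y. f y \<partial>M)"
    by (simp add: exp_diff)
  moreover have "ln ((\<integral>x. exp (f x) \<partial>M) / exp (\<integral>y. f y \<partial>M)) = ln (\<integral>x. exp (f x) \<partial>M) - (\<integral>y. f y \<partial>M)"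
    using pos by (subst ln_div) auto
  moreover have "ln (\<integral>x. exp (f x) \<partial>M) \<le> (\<integral>y. f y \<partial>M) + c \<longleftrightarrow> (\<integral>x. exp (f x) \<partial>M) \<le> exp ((\<integral>x. f x \<partial>M) + c)"
    using pos by (metis exp_gt_zero exp_ln ln_exp ln_le_cancel_iff)
  ultimately show ?thesis by (simp add: diff_le_eq add.commute)
qed

lemma lipschitz_measurable: "L-lipschitz_on UNIV f \<Longrightarrow> f \<in> borel_measurable borel"
  by (intro borel_measurable_continuous_onI lipschitz_on_continuous_on)

text \<open>Averaging translates of \<open>f\<close> against a smooth bump of radius \<open>\<epsilon>\<close> cannot increase the Lipschitz constant
  and moves values by at most \<open>L \<epsilon>\<close>. The translation form of the average shows these two bounds, the
  convolution form shows smoothness; they agree because the bump is even.\<close>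

lemma mollification:
  fixes f :: "real ^ 'n \<Rightarrow> real"
  assumes f: "L-lipschitz_on UNIV f" and supp: "compact (closure {x. f x \<noteq> 0})" and \<epsilon>: "0 < \<epsilon>"
  obtains F where "smooth F" "compact (closure {x. F x \<noteq> 0})" "L-lipschitz_on UNIV F"
    "\<And>x. \<bar>F x - f x\<bar> \<le> L * \<epsilon>"
proof -
  define \<rho> :: "real ^ 'n \<Rightarrow> real" where "\<rho> z = flat 0 (\<epsilon>\<^sup>2 - z \<bullet> z)" for z
  have \<rho>C: "C_k k \<rho>" for k unfolding \<rho>_def by (rule C_k_flat_radial)
  have c\<rho>: "continuous_on UNIV \<rho>" using \<rho>C C_k_continuous by blast
  have \<rho>0: "0 \<le> \<rho> z" for z by (simp add: \<rho>_def flat_nonneg)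
  have \<rho>supp: "norm z < \<epsilon>" if "\<rho> z \<noteq> 0" for z
  proof -
    have "(norm z)\<^sup>2 < \<epsilon>\<^sup>2" using that by (auto simp: \<rho>_def flat_def power2_norm_eq_inner split: if_splits)
    then show ?thesis using \<epsilon> by (simp add: power2_less_imp_less)
  qed
  have cf: "continuous_on UNIV f" using f lipschitz_on_continuous_on by blast
  have int: "integrable lborel (\<lambda>z. g z * \<rho> z)" if "continuous_on UNIV g" for g
  proof -
    have "integrable lborel (\<lambda>z. indicator (cball 0 \<epsilon>) z *\<^sub>R (g z * \<rho> z))"
      by (intro borel_integrable_compact continuous_intros continuous_on_subset[OF that] continuous_on_subset[OF c\<rho>]) auto
    moreover have "indicator (cball 0 \<epsilon>) z *\<^sub>R (g z * \<rho> z) = g z * \<rho> z" for z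
      using \<rho>supp[of z] by (cases "\<rho> z = 0") (auto simp: indicator_def)
    ultimately show ?thesis by (simp only:)
  qed
  define c where "c = (\<integral>z. \<rho> z \<partial>lborel)"
  have c: "0 < c"
  proof -
    define m where "m = exp (- (1 / (\<epsilon>\<^sup>2 / 2)))"
    have meas: "measure lborel (ball (0 :: real ^ 'n) (\<epsilon> / 2)) > 0" using \<epsilon> by (simp add: content_ball_pos)
    have "0 < m * measure lborel (ball (0 :: real ^ 'n) (\<epsilon> / 2))" using meas by (simp add: m_def)
    also have "\<dots> = (\<integral>z. m * indicator (ball (0 :: real ^ 'n) (\<epsilon> / 2)) z \<partial>lborel)" by simp
    also have "\<dots> \<le> c" unfolding c_def
    proof (rule integral_mono)
      show "integrable lborel (\<lambda>z. m * indicator (ball (0 :: real ^ 'n) (\<epsilon> / 2)) z)"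
        by (auto intro!: integrable_real_indicator emeasure_bounded_finite)
      show "integrable lborel \<rho>" using int[of "\<lambda>_. 1"] by simp
      fix z
      show "m * indicator (ball 0 (\<epsilon> / 2)) z \<le> \<rho> z"
      proof (cases "z \<in> ball 0 (\<epsilon> / 2)")
        case True
        then have "(norm z)\<^sup>2 \<le> (\<epsilon> / 2)\<^sup>2" by (intro power_mono) auto
        moreover have "\<epsilon>\<^sup>2 > 0" using \<epsilon> by simp
        moreover have "(\<epsilon> / 2)\<^sup>2 = \<epsilon>\<^sup>2 / 4" by (simp add: power_divide)
        ultimately have q: "\<epsilon>\<^sup>2 / 2 \<le> \<epsilon>\<^sup>2 - z \<bullet> z" "0 < \<epsilon>\<^sup>2 / 2" unfolding power2_norm_eq_inner by linarith+
        then have "1 / (\<epsilon>\<^sup>2 - z \<bullet> z) \<le> 1 / (\<epsilon>\<^sup>2 / 2)" by (intro divide_left_mono mult_pos_pos) linarith+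
        moreover have "0 < \<epsilon>\<^sup>2 - z \<bullet> z" using q by linarith
        ultimately show ?thesis using True unfolding \<rho>_def flat_def m_def by simp
      qed (use \<rho>0 in auto)
    qed
    finally show ?thesis .
  qed
  define F where "F x = (\<integral>z. f (x + z) * \<rho> z \<partial>lborel) / c" for x
  have cfx: "continuous_on UNIV (\<lambda>z. f (x + z))" for x
    by (intro continuous_on_compose2[OF cf] continuous_intros) auto
  have F_diff: "F x - y = (\<integral>z. (f (x + z) - y) * \<rho> z \<partial>lborel) / c" for x y
    using c int[OF cfx[of x]] int[of "\<lambda>_. y"]
    by (simp add: F_def left_diff_distrib diff_divide_distrib c_def)
  have bound: "\<bar>(\<integral>z. g z * \<rho> z \<partial>lborel) / c\<bar> \<le> K"
    if g: "continuous_on UNIV g" and K: "\<And>z. \<rho> z \<noteq> 0 \<Longrightarrow> \<bar>g z\<bar> \<le> K" for g K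
  proof -
    have "\<bar>\<integral>z. g z * \<rho> z \<partial>lborel\<bar> \<le> (\<integral>z. K * \<rho> z \<partial>lborel)"
    proof (rule integral_abs_bound[THEN order_trans], rule integral_mono)
      show "\<bar>g z * \<rho> z\<bar> \<le> K * \<rho> z" for z
        using K[of z] \<rho>0[of z] by (cases "\<rho> z = 0") (auto simp: abs_mult intro!: mult_right_mono)
    qed (use int[OF g] int[of "\<lambda>_. K"] in auto)
    also have "\<dots> = K * c" by (simp add: c_def)
    finally show ?thesis using c by (simp add: abs_divide divide_le_eq)
  qed
  have L0: "0 \<le> L" using f lipschitz_on_nonneg by blast
  obtain R where R: "\<And>x. f x \<noteq> 0 \<Longrightarrow> norm x \<le> R"
  proof -
    have "bounded {x. f x \<noteq> 0}" using supp bounded_subset[OF compact_imp_bounded closure_subset] by blast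
    then show ?thesis using that unfolding bounded_iff by blast
  qed
  show ?thesis
  proof (rule that[of F])
    show "\<bar>F x - f x\<bar> \<le> L * \<epsilon>" for x
      unfolding F_diff
    proof (rule bound)
      show "continuous_on UNIV (\<lambda>z. f (x + z) - f x)" by (intro continuous_intros cfx)
      fix z assume "\<rho> z \<noteq> 0"
      then have "norm z \<le> \<epsilon>" using \<rho>supp by (simp add: less_imp_le)
      then have "L * norm z \<le> L * \<epsilon>" using L0 by (rule mult_left_mono)
      then show "\<bar>f (x + z) - f x\<bar> \<le> L * \<epsilon>"
        using lipschitz_on_normD[OF f, of "x + z" x] by simp
    qed
    show "L-lipschitz_on UNIV F"
    proof (rule lipschitz_onI[OF _ L0])
      fix x y
      have "F x - F y = (\<integral>z. (f (x + z) - f (y + z)) * \<rho> z \<partial>lborel) / c"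
        using c int[OF cfx[of x]] int[OF cfx[of y]]
        by (simp add: F_def left_diff_distrib diff_divide_distrib)
      also have "\<bar>\<dots>\<bar> \<le> L * dist x y"
      proof (rule bound)
        show "continuous_on UNIV (\<lambda>z. f (x + z) - f (y + z))" by (intro continuous_intros cfx)
        show "\<bar>f (x + z) - f (y + z)\<bar> \<le> L * dist x y" for z
          using lipschitz_onD[OF f, of "x + z" "y + z"] by (simp add: dist_real_def)
      qed
      finally show "dist (F x) (F y) \<le> L * dist x y" by (simp add: dist_real_def)
    qed
    show "compact (closure {x. F x \<noteq> 0})"
    proof (rule compact_closure_subset[of "cball 0 (R + \<epsilon>)"])
      show "{x. F x \<noteq> 0} \<subseteq> closure (cball 0 (R + \<epsilon>))"
      proof safe
        fix x assume "F x \<noteq> 0"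
        moreover have "F x = 0" if "\<And>z. f (x + z) * \<rho> z = 0" unfolding F_def that by simp
        ultimately have "\<exists>z. f (x + z) * \<rho> z \<noteq> 0" by blast
        then obtain z where "f (x + z) \<noteq> 0" "\<rho> z \<noteq> 0" by auto
        then show "x \<in> closure (cball 0 (R + \<epsilon>))"
          using R[of "x + z"] \<rho>supp[of z] norm_triangle_ineq4[of "x + z" z] by simp
      qed
    qed simp
    obtain a b where ab: "cball (0 :: real ^ 'n) R \<subseteq> cbox a b"
      using bounded_subset_cbox_symmetric[OF bounded_cball] by metis
    have "F = (\<lambda>x. integral (cbox a b) (\<lambda>y. f y * \<rho> (x - y)) * (1 / c))"
    proof
      fix x
      have "(\<integral>z. f (x + z) * \<rho> z \<partial>lborel) = (\<integral>y. f y * \<rho> (y - x) \<partial>distr lborel borel ((+) x))"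
        using cf c\<rho> by (subst integral_distr)
          (auto intro!: borel_measurable_continuous_onI continuous_intros continuous_on_compose2[OF c\<rho>])
      also have "\<dots> = (\<integral>y. indicator (cbox a b) y *\<^sub>R (f y * \<rho> (x - y)) \<partial>lborel)"
        unfolding lborel_distr_plus
      proof (rule Bochner_Integration.integral_cong[OF refl])
        fix y
        show "f y * \<rho> (y - x) = indicator (cbox a b) y *\<^sub>R (f y * \<rho> (x - y))"
          using R[of y] ab by (cases "f y = 0") (auto simp: \<rho>_def algebra_simps inner_diff_left inner_diff_right inner_commute)
      qed
      also have "\<dots> = integral (cbox a b) (\<lambda>y. f y * \<rho> (x - y))"
        unfolding set_lebesgue_integral_def[symmetric]
      proof (rule set_borel_integral_eq_integral(2))
        show "set_integrable lborel (cbox a b) (\<lambda>y. f y * \<rho> (x - y))"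
          unfolding set_integrable_def
          by (intro borel_integrable_compact compact_cbox continuous_on_mult continuous_on_subset[OF cf]
              continuous_on_compose2[OF c\<rho>] continuous_intros) auto
      qed
      finally show "F x = integral (cbox a b) (\<lambda>y. f y * \<rho> (x - y)) * (1 / c)" by (simp add: F_def)
    qed
    then show "smooth F"
      unfolding smooth_def by (simp only:) (intro allI C_k_mult C_k_const C_k_convolution[OF cf \<rho>C])
  qed
qed

text \<open>Smooth compactly supported functions approximate bounded Lipschitz ones without loss in the constant.
  A compactly supported Lipschitz function is mollified. A function bounded by \<open>B\<close> is first multiplied by a
  cutoff of slope \<open>\<delta>\<close>, which raises the Lipschitz constant only by \<open>B \<delta>\<close>, and \<open>\<delta>\<close> tends to \<open>0\<close>.\<close>

lemma GCBS_iff_lipschitz_concentration: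
  fixes \<mu> :: "(real ^ 'n) measure"
  assumes "prob_space \<mu>" and sets: "sets \<mu> = sets borel"
  shows "GCBS D \<mu> \<longleftrightarrow> 0 \<le> D \<and> lipschitz_concentration D \<mu>"
proof -
  interpret prob_space \<mu> by fact
  have meas: "f \<in> borel_measurable \<mu>" if "L-lipschitz_on UNIV f" for f :: "real ^ 'n \<Rightarrow> real" and L
    using lipschitz_measurable[OF that] measurable_cong_sets[OF sets refl] by blast
  have smooth_props: "\<exists>L B. L-lipschitz_on UNIV f \<and> (\<forall>x. \<bar>f x\<bar> \<le> B)"
    if f: "smooth f" "compact (closure {x. f x \<noteq> 0})" for f :: "real ^ 'n \<Rightarrow> real"
    using compact_support_lipschitz[of f] compact_support_bounded[of f] f C_k_continuous[of 0 f]
    unfolding smooth_def real_norm_def by metis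
  show ?thesis
  proof safe
    assume D: "0 \<le> D" and conc: "lipschitz_concentration D \<mu>"
    show "GCBS D \<mu>" unfolding GCBS_def
    proof (intro conjI D allI impI, elim conjE)
      fix f :: "real ^ 'n \<Rightarrow> real" assume f: "smooth f" "compact (closure {x. f x \<noteq> 0})"
      then obtain L B where LB: "L-lipschitz_on UNIV f" "\<And>x. \<bar>f x\<bar> \<le> B" using smooth_props by blast
      show "ln (\<integral>x. exp (f x - (\<integral>y. f y \<partial>\<mu>)) \<partial>\<mu>) \<le> D * (lip f)\<^sup>2"
        unfolding ln_exp_moment_iff[OF meas[OF LB(1)] LB(2)]
        using lipschitz_concentrationD[OF conc lip_is_lipschitz(1)[OF LB(1)] LB(2)] .
    qed
  next
    assume G: "GCBS D \<mu>"
    show D: "0 \<le> D" using G unfolding GCBS_def by blast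
    have 1: "(\<integral>x. exp (f x) \<partial>\<mu>) \<le> exp ((\<integral>x. f x \<partial>\<mu>) + D * L\<^sup>2)"
      if f: "smooth f" "compact (closure {x. f x \<noteq> 0})" and L: "L-lipschitz_on UNIV f" for f :: "real ^ 'n \<Rightarrow> real" and L
    proof -
      obtain B where B: "\<And>x. \<bar>f x\<bar> \<le> B" using smooth_props[OF f] by blast
      have "ln (\<integral>x. exp (f x - (\<integral>y. f y \<partial>\<mu>)) \<partial>\<mu>) \<le> D * (lip f)\<^sup>2" using G f unfolding GCBS_def by blast
      also have "\<dots> \<le> D * L\<^sup>2"
        using D lip_is_lipschitz[OF L] lipschitz_on_nonneg by (intro mult_left_mono power_mono) blast+
      finally show ?thesis unfolding ln_exp_moment_iff[OF meas[OF L] B] .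
    qed
    have 2: "(\<integral>x. exp (f x) \<partial>\<mu>) \<le> exp ((\<integral>x. f x \<partial>\<mu>) + D * L\<^sup>2)"
      if L: "L-lipschitz_on UNIV f" and supp: "compact (closure {x. f x \<noteq> 0})" for f :: "real ^ 'n \<Rightarrow> real" and L
    proof -
      have "\<exists>F. smooth F \<and> compact (closure {x. F x \<noteq> 0}) \<and> L-lipschitz_on UNIV F
          \<and> (\<forall>x. \<bar>F x - f x\<bar> \<le> L * (1 / real (Suc n)))" for n
        using mollification[OF L supp, of "1 / real (Suc n)"] by (metis of_nat_0_less_iff zero_less_Suc zero_less_divide_1_iff)
      then obtain F where F: "\<And>n. smooth (F n)" "\<And>n. compact (closure {x. F n x \<noteq> 0})"
        "\<And>n. L-lipschitz_on UNIV (F n)" "\<And>n x. \<bar>F n x - f x\<bar> \<le> L * (1 / real (Suc n))"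
        by metis
      obtain B where B: "\<And>x. norm (f x) \<le> B"
        using compact_support_bounded[OF lipschitz_on_continuous_on[OF L] supp] by blast
      have L0: "0 \<le> L" using L lipschitz_on_nonneg by blast
      show ?thesis
      proof (rule exp_moment_bound_limit[where f = F and B = "B + L"])
        show "\<bar>F n x\<bar> \<le> B + L" for n x
        proof -
          have "L * (1 / real (Suc n)) \<le> L * 1" using L0 by (intro mult_left_mono) auto
          then show ?thesis using F(4)[of n x] B[of x] by simp
        qed
        have "(\<lambda>n. F n x) \<longlonglongrightarrow> f x" for x
        proof (rule LIM_zero_cancel, rule tendsto_rabs_zero_cancel, rule tendsto_sandwich[OF _ _ tendsto_const])
          show "(\<lambda>n. L * (1 / real (Suc n))) \<longlonglongrightarrow> 0"
            using tendsto_mult[OF tendsto_const[of L] LIMSEQ_inverse_real_of_nat] by (simp add: inverse_eq_divide)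
        qed (use F(4) in auto)
        then show "AE x in \<mu>. (\<lambda>n. F n x) \<longlonglongrightarrow> f x" by simp
        show "(\<lambda>_. D * L\<^sup>2) \<longlonglongrightarrow> D * L\<^sup>2" by simp
      qed (use F L meas 1 in auto)
    qed
    show "lipschitz_concentration D \<mu>" unfolding lipschitz_concentration_def
    proof (intro allI impI, elim conjE)
      fix f :: "real ^ 'n \<Rightarrow> real" and L B assume L: "L-lipschitz_on UNIV f" and B: "\<forall>x. \<bar>f x\<bar> \<le> B"
      have B0: "0 \<le> B" using B abs_ge_zero order_trans by blast
      have L0: "0 \<le> L" using L lipschitz_on_nonneg by blast
      \<comment> \<open>The cutoff equals \<open>1\<close> for \<open>|x| \<le> n + 1\<close> and \<open>0\<close> for \<open>|x| \<ge> 2 (n + 1)\<close>.\<close>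
      define \<theta> where "\<theta> n x = max 0 (min 1 (2 - norm x / real (Suc n)))" for n and x :: "real ^ 'n"
      have \<theta>: "0 \<le> \<theta> n x" "\<theta> n x \<le> 1" for n x by (auto simp: \<theta>_def)
      have \<theta>_lip: "\<bar>\<theta> n x - \<theta> n y\<bar> \<le> 1 / real (Suc n) * norm (x - y)" for n x y
      proof -
        have "\<bar>\<theta> n x - \<theta> n y\<bar> \<le> \<bar>norm x / real (Suc n) - norm y / real (Suc n)\<bar>" by (auto simp: \<theta>_def)
        also have "\<dots> = \<bar>norm x - norm y\<bar> / real (Suc n)" by (simp add: diff_divide_distrib[symmetric])
        also have "\<dots> \<le> norm (x - y) / real (Suc n)" by (intro divide_right_mono norm_triangle_ineq3) auto
        finally show ?thesis by simp
      qed
      define L' where "L' n = L + B * (1 / real (Suc n))" for n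
      have L': "(L' n)-lipschitz_on UNIV (\<lambda>x. f x * \<theta> n x)" for n
      proof (rule lipschitz_onI)
        show "0 \<le> L' n" using L0 B0 by (simp add: L'_def)
        fix x y
        have "\<bar>f x * \<theta> n x - f y * \<theta> n y\<bar> = \<bar>(f x - f y) * \<theta> n x + f y * (\<theta> n x - \<theta> n y)\<bar>" by (simp add: algebra_simps)
        also have "\<dots> \<le> \<bar>f x - f y\<bar> * \<theta> n x + \<bar>f y\<bar> * \<bar>\<theta> n x - \<theta> n y\<bar>"
          using \<theta>(1)[of n x] by (intro abs_triangle_ineq[THEN order_trans]) (simp add: abs_mult)
        also have "\<dots> \<le> (L * norm (x - y)) * 1 + B * (1 / real (Suc n) * norm (x - y))"
          using lipschitz_on_normD[OF L, of x y] B \<theta>[of n] \<theta>_lip[of n x y] L0 B0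
          by (intro add_mono mult_mono) auto
        finally show "dist (f x * \<theta> n x) (f y * \<theta> n y) \<le> L' n * dist x y"
          by (simp add: dist_norm L'_def algebra_simps)
      qed
      show "(\<integral>x. exp (f x) \<partial>\<mu>) \<le> exp ((\<integral>x. f x \<partial>\<mu>) + D * L\<^sup>2)"
      proof (rule exp_moment_bound_limit[where f = "\<lambda>n x. f x * \<theta> n x" and B = B and c = "\<lambda>n. D * (L' n)\<^sup>2"])
        show "\<bar>f x * \<theta> n x\<bar> \<le> B" for n x
          using mult_mono[of "\<bar>f x\<bar>" B "\<theta> n x" 1] B B0 \<theta>[of n x] by (simp add: abs_mult)
        have "(\<lambda>n. f x * \<theta> n x) \<longlonglongrightarrow> f x" for x
        proof -
          obtain N where N: "norm x \<le> real N" using real_arch_simple by blast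
          have "\<theta> n x = 1" if "n \<ge> N" for n
          proof -
            have "norm x \<le> real (Suc n)" using N that by linarith
            then have "norm x / real (Suc n) \<le> 1" by simp
            then show ?thesis unfolding \<theta>_def by simp
          qed
          then have "\<forall>\<^sub>F n in sequentially. f x = f x * \<theta> n x" by (auto simp: eventually_sequentially)
          then show ?thesis by (rule Lim_transform_eventually[OF tendsto_const])
        qed
        then show "AE x in \<mu>. (\<lambda>n. f x * \<theta> n x) \<longlonglongrightarrow> f x" by simp
        have "L' \<longlonglongrightarrow> L + B * 0" unfolding L'_def
          using LIMSEQ_inverse_real_of_nat by (intro tendsto_intros) (simp add: inverse_eq_divide)
        then show "(\<lambda>n. D * (L' n)\<^sup>2) \<longlonglongrightarrow> D * L\<^sup>2" by (auto intro!: tendsto_intros)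
        show "\<forall>\<^sub>F n in sequentially. (\<integral>x. exp (f x * \<theta> n x) \<partial>\<mu>) \<le> exp ((\<integral>x. f x * \<theta> n x \<partial>\<mu>) + D * (L' n)\<^sup>2)"
        proof (intro always_eventually allI 2 L')
          fix n
          show "compact (closure {x. f x * \<theta> n x \<noteq> 0})"
          proof (rule compact_closure_subset[of "cball 0 (2 * real (Suc n))"])
            show "{x. f x * \<theta> n x \<noteq> 0} \<subseteq> closure (cball 0 (2 * real (Suc n)))"
              by (auto simp: \<theta>_def max_def min_def divide_simps split: if_splits)
          qed simp
        qed
      qed (use meas L L' in auto)
    qed
  qed
qed

section \<open>Resolvents of a dissipative drift and the implicit Euler scheme\<close>

lemma C1_field_has_derivative:
  assumes "C1_field b"
  shows "(b has_derivative frechet_derivative b (at x)) (at x)"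
  using assms unfolding C1_field_def
  by (metis differentiableI frechet_derivative_works)

lemma C1_field_continuous: "C1_field b \<Longrightarrow> continuous_on S b"
  by (meson C1_field_has_derivative continuous_at_imp_continuous_on has_derivative_continuous)

text \<open>The derivative is bounded on a compact set, and convexity makes the mean value inequality available.\<close>

lemma C1_field_lipschitz_on:
  fixes b :: "real ^ 'n \<Rightarrow> real ^ 'n"
  assumes "C1_field b" "compact K" "convex K"
  obtains L where "0 \<le> L" "\<And>x y. x \<in> K \<Longrightarrow> y \<in> K \<Longrightarrow> norm (b x - b y) \<le> L * norm (x - y)"
proof -
  obtain D :: "real ^ 'n \<Rightarrow> (real ^ 'n) \<Rightarrow>\<^sub>L (real ^ 'n)"
    where D: "\<And>x. (b has_derivative blinfun_apply (D x)) (at x)" and cD: "continuous_on UNIV D"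
    using assms(1) unfolding C1_field_def by blast
  have "compact (D ` K)"
    using assms(2) cD compact_continuous_image continuous_on_subset by blast
  then have "bounded (D ` K)" by (rule compact_imp_bounded)
  then obtain L where L: "L > 0" "\<And>x. x \<in> K \<Longrightarrow> norm (D x) \<le> L"
    unfolding bounded_pos by auto
  have "norm (b x - b y) \<le> L * norm (x - y)" if "x \<in> K" "y \<in> K" for x y
    using that assms(3) L D
    by (intro differentiable_bound[of K b "\<lambda>x. blinfun_apply (D x)"])
      (auto simp: norm_blinfun.rep_eq[symmetric] intro: has_derivative_at_withinI)
  then show ?thesis using L(1) that[of L] by auto
qed

text \<open>Mean value theorem for \<open>s \<mapsto> \<langle>b (y + s (x - y)), x - y\<rangle>\<close>: the infinitesimal condition on the
  differential integrates along segments.\<close>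

lemma dissipative_one_sided:
  assumes "C1_field b" "dissipative \<kappa> b"
  shows "(b x - b y) \<bullet> (x - y) \<le> - \<kappa> * (norm (x - y))\<^sup>2"
proof -
  define u where "u = x - y"
  define g where "g s = b (y + s *\<^sub>R u) \<bullet> u" for s :: real
  have d: "(g has_derivative (\<lambda>h. frechet_derivative b (at (y + s *\<^sub>R u)) (h *\<^sub>R u) \<bullet> u))
      (at s within {0..1})" for s
  proof -
    have "((\<lambda>s. y + s *\<^sub>R u) has_derivative (\<lambda>h. h *\<^sub>R u)) (at s within {0..1})"
      by (auto intro!: derivative_eq_intros)
    from has_derivative_inner_left[OF has_derivative_compose[OF this C1_field_has_derivative[OF assms(1)]], of u]
    show ?thesis by (simp add: g_def[abs_def])
  qed
  obtain s where s: "g 1 - g 0 = frechet_derivative b (at (y + s *\<^sub>R u)) ((1 - 0) *\<^sub>R u) \<bullet> u"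
    using mvt_very_simple[of 0 1 g, OF _ d] by auto
  then have "g 1 - g 0 \<le> - \<kappa> * (norm u)\<^sup>2"
    using assms(2) unfolding dissipative_def by simp
  then show ?thesis by (simp add: g_def u_def inner_diff_left)
qed

locale dissipative_drift =
  fixes b :: "real ^ 'n \<Rightarrow> real ^ 'n" and \<kappa> :: real
  assumes C1: "C1_field b" and diss: "dissipative \<kappa> b"
begin

lemma one_sided: "(b x - b y) \<bullet> (x - y) \<le> - \<kappa> * (norm (x - y))\<^sup>2"
  using dissipative_one_sided[OF C1 diss] .

lemma continuous_b [continuous_intros]:
  "continuous_on S f \<Longrightarrow> continuous_on S (\<lambda>x. b (f x))"
  using C1_field_continuous[OF C1] continuous_on_compose2 by blast

text \<open>Cauchy-Schwarz after pairing the difference of \<open>x - h b x\<close> and \<open>y - h b y\<close> with \<open>x - y\<close>.\<close>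

lemma implicit_expansive:
  assumes "0 \<le> h"
  shows "(1 + h * \<kappa>) * norm (x - y) \<le> norm ((x - h *\<^sub>R b x) - (y - h *\<^sub>R b y))"
proof (cases "x = y")
  case False
  have "(1 + h * \<kappa>) * (norm (x - y))\<^sup>2 \<le> ((x - h *\<^sub>R b x) - (y - h *\<^sub>R b y)) \<bullet> (x - y)"
  proof -
    have "((x - h *\<^sub>R b x) - (y - h *\<^sub>R b y)) \<bullet> (x - y)
        = (norm (x - y))\<^sup>2 - h * ((b x - b y) \<bullet> (x - y))"
      by (simp add: power2_norm_eq_inner algebra_simps inner_diff_left inner_diff_right)
    moreover have "h * ((b x - b y) \<bullet> (x - y)) \<le> h * (- \<kappa> * (norm (x - y))\<^sup>2)"
      using one_sided assms by (rule mult_left_mono)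
    ultimately show ?thesis by (simp add: algebra_simps)
  qed
  also have "\<dots> \<le> norm ((x - h *\<^sub>R b x) - (y - h *\<^sub>R b y)) * norm (x - y)"
    by (rule norm_cauchy_schwarz)
  finally have "(1 + h * \<kappa>) * norm (x - y) * norm (x - y)
      \<le> norm ((x - h *\<^sub>R b x) - (y - h *\<^sub>R b y)) * norm (x - y)"
    by (simp add: power2_eq_square mult.assoc)
  then show ?thesis using False by (simp add: mult_le_cancel_right)
qed auto

text \<open>The map \<open>z \<mapsto> z - h b z\<close> is strongly monotone and continuous, hence onto. In finite dimension
  Brouwer's theorem suffices: if \<open>G z = z - h b z - y\<close> had no zero, the map \<open>z \<mapsto> - R G z / |G z|\<close> would
  have a fixed point on the sphere of radius \<open>R\<close>, where \<open>\<langle>G z, z\<rangle> < 0\<close>, whereas strong monotonicity makes this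
  product positive for large \<open>R\<close>.\<close>

lemma implicit_solvable:
  assumes "0 \<le> h" "0 < 1 + h * \<kappa>"
  shows "\<exists>z. z - h *\<^sub>R b z = y"
proof (rule ccontr)
  assume no: "\<nexists>z. z - h *\<^sub>R b z = y"
  define G where "G z = z - h *\<^sub>R b z - y" for z
  have G0: "G z \<noteq> 0" for z using no by (auto simp: G_def)
  \<comment> \<open>This radius makes \<open>\<langle>G z, z\<rangle> \<ge> (1 + h \<kappa>) R\<^sup>2 - |G 0| R\<close> positive on the sphere.\<close>
  define R where "R = norm (G 0) / (1 + h * \<kappa>) + 1"
  have R: "R > 0" "norm (G 0) < (1 + h * \<kappa>) * R"
    using assms(2) by (simp_all add: R_def distrib_left add_nonneg_pos)
  have cG: "continuous_on S G" for S unfolding G_def by (intro continuous_intros)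
  have "continuous_on (cball 0 R) (\<lambda>z. - (R / norm (G z)) *\<^sub>R G z)"
    using G0 by (intro continuous_intros cG) auto
  moreover have "(\<lambda>z. - (R / norm (G z)) *\<^sub>R G z) \<in> cball 0 R \<rightarrow> cball 0 R"
    using R(1) G0 by auto
  ultimately obtain z where z: "- (R / norm (G z)) *\<^sub>R G z = z"
    using brouwer_ball[OF R(1)] by blast
  have nz: "norm z = R" using R(1) G0 arg_cong[OF z, of norm] by simp
  have "(G z - G 0) \<bullet> z = (norm z)\<^sup>2 - h * ((b z - b 0) \<bullet> (z - 0))"
    by (simp add: G_def power2_norm_eq_inner algebra_simps inner_diff_left inner_diff_right)
  moreover have "h * ((b z - b 0) \<bullet> (z - 0)) \<le> h * (- \<kappa> * (norm (z - 0))\<^sup>2)"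
    using one_sided assms(1) by (rule mult_left_mono)
  ultimately have "(1 + h * \<kappa>) * R\<^sup>2 \<le> (G z - G 0) \<bullet> z"
    using nz by (simp add: algebra_simps)
  moreover have "- (G 0 \<bullet> z) \<le> norm (G 0) * R"
    using norm_cauchy_schwarz[of "- G 0" z] nz by simp
  moreover have "norm (G 0) * R < (1 + h * \<kappa>) * R * R"
    using R by simp
  ultimately have pos: "0 < G z \<bullet> z"
    by (simp add: inner_diff_left power2_eq_square)
  have "G z \<bullet> z = - (R / norm (G z)) * (G z \<bullet> G z)"
    by (subst (2) z[symmetric]) simp
  also have "\<dots> \<le> 0" using R(1) by (simp add: divide_nonneg_nonneg)
  finally show False using pos by simp
qed

text \<open>Outside the range \<open>0 \<le> h\<close>, \<open>0 < 1 + h \<kappa>\<close> the identity is a placeholder that keeps the function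
  continuous, hence measurable, for every \<open>h\<close>. For a fixed time \<open>t \<ge> 0\<close>, the steps \<open>t / n\<close> leave this range only for
  finitely many \<open>n\<close>.\<close>

definition resolvent :: "real \<Rightarrow> real ^ 'n \<Rightarrow> real ^ 'n" where
  "resolvent h y = (if 0 \<le> h \<and> 0 < 1 + h * \<kappa> then (THE z. z - h *\<^sub>R b z = y) else y)"

lemma resolvent_eqI:
  assumes "0 \<le> h" "0 < 1 + h * \<kappa>" "z - h *\<^sub>R b z = y"
  shows "resolvent h y = z"
proof -
  have "z' = z" if "z' - h *\<^sub>R b z' = y" for z'
    using implicit_expansive[OF assms(1), of z' z] that assms
    by (simp add: mult_le_0_iff)
  then have "(THE z. z - h *\<^sub>R b z = y) = z" using assms(3) by (rule the_equality[rotated])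
  then show ?thesis unfolding resolvent_def using assms(1,2) by simp
qed

lemma resolvent_works:
  assumes "0 \<le> h" "0 < 1 + h * \<kappa>"
  shows "resolvent h y - h *\<^sub>R b (resolvent h y) = y"
  using implicit_solvable[OF assms, of y] resolvent_eqI[OF assms] by metis

lemma resolvent_lipschitz:
  assumes "0 \<le> h" "0 < 1 + h * \<kappa>"
  shows "norm (resolvent h x - resolvent h y) \<le> norm (x - y) / (1 + h * \<kappa>)"
  using implicit_expansive[OF assms(1), of "resolvent h x" "resolvent h y"] assms(2)
  unfolding resolvent_works[OF assms] by (simp add: pos_le_divide_eq mult.commute)

lemma continuous_resolvent: "continuous_on S (resolvent h)"
proof (cases "0 \<le> h \<and> 0 < 1 + h * \<kappa>")
  case True
  then have "(1 / (1 + h * \<kappa>))-lipschitz_on S (resolvent h)"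
    using resolvent_lipschitz by (auto intro!: lipschitz_onI simp: dist_norm)
  then show ?thesis by (rule lipschitz_on_continuous_on)
next
  case False
  then have "resolvent h = (\<lambda>y. y)" unfolding resolvent_def by (auto simp: fun_eq_iff)
  then show ?thesis by simp
qed

end

text \<open>The scheme is kept generic in the maps \<open>J k\<close> and the increments \<open>z k\<close>: the identity maps give random
  walks, and varying the maps allows two step sizes in one run.\<close>

primrec chain :: "(nat \<Rightarrow> 'a \<Rightarrow> 'a) \<Rightarrow> (nat \<Rightarrow> 'a) \<Rightarrow> 'a::plus \<Rightarrow> nat \<Rightarrow> 'a" where
  "chain J z x 0 = x"
| "chain J z x (Suc k) = J k (chain J z x k + z k)"

lemma chain_add: "chain J z x (n + m) = chain (\<lambda>k. J (n + k)) (\<lambda>k. z (n + k)) (chain J z x n) m"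
  by (induction m) auto

lemma chain_cong:
  "(\<And>k. k < m \<Longrightarrow> J k = J' k) \<Longrightarrow> (\<And>k. k < m \<Longrightarrow> z k = z' k) \<Longrightarrow> chain J z x m = chain J' z' x m"
  by (induction m) auto

text \<open>The integrated equation \<open>dX = b(X) dt + dv\<close> for a fixed driving path \<open>v\<close>.\<close>

definition solves :: "(real ^ 'n \<Rightarrow> real ^ 'n) \<Rightarrow> (real \<Rightarrow> real ^ 'n) \<Rightarrow> real ^ 'n \<Rightarrow> real
    \<Rightarrow> (real \<Rightarrow> real ^ 'n) \<Rightarrow> bool" where
  "solves b v x T X \<longleftrightarrow> continuous_on {0..T} X \<and>
     (\<forall>t\<in>{0..T}. X t = x + integral {0..t} (\<lambda>s. b (X s)) + (v t - v 0))"

context dissipative_drift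
begin

definition implicit_euler :: "(real \<Rightarrow> real ^ 'n) \<Rightarrow> real \<Rightarrow> nat \<Rightarrow> real ^ 'n \<Rightarrow> real ^ 'n" where
  "implicit_euler v t n x =
     chain (\<lambda>_. resolvent (t / n)) (\<lambda>k. v (real (Suc k) * (t / n)) - v (real k * (t / n))) x n"

lemma chain_resolvent_lipschitz:
  assumes "0 \<le> h" "0 < 1 + h * \<kappa>"
  shows "norm (chain (\<lambda>_. resolvent h) z x k - chain (\<lambda>_. resolvent h) z y k)
    \<le> (1 / (1 + h * \<kappa>)) ^ k * norm (x - y)"
proof (induction k)
  case (Suc k)
  have "norm (chain (\<lambda>_. resolvent h) z x (Suc k) - chain (\<lambda>_. resolvent h) z y (Suc k))
    \<le> norm (chain (\<lambda>_. resolvent h) z x k - chain (\<lambda>_. resolvent h) z y k) / (1 + h * \<kappa>)"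
    using resolvent_lipschitz[OF assms] by (metis add_diff_cancel_right chain.simps(2))
  also have "\<dots> \<le> ((1 / (1 + h * \<kappa>)) ^ k * norm (x - y)) / (1 + h * \<kappa>)"
    using Suc assms by (intro divide_right_mono) auto
  finally show ?case by (simp add: field_simps)
qed auto

text \<open>If \<open>X\<close> satisfies the scheme up to a defect of size \<open>\<epsilon>\<close> per step, then \<open>X (k + 1)\<close> is the exact
  resolvent of a point displaced by the defect, so that the error \<open>e\<close> obeys
  \<open>e (k + 1) \<le> c (e k + \<epsilon>)\<close> and the defects merely add up.\<close>

lemma chain_resolvent_error:
  assumes h: "0 \<le> h" "0 < 1 + h * \<kappa>" and c: "1 / (1 + h * \<kappa>) \<le> c" "1 \<le> c"
    and err: "\<And>k. k < n \<Longrightarrow> norm (X (Suc k) - h *\<^sub>R b (X (Suc k)) - (X k + z k)) \<le> \<epsilon>"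
    and "k \<le> n"
  shows "norm (X k - chain (\<lambda>_. resolvent h) z (X 0) k) \<le> c ^ k * (k * \<epsilon>)"
  using \<open>k \<le> n\<close>
proof (induction k)
  case (Suc k)
  define S where "S = chain (\<lambda>_. resolvent h) z (X 0)"
  define r where "r = X (Suc k) - h *\<^sub>R b (X (Suc k)) - (X k + z k)"
  have r: "norm r \<le> \<epsilon>" using err[of k] Suc.prems by (simp add: r_def)
  have e: "\<epsilon> \<ge> 0" using r norm_ge_zero by (rule order_trans[rotated])
  have X: "X (Suc k) = resolvent h (X k + z k + r)"
    by (rule resolvent_eqI[OF h, symmetric]) (simp add: r_def)
  have "norm (X (Suc k) - S (Suc k)) \<le> norm ((X k + z k + r) - (S k + z k)) / (1 + h * \<kappa>)"
    using resolvent_lipschitz[OF h, of "X k + z k + r" "S k + z k"] by (simp add: X S_def)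
  also have "\<dots> \<le> norm ((X k - S k) + r) * c"
    using mult_left_mono[OF c(1), of "norm ((X k - S k) + r)"] by (simp add: algebra_simps)
  also have "\<dots> \<le> (c ^ k * (k * \<epsilon>) + \<epsilon>) * c"
    using Suc r c norm_triangle_ineq[of "X k - S k" r] by (intro mult_right_mono) (auto simp: S_def)
  also have "\<dots> \<le> (c ^ k * (k * \<epsilon>) + c ^ k * \<epsilon>) * c"
    using c e mult_right_mono[of 1 "c ^ k" \<epsilon>] by (intro mult_right_mono) (auto intro: one_le_power)
  also have "\<dots> = c ^ Suc k * (Suc k * \<epsilon>)" by (simp add: algebra_simps)
  finally show ?case by (simp add: S_def)
qed auto

text \<open>Over a step of length \<open>h\<close> the increment of a solution is \<open>h b (X (t + h))\<close> plus the increment of \<open>v\<close>, up to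
  \<open>h\<close> times the oscillation of \<open>b (X s)\<close>. The noise enters the solution and the scheme identically and cancels, so
  the error is governed by the continuity of the solution alone. In particular solutions are unique.\<close>

lemma implicit_euler_tendsto:
  assumes t: "0 \<le> t" and sol: "solves b v x t X"
  shows "(\<lambda>n. implicit_euler v t n x) \<longlonglongrightarrow> X t"
proof (rule LIMSEQ_I)
  fix e :: real assume e: "0 < e"
  define f where "f s = b (X s)" for s
  have cX: "continuous_on {0..t} X" and eq: "\<And>s. s \<in> {0..t} \<Longrightarrow> X s = x + integral {0..s} f + (v s - v 0)"
    using sol unfolding solves_def f_def by auto
  have cf: "continuous_on {0..t} f" unfolding f_def by (intro continuous_intros cX)
  \<comment> \<open>Once \<open>h |\<kappa>| \<le> 1/2\<close>, one step amplifies errors by at most \<open>exp (2 |\<kappa>| h)\<close>.\<close>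
  define C where "C = exp (2 * \<bar>\<kappa>\<bar> * t)"
  define \<eta> where "\<eta> = e / (2 * C * (t + 1))"
  have \<eta>: "\<eta> > 0" using e t by (simp add: \<eta>_def C_def)
  obtain d where d: "d > 0" "\<And>s s'. s \<in> {0..t} \<Longrightarrow> s' \<in> {0..t} \<Longrightarrow> dist s' s < d \<Longrightarrow> dist (f s') (f s) < \<eta>"
    using compact_uniformly_continuous[OF cf] \<eta> unfolding uniformly_continuous_on_def by force
  have "(\<lambda>n. t / real n) \<longlonglongrightarrow> 0" by (rule lim_const_over_n)
  then have "\<forall>\<^sub>F n in sequentially. t / real n < d \<and> t / real n < 1 / (2 * (\<bar>\<kappa>\<bar> + 1)) \<and> 0 < n"
    using d(1) by (intro eventually_conj order_tendstoD eventually_gt_at_top) auto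
  then obtain N where N: "\<And>n. n \<ge> N \<Longrightarrow> t / real n < d \<and> t / real n < 1 / (2 * (\<bar>\<kappa>\<bar> + 1)) \<and> 0 < n"
    unfolding eventually_sequentially by blast
  have "norm (implicit_euler v t n x - X t) < e" if n: "n \<ge> N" for n
  proof -
    define h where "h = t / real n"
    have h: "0 \<le> h" "h < d" "h < 1 / (2 * (\<bar>\<kappa>\<bar> + 1))" and n0: "0 < n"
      using N[OF n] t by (auto simp: h_def)
    have hn: "real n * h = t" using n0 by (simp add: h_def)
    have hk: "h * \<bar>\<kappa>\<bar> \<le> 1 / 2"
    proof -
      have "h * \<bar>\<kappa>\<bar> \<le> h * (\<bar>\<kappa>\<bar> + 1)" using h(1) by (intro mult_left_mono) auto
      also have "\<dots> \<le> 1/2" using h(3) by (simp add: field_simps)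
      finally show ?thesis .
    qed
    then have hk': "\<bar>h * \<kappa>\<bar> \<le> 1 / 2" using h(1) by (simp add: abs_mult)
    have pos: "0 < 1 + h * \<kappa>" using hk' by linarith
    define c where "c = exp (2 * \<bar>\<kappa>\<bar> * h)"
    have "1 / (1 + h * \<kappa>) \<le> 1 + 2 * (\<bar>\<kappa>\<bar> * h)"
    proof -
      define p where "p = h * \<bar>\<kappa>\<bar>"
      have p: "0 \<le> p" "p \<le> 1/2" "- p \<le> h * \<kappa>"
        using hk h(1) by (auto simp: p_def abs_if)
      have "1 \<le> (1 - p) * (1 + 2 * p)" using mult_left_mono[OF p(2) p(1)] by (simp add: algebra_simps)
      also have "\<dots> \<le> (1 + h * \<kappa>) * (1 + 2 * p)" using p by (intro mult_right_mono) auto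
      finally show ?thesis using pos by (simp add: field_simps p_def)
    qed
    also have "\<dots> \<le> c" unfolding c_def using exp_ge_add_one_self[of "2 * \<bar>\<kappa>\<bar> * h"] by (simp add: mult.assoc)
    finally have c1: "1 / (1 + h * \<kappa>) \<le> c" .
    have c2: "1 \<le> c" using h(1) by (simp add: c_def)
    define z where "z k = v (real (Suc k) * h) - v (real k * h)" for k
    have err: "norm (X (real (Suc k) * h) - h *\<^sub>R b (X (real (Suc k) * h)) - (X (real k * h) + z k)) \<le> h * \<eta>"
      if k: "k < n" for k
    proof -
      let ?p = "real k * h" and ?q = "real (Suc k) * h"
      have le: "0 \<le> ?p" "?p \<le> ?q" "?q \<le> t"
        using h(1) k hn mult_right_mono[of "real (Suc k)" "real n" h] by (auto simp: algebra_simps)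
      have int: "f integrable_on {0..?q}" "f integrable_on {?p..?q}"
        by (rule integrable_continuous_interval, rule continuous_on_subset[OF cf], use le in auto)+
      have p_in: "?p \<in> {0..t}" and q_in: "?q \<in> {0..t}" using le by auto
      have "X ?q - X ?p = integral {?p..?q} f + z k"
        unfolding z_def eq[OF p_in] eq[OF q_in]
          Henstock_Kurzweil_Integration.integral_combine[OF le(1,2) int(1), symmetric]
        by simp
      moreover have "integral {?p..?q} (\<lambda>s. f s - f ?q) = integral {?p..?q} f - h *\<^sub>R f ?q"
      proof -
        have "integral {?p..?q} (\<lambda>s. f s - f ?q) = integral {?p..?q} f - integral {?p..?q} (\<lambda>s. f ?q)"
          by (rule Henstock_Kurzweil_Integration.integral_diff[OF int(2)]) auto
        then show ?thesis using h(1) by (simp add: algebra_simps)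
      qed
      ultimately have "X ?q - h *\<^sub>R b (X ?q) - (X ?p + z k) = integral {?p..?q} (\<lambda>s. f s - f ?q)"
        by (simp add: f_def algebra_simps)
      moreover have "norm (integral {?p..?q} (\<lambda>s. f s - f ?q)) \<le> \<eta> * (?q - ?p)"
      proof (rule integral_bound[OF le(2)])
        show "continuous_on {?p..?q} (\<lambda>s. f s - f ?q)"
          using le by (intro continuous_intros continuous_on_subset[OF cf]) auto
        fix s assume s: "s \<in> {?p..?q}"
        have "dist s ?q < d" using s h(2) by (auto simp: dist_real_def algebra_simps)
        then show "norm (f s - f ?q) \<le> \<eta>"
          using d(2)[of ?q s] s le by (auto simp: dist_norm less_imp_le)
      qed
      ultimately show ?thesis by (simp only:) (simp add: algebra_simps)
    qed
    have X0: "X (real 0 * h) = x" using eq[of 0] t by simp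
    have "norm (X (real n * h) - chain (\<lambda>_. resolvent h) z (X (real 0 * h)) n) \<le> c ^ n * (n * (h * \<eta>))"
      by (rule chain_resolvent_error[where n=n and X="\<lambda>k. X (real k * h)", OF h(1) pos c1 c2 err]) auto
    also have "\<dots> = C * (t * \<eta>)"
      unfolding c_def C_def exp_of_nat_mult[symmetric] by (simp add: hn[symmetric] algebra_simps)
    also have "\<dots> < C * ((t + 1) * (2 * \<eta>))"
      using \<eta> t by (intro mult_strict_left_mono) (auto simp: C_def algebra_simps intro: add_nonneg_pos)
    also have "\<dots> = e" using t by (simp add: \<eta>_def C_def)
    finally show ?thesis
      using X0 hn by (simp add: implicit_euler_def h_def z_def[abs_def] norm_minus_commute)
  qed
  then show "\<exists>no. \<forall>n\<ge>no. norm (implicit_euler v t n x - X t) < e" by blast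
qed

end

text \<open>Global existence on \<open>[0, T]\<close> in one fixed point argument: in the weighted norm
  \<open>sup e\<^sup>-\<^sup>l\<^sup>t |y t|\<close> the Picard operator has contraction factor \<open>\<Lambda> / l\<close>. The weight is absorbed into
  the unknown, so that the complete space is that of bounded continuous functions with the supremum norm.\<close>

section \<open>The flow of a dissipative equation along a continuous path\<close>

lemma picard_exists:
  fixes g :: "real \<Rightarrow> 'a::euclidean_space \<Rightarrow> 'a"
  assumes T: "0 \<le> T" and \<Lambda>: "0 \<le> \<Lambda>"
    and cont: "\<And>y. continuous_on {0..T} y \<Longrightarrow> continuous_on {0..T} (\<lambda>s. g s (y s))"
    and lip: "\<And>s y y'. s \<in> {0..T} \<Longrightarrow> norm (g s y - g s y') \<le> \<Lambda> * norm (y - y')"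
  obtains y where "continuous_on {0..T} y" "\<And>t. t \<in> {0..T} \<Longrightarrow> y t = x + integral {0..t} (\<lambda>s. g s (y s))"
proof -
  \<comment> \<open>The weight \<open>l > 2 \<Lambda>\<close> gives the contraction factor \<open>1/2\<close>.\<close>
  define l where "l = 2 * \<Lambda> + 1"
  have l: "l > 0" using \<Lambda> by (simp add: l_def)
  define cl where "cl t = max 0 (min T t)" for t
  have cl: "cl t \<in> {0..T}" for t using T by (auto simp: cl_def)
  have cl_id: "cl t = t" if "t \<in> {0..T}" for t using that by (auto simp: cl_def)
  define F where "F z t = exp (- l * t) *\<^sub>R (x + integral {0..t} (\<lambda>s. g s (exp (l * s) *\<^sub>R z s)))"
    for z :: "real \<Rightarrow> 'a" and t
  have cg: "continuous_on {0..T} (\<lambda>s. g s (exp (l * s) *\<^sub>R z s))" if "continuous_on {0..T} z" for z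
    by (intro cont continuous_intros that)
  have ig: "(\<lambda>s. g s (exp (l * s) *\<^sub>R z s)) integrable_on {0..t}"
    if "continuous_on {0..T} z" "t \<in> {0..T}" for z t
    using that by (intro integrable_continuous_interval continuous_on_subset[OF cg]) auto
  have cF: "continuous_on {0..T} (F z)" if "continuous_on {0..T} z" for z
    unfolding F_def using T that
    by (intro continuous_intros indefinite_integral_continuous_1 ig) auto
  have FB: "(\<lambda>t. F z (cl t)) \<in> bcontfun" if "continuous_on {0..T} z" for z
  proof -
    have "continuous_on UNIV (\<lambda>t. F z (cl t))"
      using cl by (intro continuous_on_compose2[OF cF[OF that]]) (auto simp: cl_def intro!: continuous_intros)
    moreover have "bounded (range (\<lambda>t. F z (cl t)))"
      using cl by (intro bounded_subset[OF compact_imp_bounded[OF compact_continuous_image[OF cF[OF that] compact_Icc]]]) auto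
    ultimately show ?thesis by (simp add: bcontfun_def)
  qed
  define \<Phi> where "\<Phi> z = Bcontfun (\<lambda>t. F (apply_bcontfun z) (cl t))" for z :: "real \<Rightarrow>\<^sub>C 'a"
  have \<Phi>: "apply_bcontfun (\<Phi> z) t = F (apply_bcontfun z) (cl t)" for z t
    unfolding \<Phi>_def by (subst Bcontfun_inverse[OF FB]) auto
  have contr: "dist (\<Phi> z) (\<Phi> z') \<le> 1/2 * dist z z'" for z z'
  proof (rule dist_bound)
    fix t
    define \<tau> where "\<tau> = cl t"
    have \<tau>: "\<tau> \<in> {0..T}" using cl by (simp add: \<tau>_def)
    define d where "d = dist z z'"
    have d: "d \<ge> 0" by (simp add: d_def)
    let ?G = "\<lambda>z s. g s (exp (l * s) *\<^sub>R apply_bcontfun z s)"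
    have 1: "((\<lambda>s. \<Lambda> * d * exp (l * s)) has_integral (\<Lambda> * d * exp (l * \<tau>) / l - \<Lambda> * d * exp (l * 0) / l)) {0..\<tau>}"
      using \<tau> l
      by (intro fundamental_theorem_of_calculus)
         (auto intro!: derivative_eq_intros simp: has_real_derivative_iff_has_vector_derivative[symmetric])
    have "norm (integral {0..\<tau>} (\<lambda>s. ?G z s - ?G z' s)) \<le> integral {0..\<tau>} (\<lambda>s. \<Lambda> * d * exp (l * s))"
    proof (rule integral_norm_bound_integral)
      show "(\<lambda>s. ?G z s - ?G z' s) integrable_on {0..\<tau>}" "(\<lambda>s. \<Lambda> * d * exp (l * s)) integrable_on {0..\<tau>}"
        using 1 \<tau> by (auto intro!: Henstock_Kurzweil_Integration.integrable_diff ig)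
      fix s assume s: "s \<in> {0..\<tau>}"
      have "norm (?G z s - ?G z' s) \<le> \<Lambda> * norm (exp (l * s) *\<^sub>R apply_bcontfun z s - exp (l * s) *\<^sub>R apply_bcontfun z' s)"
        using s \<tau> by (intro lip) auto
      also have "\<dots> = \<Lambda> * (exp (l * s) * dist (apply_bcontfun z s) (apply_bcontfun z' s))"
        by (simp add: dist_norm flip: scaleR_diff_right)
      also have "\<dots> \<le> \<Lambda> * (exp (l * s) * d)"
        using \<Lambda> dist_bounded by (intro mult_left_mono) (auto simp: d_def)
      finally show "norm (?G z s - ?G z' s) \<le> \<Lambda> * d * exp (l * s)" by (simp add: mult_ac)
    qed
    also have "\<dots> = \<Lambda> * d / l * (exp (l * \<tau>) - 1)" unfolding integral_unique[OF 1] by (simp add: right_diff_distrib)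
    also have "\<dots> \<le> \<Lambda> * d / l * exp (l * \<tau>)" using \<Lambda> d l by (intro mult_left_mono) auto
    also have "\<dots> \<le> 1/2 * d * exp (l * \<tau>)"
      using d l by (intro mult_right_mono) (auto simp: l_def field_simps mult_left_mono)
    finally have 2: "norm (integral {0..\<tau>} (\<lambda>s. ?G z s - ?G z' s)) \<le> 1/2 * d * exp (l * \<tau>)" .
    have "F (apply_bcontfun z) \<tau> - F (apply_bcontfun z') \<tau>
        = exp (- l * \<tau>) *\<^sub>R integral {0..\<tau>} (\<lambda>s. ?G z s - ?G z' s)"
      unfolding F_def using \<tau>
      by (subst Henstock_Kurzweil_Integration.integral_diff)
         (auto intro!: ig[OF _ \<tau>] simp: scaleR_add_right scaleR_diff_right)
    then have "dist (F (apply_bcontfun z) \<tau>) (F (apply_bcontfun z') \<tau>) \<le> exp (- l * \<tau>) * (1/2 * d * exp (l * \<tau>))"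
      using 2 by (simp add: dist_norm)
    also have "\<dots> = 1/2 * d" by (simp add: exp_minus)
    finally show "dist (apply_bcontfun (\<Phi> z) t) (apply_bcontfun (\<Phi> z') t) \<le> 1/2 * dist z z'"
      by (simp add: \<Phi> \<tau>_def d_def)
  qed
  obtain z where z: "\<Phi> z = z"
    using banach_fix_type[of "1/2" \<Phi>] contr by auto
  have zF: "apply_bcontfun z t = F (apply_bcontfun z) t" if "t \<in> {0..T}" for t
    using \<Phi>[of z t] z cl_id[OF that] by simp
  define y where "y t = exp (l * t) *\<^sub>R apply_bcontfun z t" for t
  show ?thesis
  proof (rule that[of y])
    show "continuous_on {0..T} y" unfolding y_def by (intro continuous_intros) auto
    fix t assume "t \<in> {0..T}"
    then show "y t = x + integral {0..t} (\<lambda>s. g s (y s))"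
      using zF[of t] by (simp add: y_def[of t] F_def) (simp add: y_def exp_minus)
  qed
qed

context dissipative_drift
begin

text \<open>Truncation is applied to the solution minus the driving path, here \<open>y\<close>, not to the solution itself. Since \<open>y\<close> is a multiple \<open>\<ge> 1\<close> of its
  projection, the one-sided bound for the projected point transfers to \<open>y\<close>, with constants that do not depend
  on the truncation radius.\<close>

lemma truncated_drift_inner:
  assumes R: "0 < R" and B: "norm (b v) \<le> B"
  shows "2 * (y \<bullet> b (closest_point (cball 0 R) y + v)) \<le> (2 * \<bar>\<kappa>\<bar> + 1) * (norm y)\<^sup>2 + B\<^sup>2"
proof -
  define p where "p = closest_point (cball (0 :: real ^ 'n) R) y"
  obtain c where c: "y = c *\<^sub>R p" "1 \<le> c"
  proof (cases "norm y \<le> R")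
    case True
    then have "p = y" unfolding p_def by (intro closest_point_self) simp
    then show ?thesis using that[of 1] by simp
  next
    case False
    then have ny: "0 < norm y" using R by linarith
    have py: "(R / norm y) *\<^sub>R y = p"
      unfolding p_def
    proof (rule closest_point_unique)
      show "(R / norm y) *\<^sub>R y \<in> cball 0 R" using R False by simp
      have le: "R / norm y \<le> 1" using ny False by simp
      have "y - (R / norm y) *\<^sub>R y = (1 - R / norm y) *\<^sub>R y" by (simp add: algebra_simps)
      then have "dist y ((R / norm y) *\<^sub>R y) = \<bar>1 - R / norm y\<bar> * norm y" by (simp add: dist_norm)
      also have "\<dots> = norm y - R" using le ny by (simp add: left_diff_distrib)
      finally have d_eq: "dist y ((R / norm y) *\<^sub>R y) = norm y - R" .
      show "\<forall>z\<in>cball 0 R. dist y ((R / norm y) *\<^sub>R y) \<le> dist y z"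
      proof (intro ballI)
        fix z :: "real ^ 'n" assume "z \<in> cball 0 R"
        then have "norm z \<le> R" by simp
        then show "dist y ((R / norm y) *\<^sub>R y) \<le> dist y z"
          using norm_triangle_ineq2[of y z] d_eq
          by (simp add: dist_norm)
      qed
    qed auto
    have "y = (norm y / R) *\<^sub>R p" using R ny by (simp flip: py)
    then show ?thesis using that[of "norm y / R"] R False by simp
  qed
  have "p \<bullet> (b (p + v) - b v) \<le> \<bar>\<kappa>\<bar> * (norm p)\<^sup>2"
    using one_sided[of "p + v" v] mult_right_mono[OF abs_ge_minus_self[of \<kappa>] zero_le_power2[of "norm p"]]
    by (simp add: inner_commute)
  then have "c * (p \<bullet> (b (p + v) - b v)) \<le> c * (\<bar>\<kappa>\<bar> * (norm p)\<^sup>2)"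
    using c by (intro mult_left_mono) auto
  also have "\<dots> \<le> c * (c * (\<bar>\<kappa>\<bar> * (norm p)\<^sup>2))"
    using c(2) mult_right_mono[of 1 c "\<bar>\<kappa>\<bar> * (norm p)\<^sup>2"] by (intro mult_left_mono) auto
  also have "\<dots> = \<bar>\<kappa>\<bar> * (norm y)\<^sup>2" using c by (simp add: power2_eq_square)
  finally have "y \<bullet> (b (p + v) - b v) \<le> \<bar>\<kappa>\<bar> * (norm y)\<^sup>2" using c by simp
  moreover have "y \<bullet> b v \<le> norm y * B"
    using norm_cauchy_schwarz[of y "b v"] B by (meson mult_left_mono norm_ge_zero order_trans)
  moreover have "2 * (norm y * B) \<le> (norm y)\<^sup>2 + B\<^sup>2"
    using sum_squares_bound[of "norm y" B] by (simp add: mult.assoc)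
  ultimately show ?thesis by (simp add: p_def inner_diff_right algebra_simps)
qed

text \<open>The drift is only locally Lipschitz. Precomposing it with the projection to a ball of radius \<open>R\<close> makes it
  globally Lipschitz; the resulting solution obeys a Gronwall bound that does not depend on \<open>R\<close>. With \<open>R\<close>
  chosen beyond this bound the truncation is never active.\<close>

lemma solution_exists:
  assumes T: "0 \<le> T" and v: "continuous_on {0..T} v"
  shows "\<exists>X. solves b v x T X"
proof -
  define w where "w s = v s - v 0" for s
  have cw: "continuous_on {0..T} w" unfolding w_def by (intro continuous_intros v)
  obtain V where V: "\<And>s. s \<in> {0..T} \<Longrightarrow> norm (w s) \<le> V"
    using compact_imp_bounded[OF compact_continuous_image[OF cw compact_Icc]] unfolding bounded_iff by blast
  obtain B where B: "\<And>s. s \<in> {0..T} \<Longrightarrow> norm (b (w s)) \<le> B"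
    using compact_imp_bounded[OF compact_continuous_image[OF continuous_b[OF cw] compact_Icc]]
    unfolding bounded_iff by blast
  define c where "c = 2 * \<bar>\<kappa>\<bar> + 1"
  \<comment> \<open>One more than the Gronwall bound on \<open>[0, T]\<close>, which also makes the radius positive.\<close>
  define R where "R = sqrt (exp (c * T) * ((norm x)\<^sup>2 + B\<^sup>2 * T)) + 1"
  have R: "R > 0" using T by (simp add: R_def add_nonneg_pos)
  define p where "p = closest_point (cball (0 :: real ^ 'n) R)"
  have p_in: "p y \<in> cball 0 R" for y
    unfolding p_def using R by (intro closest_point_in_set) auto
  have p_lip: "norm (p y - p z) \<le> norm (y - z)" for y z
    unfolding p_def dist_norm[symmetric] using R by (intro closest_point_lipschitz) auto
  have cp: "continuous_on S p" for S
    unfolding p_def using R by (intro continuous_on_closest_point) auto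
  obtain L where L: "0 \<le> L" "\<And>y z. y \<in> cball 0 (R + V) \<Longrightarrow> z \<in> cball 0 (R + V) \<Longrightarrow> norm (b y - b z) \<le> L * norm (y - z)"
    using C1_field_lipschitz_on[OF C1 compact_cball convex_cball] by blast
  have pw: "p y + w s \<in> cball 0 (R + V)" if "s \<in> {0..T}" for s y
    using norm_triangle_ineq[of "p y" "w s"] p_in[of y] V[OF that] by simp
  have lip: "norm (b (p y + w s) - b (p z + w s)) \<le> L * norm (y - z)" if "s \<in> {0..T}" for s y z
  proof -
    have "norm (b (p y + w s) - b (p z + w s)) \<le> L * norm ((p y + w s) - (p z + w s))"
      using pw[OF that] by (intro L)
    also have "\<dots> \<le> L * norm (y - z)" using p_lip[of y z] L(1) by (auto intro: mult_left_mono)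
    finally show ?thesis .
  qed
  obtain y where cy: "continuous_on {0..T} y"
    and y: "\<And>t. t \<in> {0..T} \<Longrightarrow> y t = x + integral {0..t} (\<lambda>s. b (p (y s) + w s))"
  proof (rule picard_exists[OF T L(1), of "\<lambda>s y. b (p y + w s)"])
    show "continuous_on {0..T} (\<lambda>s. b (p (y s) + w s))" if "continuous_on {0..T} y" for y
      using that by (intro continuous_intros cw continuous_on_compose2[OF cp[of UNIV]]) auto
  qed (use lip in auto)
  have cg: "continuous_on {0..T} (\<lambda>s. b (p (y s) + w s))"
    by (intro continuous_intros cw cy continuous_on_compose2[OF cp[of UNIV]]) auto
  have bound: "norm (y t) \<le> R" if t: "t \<in> {0..T}" for t
  proof -
    \<comment> \<open>The Gronwall bound: \<open>\<phi>\<close> is nonincreasing.\<close>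
    define \<phi> where "\<phi> s = exp (- c * s) * (y s \<bullet> y s) - B\<^sup>2 * s" for s
    have dy: "(y has_derivative (\<lambda>h. h *\<^sub>R b (p (y s) + w s))) (at s within {0..t})" if s: "s \<in> {0..t}" for s
    proof -
      have "((\<lambda>u. x + integral {0..u} (\<lambda>s. b (p (y s) + w s))) has_vector_derivative
          (b (p (y s) + w s))) (at s within {0..t})"
        using integral_has_vector_derivative[OF continuous_on_subset[OF cg], of 0 t s] s t
        by (auto intro!: derivative_eq_intros)
      then have "(y has_vector_derivative (b (p (y s) + w s))) (at s within {0..t})"
        by (rule has_vector_derivative_transform[rotated 2]) (use s t y in auto)
      then show ?thesis by (simp add: has_vector_derivative_def)
    qed
    define \<phi>' where "\<phi>' s = exp (- c * s) * (2 * (y s \<bullet> b (p (y s) + w s)) - c * (norm (y s))\<^sup>2) - B\<^sup>2" for s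
    have d\<phi>: "(\<phi> has_derivative (\<lambda>h. h * \<phi>' s)) (at s within {0..t})" if s: "s \<in> {0..t}" for s
      unfolding \<phi>_def \<phi>'_def
      by (rule derivative_eq_intros dy[OF s] refl | simp)+
         (simp add: fun_eq_iff power2_norm_eq_inner algebra_simps inner_commute)
    have "\<exists>s\<in>{0..t}. \<phi> t - \<phi> 0 = (t - 0) * \<phi>' s"
      using mvt_very_simple[of 0 t \<phi> "\<lambda>s h. h * \<phi>' s"] d\<phi> t by auto
    then obtain s where s: "s \<in> {0..t}" and mv: "\<phi> t - \<phi> 0 = t * \<phi>' s" by auto
    have "\<phi>' s \<le> 0"
    proof -
      have "2 * (y s \<bullet> b (p (y s) + w s)) - c * (norm (y s))\<^sup>2 \<le> B\<^sup>2"
        using truncated_drift_inner[OF R B, of s "y s"] s t by (simp add: c_def p_def)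
      then have "exp (- c * s) * (2 * (y s \<bullet> b (p (y s) + w s)) - c * (norm (y s))\<^sup>2) \<le> exp (- c * s) * B\<^sup>2"
        by (intro mult_left_mono) auto
      also have "\<dots> \<le> 1 * B\<^sup>2" using s by (intro mult_right_mono) (auto simp: c_def intro!: mult_nonpos_nonneg)
      finally show ?thesis by (simp add: \<phi>'_def)
    qed
    then have "\<phi> t \<le> \<phi> 0" using mv t by (simp add: mult_nonneg_nonpos algebra_simps)
    moreover have "y 0 = x" using y[of 0] T by simp
    ultimately have "exp (- c * t) * (norm (y t))\<^sup>2 \<le> (norm x)\<^sup>2 + B\<^sup>2 * t"
      by (simp add: \<phi>_def power2_norm_eq_inner)
    then have "exp (c * t) * (exp (- c * t) * (norm (y t))\<^sup>2) \<le> exp (c * t) * ((norm x)\<^sup>2 + B\<^sup>2 * t)"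
      by (intro mult_left_mono) auto
    also have "\<dots> \<le> exp (c * T) * ((norm x)\<^sup>2 + B\<^sup>2 * T)"
      using t by (intro mult_mono add_mono) (auto simp: c_def mult_left_mono)
    finally have "(norm (y t))\<^sup>2 \<le> exp (c * T) * ((norm x)\<^sup>2 + B\<^sup>2 * T)"
      by (simp flip: mult.assoc exp_add)
    then have "norm (y t) \<le> sqrt (exp (c * T) * ((norm x)\<^sup>2 + B\<^sup>2 * T))"
      by (simp add: real_le_rsqrt)
    then show ?thesis by (simp add: R_def)
  qed
  have py: "p (y t) = y t" if "t \<in> {0..T}" for t
    unfolding p_def using bound[OF that] by (intro closest_point_self) simp
  have "solves b v x T (\<lambda>t. y t + w t)"
    unfolding solves_def
  proof (intro conjI ballI)
    show "continuous_on {0..T} (\<lambda>t. y t + w t)" by (intro continuous_intros cy cw)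
    fix t assume t: "t \<in> {0..T}"
    have "integral {0..t} (\<lambda>s. b (p (y s) + w s)) = integral {0..t} (\<lambda>s. b (y s + w s))"
      using t py by (intro Henstock_Kurzweil_Integration.integral_cong) auto
    then show "y t + w t = x + integral {0..t} (\<lambda>s. b (y s + w s)) + (v t - v 0)"
      using y[OF t] by (simp add: w_def)
  qed
  then show ?thesis by blast
qed

text \<open>Defining the flow as the limit of the scheme makes it measurable in the path and in the starting point.\<close>

definition flow :: "(real \<Rightarrow> real ^ 'n) \<Rightarrow> real \<Rightarrow> real ^ 'n \<Rightarrow> real ^ 'n" where
  "flow v t x = lim (\<lambda>n. implicit_euler v t n x)"

lemma flow_eq: "0 \<le> t \<Longrightarrow> solves b v x t X \<Longrightarrow> flow v t x = X t"
  unfolding flow_def by (rule limI implicit_euler_tendsto)+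

lemma solves_mono: "solves b v x T X \<Longrightarrow> t \<le> T \<Longrightarrow> solves b v x t X"
  unfolding solves_def by (auto intro: continuous_on_subset)

lemma solves_flow:
  assumes "0 \<le> T" "continuous_on {0..T} v"
  shows "solves b v x T (\<lambda>t. flow v t x)"
proof -
  obtain X where X: "solves b v x T X" using solution_exists[OF assms] by blast
  have eq: "flow v t x = X t" if "t \<in> {0..T}" for t
    using flow_eq[OF _ solves_mono[OF X]] that by auto
  have "integral {0..t} (\<lambda>s. b (flow v s x)) = integral {0..t} (\<lambda>s. b (X s))" if "t \<in> {0..T}" for t
    using that eq by (intro Henstock_Kurzweil_Integration.integral_cong) auto
  moreover have "continuous_on {0..T} (\<lambda>t. flow v t x)"
    using X eq unfolding solves_def by (auto cong: continuous_on_cong_simp)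
  ultimately show ?thesis
    using X eq unfolding solves_def by simp
qed

lemma implicit_euler_tendsto_flow:
  assumes "0 \<le> t" "continuous_on {0..t} v"
  shows "(\<lambda>n. implicit_euler v t n x) \<longlonglongrightarrow> flow v t x"
  using implicit_euler_tendsto[OF assms(1) solves_flow[OF assms]] .

lemma continuous_flow: "0 \<le> T \<Longrightarrow> continuous_on {0..T} v \<Longrightarrow> continuous_on {0..T} (\<lambda>t. flow v t x)"
  using solves_flow unfolding solves_def by blast

lemma flow_zero [simp]: "flow v 0 x = x"
proof -
  have "solves b v x 0 (\<lambda>_. x)" by (auto simp: solves_def)
  then show ?thesis using flow_eq by fastforce
qed

lemma eventually_small_step: "\<forall>\<^sub>F n in sequentially. 0 < 1 + t / real n * \<kappa>"
proof -
  have "(\<lambda>n. 1 + t / real n * \<kappa>) \<longlonglongrightarrow> 1 + 0 * \<kappa>"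
    by (intro tendsto_intros lim_const_over_n)
  then show ?thesis using order_tendstoD(1)[of _ "1 + 0 * \<kappa>" sequentially 0] by auto
qed

lemma contraction_factor_tendsto:
  "(\<lambda>n. (1 / (1 + t / real n * \<kappa>)) ^ n) \<longlonglongrightarrow> exp (- \<kappa> * t)"
proof -
  have "(\<lambda>n. inverse ((1 + (\<kappa> * t) / real n) ^ n)) \<longlonglongrightarrow> inverse (exp (\<kappa> * t))"
    by (intro tendsto_inverse tendsto_exp_limit_sequentially) auto
  moreover have "inverse ((1 + (\<kappa> * t) / real n) ^ n) = (1 / (1 + t / real n * \<kappa>)) ^ n" for n
    by (simp add: power_divide inverse_eq_divide mult.commute)
  ultimately show ?thesis by (simp add: exp_minus)
qed

lemma implicit_euler_lipschitz:
  assumes "0 \<le> t" "0 < 1 + t / real n * \<kappa>"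
  shows "norm (implicit_euler v t n x - implicit_euler v t n y) \<le> (1 / (1 + t / real n * \<kappa>)) ^ n * norm (x - y)"
  unfolding implicit_euler_def using assms by (intro chain_resolvent_lipschitz) auto

lemma flow_lipschitz:
  assumes t: "0 \<le> t" and v: "continuous_on {0..t} v"
  shows "norm (flow v t x - flow v t y) \<le> exp (- \<kappa> * t) * norm (x - y)"
proof (rule tendsto_le[OF sequentially_bot])
  show "(\<lambda>n. norm (implicit_euler v t n x - implicit_euler v t n y)) \<longlonglongrightarrow> norm (flow v t x - flow v t y)"
    by (intro tendsto_intros implicit_euler_tendsto_flow t v)
  show "(\<lambda>n. (1 / (1 + t / real n * \<kappa>)) ^ n * norm (x - y)) \<longlonglongrightarrow> exp (- \<kappa> * t) * norm (x - y)"
    by (intro tendsto_intros contraction_factor_tendsto)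
  show "\<forall>\<^sub>F n in sequentially. norm (implicit_euler v t n x - implicit_euler v t n y)
      \<le> (1 / (1 + t / real n * \<kappa>)) ^ n * norm (x - y)"
    using eventually_small_step[of t] by eventually_elim (use t implicit_euler_lipschitz in auto)
qed

text \<open>The restarted path solves the shifted equation, and solutions are unique.\<close>

lemma flow_cocycle:
  assumes s: "0 \<le> s" and t: "0 \<le> t" and v: "continuous_on {0..s + t} v"
  shows "flow v (s + t) x = flow (\<lambda>r. v (s + r)) t (flow v s x)"
proof -
  let ?X = "\<lambda>r. flow v r x"
  have sol: "solves b v x (s + t) ?X" using s t v by (intro solves_flow) auto
  then have cX: "continuous_on {0..s + t} ?X"
    and eq: "\<And>r. r \<in> {0..s + t} \<Longrightarrow> ?X r = x + integral {0..r} (\<lambda>s. b (?X s)) + (v r - v 0)"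
    unfolding solves_def by auto
  have "solves b (\<lambda>r. v (s + r)) (?X s) t (\<lambda>r. ?X (s + r))"
    unfolding solves_def
  proof (intro conjI ballI)
    show "continuous_on {0..t} (\<lambda>r. ?X (s + r))"
      using s by (intro continuous_on_compose2[OF cX] continuous_intros) auto
    fix r assume r: "r \<in> {0..t}"
    have int: "(\<lambda>s. b (?X s)) integrable_on {0..s + r}"
      using r s by (intro integrable_continuous_interval continuous_intros continuous_on_subset[OF cX]) auto
    have cb: "continuous_on {s..s + r} (\<lambda>s. b (?X s))"
      using r s by (intro continuous_intros continuous_on_subset[OF cX]) auto
    have "integral {0..s + r} (\<lambda>s. b (?X s)) = integral {0..s} (\<lambda>s. b (?X s)) + integral {s..s + r} (\<lambda>s. b (?X s))"
      using r s int by (intro Henstock_Kurzweil_Integration.integral_combine[symmetric]) auto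
    moreover have "integral {s..s + r} (\<lambda>s. b (?X s)) = integral {0..r} (\<lambda>u. b (?X (s + u)))"
      using integral_shift[of 0 s r "\<lambda>s. b (?X s)"] cb
      by (simp add: o_def add.commute)
    ultimately show "?X (s + r) = ?X s + integral {0..r} (\<lambda>u. b (?X (s + u))) + (v (s + r) - v (s + 0))"
      using eq[of "s + r"] eq[of s] r s t by simp
  qed
  then show ?thesis using flow_eq[OF t] by simp
qed

end

text \<open>Lebesgue measure on \<^typ>\<open>real ^ 'n\<close> is the image of the product of the one-dimensional ones, so Fubini's
  theorem for products over coordinates carries over.\<close>

section \<open>Gaussian concentration of Brownian increments\<close>

lemma lborel_vec_prod:
  fixes f :: "'n::finite \<Rightarrow> real \<Rightarrow> real"
  assumes f: "\<And>i. integrable lborel (f i)"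
  shows "integrable lborel (\<lambda>x::real ^ 'n. \<Prod>i\<in>UNIV. f i (x $ i))"
    and "(\<integral>x. (\<Prod>i\<in>UNIV. f i (x $ i)) \<partial>(lborel :: (real ^ 'n) measure)) = (\<Prod>i\<in>UNIV. \<integral>t. f i t \<partial>lborel)"
proof -
  interpret product_sigma_finite "\<lambda>_ :: real ^ 'n. lborel :: real measure" by standard
  let ?T = "\<lambda>g. \<Sum>b\<in>(Basis :: (real ^ 'n) set). g b *\<^sub>R b"
  have inj: "inj (\<lambda>i::'n. axis i (1::real))" by (auto simp: inj_on_def axis_eq_axis)
  have B: "(Basis :: (real ^ 'n) set) = range (\<lambda>i. axis i 1)" by (auto simp: Basis_vec_def)
  have T: "?T g $ i = g (axis i 1)" for g and i :: 'n
  proof -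
    have "?T g \<bullet> axis i 1 = g (axis i 1)" by (rule inner_sum_left_Basis) (simp add: B)
    then show ?thesis by (simp add: inner_axis)
  qed
  have prod: "(\<Prod>i\<in>UNIV. f i (g (axis i 1))) = (\<Prod>b\<in>Basis. f (axis_index b) (g b))" for g :: "real ^ 'n \<Rightarrow> real"
    unfolding B by (subst prod.reindex[OF inj]) simp
  have m [measurable]: "f i \<in> borel_measurable borel" for i using f[of i] by simp
  have mT: "?T \<in> (\<Pi>\<^sub>M b\<in>Basis. lborel) \<rightarrow>\<^sub>M borel" by measurable
  have mp: "(\<lambda>x::real ^ 'n. \<Prod>i\<in>UNIV. f i (x $ i)) \<in> borel_measurable borel" by measurable
  show "integrable lborel (\<lambda>x::real ^ 'n. \<Prod>i\<in>UNIV. f i (x $ i))"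
    unfolding lborel_eq[where 'a = "real ^ 'n"] integrable_distr_eq[OF mT mp] T prod
    by (rule product_integrable_prod) (auto simp: f)
  have "(\<integral>x. (\<Prod>i\<in>UNIV. f i (x $ i)) \<partial>(lborel :: (real ^ 'n) measure)) = (\<Prod>b\<in>(Basis :: (real ^ 'n) set). \<integral>t. f (axis_index b) t \<partial>lborel)"
    unfolding lborel_eq[where 'a = "real ^ 'n"] integral_distr[OF mT mp] T prod
    by (rule product_integral_prod) (auto simp: f)
  also have "\<dots> = (\<Prod>i\<in>UNIV. \<integral>t. f i t \<partial>lborel)"
    unfolding B by (subst prod.reindex[OF inj]) simp
  finally show "(\<integral>x. (\<Prod>i\<in>UNIV. f i (x $ i)) \<partial>(lborel :: (real ^ 'n) measure)) = (\<Prod>i\<in>UNIV. \<integral>t. f i t \<partial>lborel)" .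
qed

text \<open>The only properties of a centred Gaussian with covariance \<open>h I\<close> that the concentration proof uses: the
  covariance, and a fourth moment of order \<open>h\<^sup>2\<close> to control the error terms.\<close>

definition isotropic_moments :: "real \<Rightarrow> (real ^ 'n) measure \<Rightarrow> bool" where
  "isotropic_moments h \<gamma> \<longleftrightarrow> prob_space \<gamma> \<and> sets \<gamma> = sets borel \<and>
     (\<forall>i j. integrable \<gamma> (\<lambda>z. z $ i * z $ j) \<and> (\<integral>z. z $ i * z $ j \<partial>\<gamma>) = (if i = j then h else 0)) \<and>
     (\<forall>i. integrable \<gamma> (\<lambda>z. (z $ i) ^ 4) \<and> (\<integral>z. (z $ i) ^ 4 \<partial>\<gamma>) = 3 * h\<^sup>2)"

lemma normal_vec_moments:
  fixes X :: "'w \<Rightarrow> real ^ 'n"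
  assumes "prob_space M" and h: "0 < h"
    and X: "distributed M lborel X (\<lambda>x. ennreal (\<Prod>i\<in>UNIV. normal_density 0 (sqrt h) (x $ i)))"
  shows "isotropic_moments h (distr M borel X)"
proof -
  interpret prob_space M by fact
  let ?p = "\<lambda>x::real ^ 'n. \<Prod>i\<in>UNIV. normal_density 0 (sqrt h) (x $ i)"
  have X_meas [measurable]: "X \<in> borel_measurable M" using distributed_measurable[OF X] by simp
  have nonneg: "0 \<le> ?p x" for x by (intro prod_nonneg) auto
  have mom: "integrable M (\<lambda>\<omega>. \<Prod>i\<in>UNIV. (X \<omega> $ i) ^ e i)"
    "(\<integral>\<omega>. (\<Prod>i\<in>UNIV. (X \<omega> $ i) ^ e i) \<partial>M) = (\<Prod>i\<in>UNIV. \<integral>t. normal_density 0 (sqrt h) t * t ^ e i \<partial>lborel)" for e :: "'n \<Rightarrow> nat"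
  proof -
    have 0: "integrable lborel (\<lambda>t. normal_density 0 (sqrt h) t * t ^ e i)" for i
    proof (cases "even (e i)")
      case True
      then obtain k where "e i = 2 * k" by (rule evenE)
      then show ?thesis using integrable.intros[OF normal_moment_even[of "sqrt h" 0 k]] h by (simp only: diff_zero real_sqrt_gt_0_iff)
    next
      case False
      then obtain k where "e i = 2 * k + 1" by (rule oddE)
      then show ?thesis using integrable.intros[OF normal_moment_odd[of "sqrt h" 0 k]] h by (simp only: diff_zero real_sqrt_gt_0_iff)
    qed
    have eq: "?p x * (\<Prod>i\<in>UNIV. (x $ i) ^ e i) = (\<Prod>i\<in>UNIV. normal_density 0 (sqrt h) (x $ i) * (x $ i) ^ e i)" for x
      by (simp add: prod.distrib)
    show "integrable M (\<lambda>\<omega>. \<Prod>i\<in>UNIV. (X \<omega> $ i) ^ e i)"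
      using distributed_integrable[OF X, of "\<lambda>x. \<Prod>i\<in>UNIV. (x $ i) ^ e i"] nonneg lborel_vec_prod(1)[where f = "\<lambda>i t. normal_density 0 (sqrt h) t * t ^ e i", OF 0]
      by (simp add: eq)
    show "(\<integral>\<omega>. (\<Prod>i\<in>UNIV. (X \<omega> $ i) ^ e i) \<partial>M) = (\<Prod>i\<in>UNIV. \<integral>t. normal_density 0 (sqrt h) t * t ^ e i \<partial>lborel)"
      using distributed_integral[OF X, of "\<lambda>x. \<Prod>i\<in>UNIV. (x $ i) ^ e i"] nonneg lborel_vec_prod(2)[where f = "\<lambda>i t. normal_density 0 (sqrt h) t * t ^ e i", OF 0]
      by (simp add: eq)
  qed
  have I: "(\<integral>t. normal_density 0 (sqrt h) t \<partial>lborel) = 1" "(\<integral>t. normal_density 0 (sqrt h) t * t \<partial>lborel) = 0"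
    "(\<integral>t. normal_density 0 (sqrt h) t * t\<^sup>2 \<partial>lborel) = h" "(\<integral>t. normal_density 0 (sqrt h) t * t ^ 4 \<partial>lborel) = 3 * h\<^sup>2"
    using integral_normal_moment_even[of "sqrt h" 0 0] integral_normal_moment_odd[of "sqrt h" 0 0]
      integral_normal_moment_even[of "sqrt h" 0 1] integral_normal_moment_even[of "sqrt h" 0 2] h
    by (simp_all add: fact_numeral power2_eq_square field_simps)
  have one: "(\<Prod>k\<in>UNIV. (x $ k) ^ (if k = i then a else 0)) = (x $ i) ^ a" for x :: "real ^ 'n" and i a
    by (subst prod.remove[of _ i]) auto
  have pw: "integrable M (\<lambda>\<omega>. (X \<omega> $ i) ^ a)" "(\<integral>\<omega>. (X \<omega> $ i) ^ a \<partial>M) = (\<integral>t. normal_density 0 (sqrt h) t * t ^ a \<partial>lborel)" for i a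
  proof -
    show "integrable M (\<lambda>\<omega>. (X \<omega> $ i) ^ a)"
      using mom(1)[of "\<lambda>k. if k = i then a else 0"] by (simp add: one)
    show "(\<integral>\<omega>. (X \<omega> $ i) ^ a \<partial>M) = (\<integral>t. normal_density 0 (sqrt h) t * t ^ a \<partial>lborel)"
      using mom(2)[of "\<lambda>k. if k = i then a else 0"] by (subst (asm) prod.remove[of _ i]) (auto simp: one I)
  qed
  have two: "(\<Prod>k\<in>UNIV. (x $ k) ^ (if k = i \<or> k = j then 1 else 0)) = x $ i * x $ j" if "i \<noteq> j" for x :: "real ^ 'n" and i j
    using that by (subst prod.remove[of _ i], simp, simp, subst prod.remove[of _ j]) auto
  have mixed: "integrable M (\<lambda>\<omega>. X \<omega> $ i * X \<omega> $ j)" "(\<integral>\<omega>. X \<omega> $ i * X \<omega> $ j \<partial>M) = 0" if "i \<noteq> j" for i j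
  proof -
    show "integrable M (\<lambda>\<omega>. X \<omega> $ i * X \<omega> $ j)"
      using mom(1)[of "\<lambda>k. if k = i \<or> k = j then 1 else 0"] by (simp only: two[OF that])
    have "(\<Prod>k\<in>UNIV. \<integral>t. normal_density 0 (sqrt h) t * t ^ (if k = i \<or> k = j then 1 else 0) \<partial>lborel) = 0"
      by (subst prod.remove[of _ i]) (auto simp: I)
    then show "(\<integral>\<omega>. X \<omega> $ i * X \<omega> $ j \<partial>M) = 0"
      using mom(2)[of "\<lambda>k. if k = i \<or> k = j then 1 else 0"] by (simp only: two[OF that])
  qed
  show ?thesis unfolding isotropic_moments_def
  proof (intro conjI allI)
    show "prob_space (distr M borel X)" by (rule prob_space_distr) simp
    fix i j
    show "integrable (distr M borel X) (\<lambda>z. z $ i * z $ j)"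
      using pw(1)[of i 2] mixed(1)[of i j] by (subst integrable_distr_eq) (auto simp: power2_eq_square)
    show "(\<integral>z. z $ i * z $ j \<partial>distr M borel X) = (if i = j then h else 0)"
      using pw(2)[of i 2] mixed(2)[of i j] I by (subst integral_distr) (auto simp: power2_eq_square)
    show "integrable (distr M borel X) (\<lambda>z. (z $ i) ^ 4)"
      using pw(1)[of i 4] by (subst integrable_distr_eq) auto
    show "(\<integral>z. (z $ i) ^ 4 \<partial>distr M borel X) = 3 * h\<^sup>2"
      using pw(2)[of i 4] I by (subst integral_distr) auto
  qed simp
qed

text \<open>Bounded Lipschitz functions with uniformly quadratic Taylor remainder. The gradient \<open>v\<close> is an arbitrary
  measurable field, which makes the class invariant under averaging over translations.\<close>

definition taylor_bounded :: "real \<Rightarrow> real \<Rightarrow> real \<Rightarrow> ('a::euclidean_space \<Rightarrow> real) \<Rightarrow> bool" where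
  "taylor_bounded L K B g \<longleftrightarrow> L-lipschitz_on UNIV g \<and> (\<forall>x. \<bar>g x\<bar> \<le> B) \<and>
     (\<exists>v\<in>borel_measurable borel. \<forall>x. norm (v x) \<le> L \<and>
        (\<forall>z. \<bar>g (x + z) - g x - v x \<bullet> z\<bar> \<le> K * (norm z)\<^sup>2))"

lemma exp_le_cubic: "exp x \<le> 1 + x + x\<^sup>2 / 2 + \<bar>x\<bar> ^ 3 * exp \<bar>x\<bar>" for x :: real
proof -
  obtain t where t: "\<bar>t\<bar> \<le> \<bar>x\<bar>" and e: "exp x = (\<Sum>m<3. x ^ m / fact m) + exp t / fact 3 * x ^ 3"
    using Maclaurin_exp_le by blast
  have "exp t / fact 3 * x ^ 3 \<le> \<bar>exp t / fact 3 * x ^ 3\<bar>" by (rule abs_ge_self)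
  also have "\<dots> = exp t / 6 * \<bar>x\<bar> ^ 3" by (simp add: abs_mult power_abs fact_numeral)
  also have "\<dots> \<le> exp \<bar>x\<bar> * \<bar>x\<bar> ^ 3"
  proof (intro mult_right_mono)
    have "exp t / 6 \<le> exp t" by simp
    also have "\<dots> \<le> exp \<bar>x\<bar>" using t by simp
    finally show "exp t / 6 \<le> exp \<bar>x\<bar>" .
  qed simp
  finally show ?thesis unfolding e by (simp add: eval_nat_numeral fact_numeral mult.commute)
qed

text \<open>Write \<open>\<phi> z = g (x + z) - g x\<close>. Then \<open>e\<^sup>\<phi> \<le> 1 + \<phi> + \<phi>\<^sup>2 / 2 + O(|z|\<^sup>3)\<close> and
  \<open>\<phi>\<^sup>2 = \<langle>v, z\<rangle>\<^sup>2 + O(|z|\<^sup>3)\<close>, where \<open>\<langle>v, z\<rangle>\<^sup>2\<close> has mean \<open>h |v|\<^sup>2 \<le> h L\<^sup>2\<close>. This is the source of the sharp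
  constant \<open>1/2\<close>; the cubic terms are of order \<open>h\<^sup>3\<^sup>/\<^sup>2\<close> and vanish when many small steps are composed.\<close>

lemma isotropic_one_step:
  fixes \<gamma> :: "(real ^ 'n) measure"
  assumes mom: "isotropic_moments h \<gamma>" and h: "0 < h"
    and g: "taylor_bounded L K B g" and K: "0 \<le> K"
  shows "(\<integral>z. exp (g (x + z)) \<partial>\<gamma>) \<le> exp ((\<integral>z. g (x + z) \<partial>\<gamma>)
      + (h * L\<^sup>2 / 2 + (K * L + L ^ 3 * exp (2 * B)) * (real CARD('n) + 3 * (real CARD('n))\<^sup>2) / 2 * (h * sqrt h)))"
proof -
  interpret prob_space \<gamma> using mom by (simp add: isotropic_moments_def)
  have sets [measurable_cong, simp]: "sets \<gamma> = sets borel" using mom by (simp add: isotropic_moments_def)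
  define d where "d = real CARD('n)"
  have L: "L-lipschitz_on UNIV g" and B: "\<And>x. \<bar>g x\<bar> \<le> B" using g by (auto simp: taylor_bounded_def)
  have L0: "0 \<le> L" using L lipschitz_on_nonneg by blast
  obtain v where v: "norm v \<le> L" "\<And>z. \<bar>g (x + z) - g x - v \<bullet> z\<bar> \<le> K * (norm z)\<^sup>2"
    using g unfolding taylor_bounded_def by blast
  define \<phi> where "\<phi> z = g (x + z) - g x" for z
  have \<phi>_meas [measurable]: "\<phi> \<in> borel_measurable borel"
    unfolding \<phi>_def using L
    by (intro borel_measurable_continuous_onI continuous_intros
        continuous_on_compose2[OF lipschitz_on_continuous_on[OF L]]) auto
  have \<phi>L: "\<bar>\<phi> z\<bar> \<le> L * norm z" for z
    using lipschitz_on_normD[OF L, of "x + z" x] by (simp add: \<phi>_def)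
  have \<phi>B: "\<bar>\<phi> z\<bar> \<le> 2 * B" for z
    using B[of "x + z"] B[of x] by (simp add: \<phi>_def)
  define C0 where "C0 = K * L + L ^ 3 * exp (2 * B)"
  have C0: "0 \<le> C0" using K L0 by (simp add: C0_def)
  define q where "q z = (\<Sum>i\<in>UNIV. (z $ i)\<^sup>2)" for z :: "real ^ 'n"
  define r where "r z = (\<Sum>i\<in>UNIV. (z $ i) ^ 4)" for z :: "real ^ 'n"
  have nq: "(norm z)\<^sup>2 = q z" for z
    unfolding q_def power2_norm_eq_inner inner_vec_def by (simp add: power2_eq_square)
  have nr: "(norm z) ^ 4 \<le> d * r z" for z
  proof -
    have "(norm z) ^ 4 = (q z)\<^sup>2" unfolding nq[symmetric] by (simp flip: power_mult)
    also have "\<dots> = (\<Sum>i\<in>UNIV. 1 * (z $ i)\<^sup>2)\<^sup>2" by (simp add: q_def)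
    also have "\<dots> \<le> (\<Sum>i\<in>(UNIV :: 'n set). 1\<^sup>2) * (\<Sum>i\<in>UNIV. ((z $ i)\<^sup>2)\<^sup>2)" by (rule Cauchy_Schwarz_ineq_sum)
    also have "\<dots> = d * r z" by (simp add: d_def r_def flip: power_mult)
    finally show ?thesis .
  qed
  define s where "s = sqrt h"
  have s: "0 < s" "s * s = h" using h by (auto simp: s_def)
  have cube: "(norm z) ^ 3 \<le> (s * q z + d * r z / s) / 2" for z
  proof -
    have "0 \<le> (norm z)\<^sup>2 * (s - norm z)\<^sup>2" by simp
    then have "2 * s * (norm z) ^ 3 \<le> s * s * (norm z)\<^sup>2 + (norm z) ^ 4"
      by (simp add: power2_eq_square eval_nat_numeral algebra_simps)
    also have "\<dots> \<le> s * s * q z + d * r z" using nr[of z] by (simp add: nq)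
    also have "\<dots> = 2 * s * ((s * q z + d * r z / s) / 2)" using s(1) by (simp add: field_simps)
    finally show ?thesis using s(1) by (subst (asm) mult_le_cancel_left_pos) auto
  qed
  \<comment> \<open>An integrable majorant of \<open>e\<^sup>\<phi>\<close>; the cube \<open>|z|\<^sup>3\<close> is dominated by second and fourth moments, balanced by \<open>s = sqrt h\<close>.\<close>
  define U where "U z = 1 + \<phi> z + (v \<bullet> z)\<^sup>2 / 2 + C0 * ((s * q z + d * r z / s) / 2)" for z
  have le: "exp (\<phi> z) \<le> U z" for z
  proof -
    have "(\<phi> z)\<^sup>2 - (v \<bullet> z)\<^sup>2 = (\<phi> z - v \<bullet> z) * (\<phi> z + v \<bullet> z)" by (simp add: power2_eq_square algebra_simps)
    also have "\<dots> \<le> \<bar>\<phi> z - v \<bullet> z\<bar> * \<bar>\<phi> z + v \<bullet> z\<bar>" by (metis abs_ge_self abs_mult)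
    also have "\<dots> \<le> (K * (norm z)\<^sup>2) * (2 * (L * norm z))"
    proof (intro mult_mono)
      have "\<bar>v \<bullet> z\<bar> \<le> L * norm z"
        using Cauchy_Schwarz_ineq2[of v z] mult_right_mono[OF v(1) norm_ge_zero[of z]] by linarith
      then show "\<bar>\<phi> z + v \<bullet> z\<bar> \<le> 2 * (L * norm z)" using \<phi>L[of z] by linarith
    qed (use v(2)[of z] K in \<open>auto simp: \<phi>_def\<close>)
    finally have 1: "(\<phi> z)\<^sup>2 / 2 \<le> (v \<bullet> z)\<^sup>2 / 2 + K * L * (norm z) ^ 3"
      by (simp add: eval_nat_numeral algebra_simps)
    have "\<bar>\<phi> z\<bar> ^ 3 * exp \<bar>\<phi> z\<bar> \<le> (L * norm z) ^ 3 * exp (2 * B)"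
      using \<phi>L[of z] \<phi>B[of z] L0 by (intro mult_mono power_mono) auto
    then have "exp (\<phi> z) \<le> 1 + \<phi> z + (v \<bullet> z)\<^sup>2 / 2 + C0 * (norm z) ^ 3"
      using exp_le_cubic[of "\<phi> z"] 1 by (simp add: C0_def power_mult_distrib algebra_simps)
    also have "\<dots> \<le> U z" unfolding U_def using mult_left_mono[OF cube C0] by simp
    finally show ?thesis .
  qed
  have int2: "integrable \<gamma> (\<lambda>z. z $ i * z $ j)" "(\<integral>z. z $ i * z $ j \<partial>\<gamma>) = (if i = j then h else 0)"
    and int4: "integrable \<gamma> (\<lambda>z. (z $ i) ^ 4)" "(\<integral>z. (z $ i) ^ 4 \<partial>\<gamma>) = 3 * h\<^sup>2" for i j
    using mom by (auto simp: isotropic_moments_def)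
  have intq: "integrable \<gamma> q" "(\<integral>z. q z \<partial>\<gamma>) = d * h"
    unfolding q_def d_def using int2 by (auto simp: power2_eq_square)
  have intr: "integrable \<gamma> r" "(\<integral>z. r z \<partial>\<gamma>) = d * (3 * h\<^sup>2)"
    unfolding r_def d_def using int4 by auto
  have vz: "(v \<bullet> z)\<^sup>2 = (\<Sum>i\<in>UNIV. \<Sum>j\<in>UNIV. (v $ i * v $ j) * (z $ i * z $ j))" for z
    by (simp add: inner_vec_def power2_eq_square sum_product mult_ac)
  have intv: "integrable \<gamma> (\<lambda>z. (v \<bullet> z)\<^sup>2)" unfolding vz using int2 by auto
  have "(\<integral>z. (v \<bullet> z)\<^sup>2 \<partial>\<gamma>) = (\<Sum>i\<in>UNIV. \<Sum>j\<in>UNIV. (v $ i * v $ j) * (if i = j then h else 0))"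
    unfolding vz using int2 by simp
  also have "\<dots> = h * (norm v)\<^sup>2"
    by (simp add: power2_norm_eq_inner inner_vec_def sum_distrib_left if_distrib mult_ac cong: if_cong)
  also have "\<dots> \<le> h * L\<^sup>2" using v(1) h by (intro mult_left_mono power_mono) auto
  finally have Ev: "(\<integral>z. (v \<bullet> z)\<^sup>2 \<partial>\<gamma>) \<le> h * L\<^sup>2" .
  have int\<phi>: "integrable \<gamma> \<phi>" by (rule integrable_bounded[OF _ \<phi>B]) simp
  have "(\<integral>z. exp (\<phi> z) \<partial>\<gamma>) \<le> (\<integral>z. U z \<partial>\<gamma>)"
  proof (rule integral_mono[OF _ _ le])
    show "integrable \<gamma> (\<lambda>z. exp (\<phi> z))"
      using \<phi>B by (intro integrable_bounded[where B = "exp (2 * B)"]) (auto simp: abs_le_iff)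
    show "integrable \<gamma> U" unfolding U_def using int\<phi> intv intq intr by auto
  qed
  also have "\<dots> = 1 + (\<integral>z. \<phi> z \<partial>\<gamma>) + (\<integral>z. (v \<bullet> z)\<^sup>2 \<partial>\<gamma>) / 2 + C0 * ((s * (d * h) + d * (d * (3 * h\<^sup>2)) / s) / 2)"
    unfolding U_def using int\<phi> intv intq intr by (simp add: prob_space)
  also have "\<dots> = 1 + (\<integral>z. \<phi> z \<partial>\<gamma>) + (\<integral>z. (v \<bullet> z)\<^sup>2 \<partial>\<gamma>) / 2 + C0 * (d + 3 * d\<^sup>2) / 2 * (h * s)"
  proof -
    have "h\<^sup>2 / s = h * s" using s by (simp add: power2_eq_square field_simps)
    moreover have "d * (d * (3 * h\<^sup>2)) / s = 3 * d\<^sup>2 * (h\<^sup>2 / s)" by (simp add: power2_eq_square)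
    ultimately have "d * (d * (3 * h\<^sup>2)) / s = 3 * d\<^sup>2 * (h * s)" by (simp only:)
    then show ?thesis by (simp add: algebra_simps)
  qed
  also have "\<dots> \<le> 1 + ((\<integral>z. \<phi> z \<partial>\<gamma>) + (h * L\<^sup>2 / 2 + C0 * (d + 3 * d\<^sup>2) / 2 * (h * s)))"
    using Ev by simp
  also have "\<dots> \<le> exp ((\<integral>z. \<phi> z \<partial>\<gamma>) + (h * L\<^sup>2 / 2 + C0 * (d + 3 * d\<^sup>2) / 2 * (h * s)))"
    by (rule exp_ge_add_one_self)
  finally have main: "(\<integral>z. exp (\<phi> z) \<partial>\<gamma>) \<le> exp ((\<integral>z. \<phi> z \<partial>\<gamma>) + (h * L\<^sup>2 / 2 + C0 * (d + 3 * d\<^sup>2) / 2 * (h * s)))" .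
  have "(\<integral>z. exp (g (x + z)) \<partial>\<gamma>) = (\<integral>z. exp (g x) * exp (\<phi> z) \<partial>\<gamma>)"
    by (simp add: \<phi>_def flip: exp_add)
  also have "\<dots> = exp (g x) * (\<integral>z. exp (\<phi> z) \<partial>\<gamma>)" by simp
  also have "\<dots> \<le> exp (g x) * exp ((\<integral>z. \<phi> z \<partial>\<gamma>) + (h * L\<^sup>2 / 2 + C0 * (d + 3 * d\<^sup>2) / 2 * (h * s)))"
    using main by (intro mult_left_mono) auto
  also have "\<dots> = exp ((g x + (\<integral>z. \<phi> z \<partial>\<gamma>)) + (h * L\<^sup>2 / 2 + C0 * (d + 3 * d\<^sup>2) / 2 * (h * s)))"
    by (simp add: exp_add mult_ac)
  also have "g x + (\<integral>z. \<phi> z \<partial>\<gamma>) = (\<integral>z. g (x + z) \<partial>\<gamma>)"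
  proof -
    have "(\<integral>z. g (x + z) \<partial>\<gamma>) = (\<integral>z. g x + \<phi> z \<partial>\<gamma>)" by (simp add: \<phi>_def)
    also have "\<dots> = g x + (\<integral>z. \<phi> z \<partial>\<gamma>)" using int\<phi> by (simp add: prob_space)
    finally show ?thesis by simp
  qed
  finally show ?thesis by (simp add: C0_def d_def s_def)
qed

text \<open>The two variables may take values in different spaces, as needed for an initial value and a whole path.\<close>

lemma (in prob_space) independent_integral:
  fixes F :: "'b \<times> 'c \<Rightarrow> real"
  assumes X [measurable]: "X \<in> M \<rightarrow>\<^sub>M S" and Y [measurable]: "Y \<in> M \<rightarrow>\<^sub>M T"
    and ind: "\<And>A B. A \<in> sets S \<Longrightarrow> B \<in> sets T \<Longrightarrow>
      prob ((\<lambda>\<omega>. (X \<omega>, Y \<omega>)) -` (A \<times> B) \<inter> space M) = prob (X -` A \<inter> space M) * prob (Y -` B \<inter> space M)"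
    and F [measurable]: "F \<in> borel_measurable (S \<Otimes>\<^sub>M T)" and B: "\<And>p. \<bar>F p\<bar> \<le> B"
  shows "(\<integral>\<omega>. F (X \<omega>, Y \<omega>) \<partial>M) = (\<integral>x. (\<integral>\<omega>. F (x, Y \<omega>) \<partial>M) \<partial>distr M S X)"
proof -
  interpret X: prob_space "distr M S X" by (rule prob_space_distr) simp
  interpret Y: prob_space "distr M T Y" by (rule prob_space_distr) simp
  interpret XY: pair_prob_space "distr M S X" "distr M T Y" ..
  have eq: "distr M S X \<Otimes>\<^sub>M distr M T Y = distr M (S \<Otimes>\<^sub>M T) (\<lambda>\<omega>. (X \<omega>, Y \<omega>))"
  proof (rule pair_measure_eqI)
    fix A B assume "A \<in> sets (distr M S X)" "B \<in> sets (distr M T Y)"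
    then show "emeasure (distr M S X) A * emeasure (distr M T Y) B
        = emeasure (distr M (S \<Otimes>\<^sub>M T) (\<lambda>\<omega>. (X \<omega>, Y \<omega>))) (A \<times> B)"
      using ind[of A B] by (simp add: emeasure_distr emeasure_eq_measure ennreal_mult'')
  qed (auto intro: X.sigma_finite_measure_axioms Y.sigma_finite_measure_axioms)
  have "(\<integral>\<omega>. F (X \<omega>, Y \<omega>) \<partial>M) = (\<integral>p. F p \<partial>(distr M S X \<Otimes>\<^sub>M distr M T Y))"
    unfolding eq by (subst integral_distr) auto
  also have "\<dots> = (\<integral>x. (\<integral>y. F (x, y) \<partial>distr M T Y) \<partial>distr M S X)"
    by (rule XY.integral_fst'[symmetric], rule XY.P.integrable_bounded[OF _ B]) simp
  also have "\<dots> = (\<integral>x. (\<integral>\<omega>. F (x, Y \<omega>) \<partial>M) \<partial>distr M S X)"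
    by (intro Bochner_Integration.integral_cong refl) (simp add: integral_distr)
  finally show ?thesis .
qed

lemma chain_measurable:
  fixes J :: "nat \<Rightarrow> 'a::{second_countable_topology, real_normed_vector} \<Rightarrow> 'a"
  assumes J: "\<And>k. J k \<in> borel_measurable borel"
    and z: "\<And>k. k < m \<Longrightarrow> (\<lambda>\<omega>. z \<omega> k) \<in> borel_measurable N" and x: "x \<in> borel_measurable N"
  shows "(\<lambda>\<omega>. chain J (z \<omega>) (x \<omega>) m) \<in> borel_measurable N"
  using z
proof (induction m)
  case (Suc m)
  have "(\<lambda>\<omega>. chain J (z \<omega>) (x \<omega>) m + z \<omega> m) \<in> borel_measurable N"
    using Suc by (intro borel_measurable_add) auto
  then show ?case using J by (simp add: measurable_compose)
qed (use x in simp)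

text \<open>The state after \<open>m\<close> steps is a function of the first \<open>m\<close> increments, hence independent of the next one,
  which can therefore be integrated out first.\<close>

lemma (in prob_space) chain_step:
  fixes \<xi> :: "nat \<Rightarrow> 'a \<Rightarrow> 'b::{second_countable_topology, real_normed_vector}"
  assumes ind: "indep_vars (\<lambda>_. borel) \<xi> {..<Suc m}"
    and J: "\<And>k. J k \<in> borel_measurable borel"
    and f: "f \<in> borel_measurable borel" and B: "\<And>x. \<bar>f x :: real\<bar> \<le> B"
  shows "(\<integral>\<omega>. f (chain J (\<lambda>k. \<xi> k \<omega>) x (Suc m)) \<partial>M)
    = (\<integral>\<omega>. (\<integral>\<omega>'. f (J m (chain J (\<lambda>k. \<xi> k \<omega>) x m + \<xi> m \<omega>')) \<partial>M) \<partial>M)"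
proof -
  have \<xi> [measurable]: "\<xi> k \<in> borel_measurable M" if "k < Suc m" for k
    using ind that unfolding indep_vars_def by auto
  let ?S = "\<lambda>\<omega>. chain J (\<lambda>k. \<xi> k \<omega>) x m"
  have "indep_var borel ((\<lambda>z. chain J z x m) \<circ> (\<lambda>\<omega>. \<lambda>k\<in>{..<m}. \<xi> k \<omega>)) borel ((\<lambda>z. z m) \<circ> (\<lambda>\<omega>. \<lambda>k\<in>{m}. \<xi> k \<omega>))"
    by (rule indep_var_compose[OF indep_var_restrict[OF ind]])
       (auto intro!: chain_measurable J)
  also have "(\<lambda>z. chain J z x m) \<circ> (\<lambda>\<omega>. \<lambda>k\<in>{..<m}. \<xi> k \<omega>) = ?S"
    by (auto simp: fun_eq_iff intro: chain_cong)
  also have "(\<lambda>z. z m) \<circ> (\<lambda>\<omega>. \<lambda>k\<in>{m}. \<xi> k \<omega>) = \<xi> m" by auto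
  finally have ind': "indep_var borel ?S borel (\<xi> m)" .
  have S [measurable]: "?S \<in> borel_measurable M" using ind' by (rule indep_var_rv1)
  have F [measurable]: "(\<lambda>p. f (J m (fst p + snd p))) \<in> borel_measurable (borel \<Otimes>\<^sub>M borel)"
    by (intro measurable_compose[OF _ f] measurable_compose[OF _ J]) measurable
  have m': "\<xi> m \<in> borel_measurable M" by simp
  have "(\<integral>\<omega>. f (chain J (\<lambda>k. \<xi> k \<omega>) x (Suc m)) \<partial>M) = (\<integral>s. (\<integral>\<omega>'. f (J m (s + \<xi> m \<omega>')) \<partial>M) \<partial>distr M borel ?S)"
    using independent_integral[OF S m' indep_varD[OF ind'] F B] by (simp only: chain.simps fst_conv snd_conv)
  also have "\<dots> = (\<integral>\<omega>. (\<integral>\<omega>'. f (J m (?S \<omega> + \<xi> m \<omega>')) \<partial>M) \<partial>M)"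
  proof (rule integral_distr[OF S])
    have "(\<lambda>p. f (J m (fst p + \<xi> m (snd p)))) \<in> borel_measurable (borel \<Otimes>\<^sub>M M)"
      using m' by (intro measurable_compose[OF _ f] measurable_compose[OF _ J]) measurable
    then show "(\<lambda>s. \<integral>\<omega>'. f (J m (s + \<xi> m \<omega>')) \<partial>M) \<in> borel_measurable borel"
      using borel_measurable_lebesgue_integral[of "\<lambda>s \<omega>'. f (J m (s + \<xi> m \<omega>'))" borel] by (simp add: split_beta')
  qed
  finally show ?thesis .
qed

lemma taylor_bounded_average:
  fixes \<gamma> :: "'a::euclidean_space measure"
  assumes "prob_space \<gamma>" "sets \<gamma> = sets borel" and g: "taylor_bounded L K B g"
  shows "taylor_bounded L K B (\<lambda>x. \<integral>z. g (x + z) \<partial>\<gamma>)"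
proof -
  interpret prob_space \<gamma> by fact
  note [measurable_cong] = assms(2)
  have L: "L-lipschitz_on UNIV g" and B: "\<And>x. \<bar>g x\<bar> \<le> B" using g by (auto simp: taylor_bounded_def)
  have L0: "0 \<le> L" using L lipschitz_on_nonneg by blast
  have gm [measurable]: "g \<in> borel_measurable borel" using L by (rule lipschitz_measurable)
  obtain v where v [measurable]: "v \<in> borel_measurable borel" and vL: "\<And>x. norm (v x) \<le> L"
    and vK: "\<And>x z. \<bar>g (x + z) - g x - v x \<bullet> z\<bar> \<le> K * (norm z)\<^sup>2"
    using g unfolding taylor_bounded_def by blast
  have ig: "integrable \<gamma> (\<lambda>z. g (x + z))" for x
    by (rule integrable_bounded[OF _ B]) measurable
  have iv: "integrable \<gamma> (\<lambda>z. v (x + z))" for x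
    using vL by (intro integrable_const_bound[where B = L]) auto
  have bound: "\<bar>\<integral>z. f z \<partial>\<gamma>\<bar> \<le> C" if "integrable \<gamma> f" "\<And>z. \<bar>f z\<bar> \<le> C" for f :: "'a \<Rightarrow> real" and C
  proof -
    have "\<bar>\<integral>z. f z \<partial>\<gamma>\<bar> \<le> (\<integral>z. \<bar>f z\<bar> \<partial>\<gamma>)" by (rule integral_abs_bound)
    also have "\<dots> \<le> (\<integral>z. C \<partial>\<gamma>)" using that by (intro integral_mono) auto
    finally show ?thesis by (simp add: prob_space)
  qed
  show ?thesis unfolding taylor_bounded_def
  proof (intro conjI allI bexI[where x = "\<lambda>x. \<integral>z. v (x + z) \<partial>\<gamma>"])
    show "L-lipschitz_on UNIV (\<lambda>x. \<integral>z. g (x + z) \<partial>\<gamma>)"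
    proof (rule lipschitz_onI[OF _ L0])
      fix x y
      have "\<bar>\<integral>z. g (x + z) - g (y + z) \<partial>\<gamma>\<bar> \<le> L * dist x y"
        using lipschitz_onD[OF L, of "x + z" "y + z" for z] ig by (intro bound) (auto simp: dist_real_def)
      then show "dist (\<integral>z. g (x + z) \<partial>\<gamma>) (\<integral>z. g (y + z) \<partial>\<gamma>) \<le> L * dist x y"
        using ig by (simp add: dist_real_def)
    qed
    show "\<bar>\<integral>z. g (x + z) \<partial>\<gamma>\<bar> \<le> B" for x by (rule bound[OF ig B])
    show "(\<lambda>x. \<integral>z. v (x + z) \<partial>\<gamma>) \<in> borel_measurable borel" by measurable
    fix x
    have "norm (\<integral>z. v (x + z) \<partial>\<gamma>) \<le> (\<integral>z. norm (v (x + z)) \<partial>\<gamma>)" by (rule integral_norm_bound)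
    also have "\<dots> \<le> (\<integral>z. L \<partial>\<gamma>)" using iv vL by (intro integral_mono) auto
    finally show "norm (\<integral>z. v (x + z) \<partial>\<gamma>) \<le> L" by (simp add: prob_space)
    fix y
    have "(\<integral>z. g (x + y + z) \<partial>\<gamma>) - (\<integral>z. g (x + z) \<partial>\<gamma>) - (\<integral>z. v (x + z) \<partial>\<gamma>) \<bullet> y
        = (\<integral>z. g (x + y + z) - g (x + z) - v (x + z) \<bullet> y \<partial>\<gamma>)"
      using ig iv by simp
    also have "\<bar>\<dots>\<bar> \<le> K * (norm y)\<^sup>2"
    proof (rule bound)
      show "integrable \<gamma> (\<lambda>z. g (x + y + z) - g (x + z) - v (x + z) \<bullet> y)"
        by (intro Bochner_Integration.integrable_diff ig integrable_inner_left iv)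
      show "\<bar>g (x + y + z) - g (x + z) - v (x + z) \<bullet> y\<bar> \<le> K * (norm y)\<^sup>2" for z
        using vK[of "x + z" y] by (simp add: add_ac)
    qed
    finally show "\<bar>(\<integral>z. g (x + y + z) \<partial>\<gamma>) - (\<integral>z. g (x + z) \<partial>\<gamma>) - (\<integral>z. v (x + z) \<partial>\<gamma>) \<bullet> y\<bar> \<le> K * (norm y)\<^sup>2" .
  qed
qed

text \<open>The gradient is bounded by the Lipschitz constant: compare the Taylor expansion with the Lipschitz bound
  along small multiples of the gradient.\<close>

lemma smooth_taylor_bounded:
  fixes f :: "real ^ 'n \<Rightarrow> real"
  assumes f: "smooth f" and supp: "compact (closure {x. f x \<noteq> 0})" and L: "L-lipschitz_on UNIV f"
  obtains K B where "0 \<le> K" "taylor_bounded L K B f"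
proof -
  have C: "C_k k f" for k using f by (simp add: smooth_def)
  obtain K where K: "0 \<le> K" "\<And>x z. \<bar>f (x + z) - f x - grad f x \<bullet> z\<bar> \<le> K * (norm z)\<^sup>2"
    using compact_support_taylor[OF C supp] by blast
  obtain B where B: "\<And>x. norm (f x) \<le> B"
    using compact_support_bounded[OF C_k_continuous[OF C] supp] by blast
  have gL: "norm (grad f x) \<le> L" for x
  proof -
    let ?v = "grad f x"
    have "(norm ?v)\<^sup>2 \<le> L * norm ?v"
    proof (rule tendsto_le[OF trivial_limit_at_right_real])
      show "((\<lambda>e. L * norm ?v + K * e * (norm ?v)\<^sup>2) \<longlongrightarrow> L * norm ?v) (at_right 0)"
        by (auto intro!: tendsto_eq_intros)
      show "((\<lambda>e. (norm ?v)\<^sup>2) \<longlongrightarrow> (norm ?v)\<^sup>2) (at_right 0)" by simp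
      show "\<forall>\<^sub>F e in at_right (0::real). (norm ?v)\<^sup>2 \<le> L * norm ?v + K * e * (norm ?v)\<^sup>2"
        unfolding eventually_at_right_field
      proof (intro exI[of _ 1] conjI allI impI)
        fix e :: real assume e: "0 < e" "e < 1"
        have "\<bar>f (x + e *\<^sub>R ?v) - f x\<bar> \<le> L * norm (e *\<^sub>R ?v)"
          using lipschitz_on_normD[OF L, of "x + e *\<^sub>R ?v" x] by simp
        then have "?v \<bullet> (e *\<^sub>R ?v) \<le> L * norm (e *\<^sub>R ?v) + K * (norm (e *\<^sub>R ?v))\<^sup>2"
          using K(2)[of x "e *\<^sub>R ?v"] by linarith
        then have "e * (norm ?v)\<^sup>2 \<le> e * (L * norm ?v + K * e * (norm ?v)\<^sup>2)"
          using e by (simp add: dot_square_norm power_mult_distrib algebra_simps power2_eq_square)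
        then show "(norm ?v)\<^sup>2 \<le> L * norm ?v + K * e * (norm ?v)\<^sup>2" using e by simp
      qed simp
    qed
    then have "norm ?v * norm ?v \<le> L * norm ?v" by (simp add: power2_eq_square)
    then show ?thesis using lipschitz_on_nonneg[OF L] by (cases "norm ?v = 0") (auto simp: mult_le_cancel_right)
  qed
  have "grad f \<in> borel_measurable borel"
    using continuous_grad[OF C] by (rule borel_measurable_continuous_onI)
  then have "taylor_bounded L K B f"
    unfolding taylor_bounded_def using L B gL K by (auto intro!: bexI[of _ "grad f"])
  then show ?thesis using K(1) that by blast
qed

locale brownian =
  fixes M :: "'w measure" and W :: "real \<Rightarrow> 'w \<Rightarrow> real ^ 'n"
  assumes bm: "brownian_motion M W"
begin

sublocale prob_space M using bm by (simp add: brownian_motion_def)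

lemma W_measurable: "0 \<le> t \<Longrightarrow> W t \<in> borel_measurable M"
  using bm by (simp add: brownian_motion_def)

lemma W_continuous: "AE \<omega> in M. continuous_on {0..} (\<lambda>t. W t \<omega>)"
  using bm by (simp add: brownian_motion_def)

lemma increments_indep:
  assumes "0 \<le> \<tau> 0" "mono \<tau>"
  shows "indep_vars (\<lambda>_. borel) (\<lambda>k \<omega>. W (\<tau> (Suc k)) \<omega> - W (\<tau> k) \<omega>) {..<n}"
  using bm assms by (simp add: brownian_motion_def)

lemma increment_distributed:
  assumes "0 \<le> s" "s < t"
  shows "distributed M lborel (\<lambda>\<omega>. W t \<omega> - W s \<omega>) (\<lambda>x. ennreal (\<Prod>i\<in>UNIV. normal_density 0 (sqrt (t - s)) (x $ i)))"
  using bm assms by (simp add: brownian_motion_def)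

lemma increment_law:
  assumes "0 \<le> s" "s \<le> t" "0 \<le> s'" "s' \<le> t'" "t - s = t' - s'"
  shows "distr M borel (\<lambda>\<omega>. W t \<omega> - W s \<omega>) = distr M borel (\<lambda>\<omega>. W t' \<omega> - W s' \<omega>)"
proof (cases "s = t")
  case True
  then show ?thesis using assms by simp
next
  case False
  then have "distr M lborel (\<lambda>\<omega>. W t \<omega> - W s \<omega>) = distr M lborel (\<lambda>\<omega>. W t' \<omega> - W s' \<omega>)"
    using increment_distributed[of s t] increment_distributed[of s' t'] assms
    by (simp add: distributed_distr_eq_density)
  moreover have "distr M borel X = distr M lborel X" for X :: "'w \<Rightarrow> real ^ 'n"
    by (rule distr_cong) auto
  ultimately show ?thesis by simp
qed

lemma increment_moments:
  assumes "0 \<le> s" "s < t"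
  shows "isotropic_moments (t - s) (distr M borel (\<lambda>\<omega>. W t \<omega> - W s \<omega>))"
  using normal_vec_moments[OF prob_space_axioms _ increment_distributed[OF assms]] assms by simp

text \<open>Averaging over one small increment maps the class \<^const>\<open>taylor_bounded\<close> into itself with the same
  constants, so the one-step bound can be iterated with a total error \<open>k O(h\<^sup>3\<^sup>/\<^sup>2)\<close>.\<close>

lemma increment_exp_moment_taylor:
  assumes s: "0 \<le> s" and h: "0 < h" and g: "taylor_bounded L K B g" and K: "0 \<le> K"
    and C: "C = (K * L + L ^ 3 * exp (2 * B)) * (real CARD('n) + 3 * (real CARD('n))\<^sup>2) / 2"
  shows "(\<integral>\<omega>. exp (g (W (s + real k * h) \<omega> - W s \<omega>)) \<partial>M)
    \<le> exp ((\<integral>\<omega>. g (W (s + real k * h) \<omega> - W s \<omega>) \<partial>M) + real k * (h * L\<^sup>2 / 2 + C * (h * sqrt h)))"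
proof -
  define \<tau> where "\<tau> k = s + real k * h" for k
  define \<xi> where "\<xi> k \<omega> = W (\<tau> (Suc k)) \<omega> - W (\<tau> k) \<omega>" for k \<omega>
  define c where "c = h * L\<^sup>2 / 2 + C * (h * sqrt h)"
  have \<tau>: "0 \<le> \<tau> k" "\<tau> k < \<tau> (Suc k)" for k using s h by (auto simp: \<tau>_def algebra_simps)
  have ind: "indep_vars (\<lambda>_. borel) \<xi> {..<n}" for n
    unfolding \<xi>_def using s h by (intro increments_indep) (auto simp: \<tau>_def mono_def mult_right_mono)
  have [measurable]: "\<xi> k \<in> borel_measurable M" for k
    unfolding \<xi>_def using \<tau> by (intro borel_measurable_diff W_measurable)
  define \<gamma> where "\<gamma> = distr M borel (\<xi> 0)"
  have law: "distr M borel (\<xi> k) = \<gamma>" for k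
    unfolding \<gamma>_def \<xi>_def by (rule increment_law[OF \<tau>(1) less_imp_le[OF \<tau>(2)] \<tau>(1) less_imp_le[OF \<tau>(2)]])
      (simp add: \<tau>_def algebra_simps)
  have mom: "isotropic_moments h \<gamma>"
    using increment_moments[of "\<tau> 0" "\<tau> 1"] \<tau>[of 0] by (simp add: \<gamma>_def \<xi>_def[abs_def] \<tau>_def)
  have p: "prob_space \<gamma>" "sets \<gamma> = sets borel" using mom by (auto simp: isotropic_moments_def)
  let ?S = "\<lambda>k \<omega>. chain (\<lambda>_ x. x) (\<lambda>k. \<xi> k \<omega>) 0 k"
  have S: "?S k \<omega> = W (s + real k * h) \<omega> - W s \<omega>" for k \<omega>
    by (induction k) (auto simp: \<xi>_def \<tau>_def)
  have Sm [measurable]: "?S k \<in> borel_measurable M" for k by (intro chain_measurable) auto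
  have step: "(\<integral>\<omega>. f (?S (Suc k) \<omega>) \<partial>M) = (\<integral>\<omega>. (\<integral>z. f (?S k \<omega> + z) \<partial>\<gamma>) \<partial>M)"
    if f [measurable]: "f \<in> borel_measurable borel" and fB: "\<And>x. \<bar>f x :: real\<bar> \<le> B'" for f k B'
  proof -
    have "(\<integral>\<omega>. f (?S (Suc k) \<omega>) \<partial>M) = (\<integral>\<omega>. (\<integral>\<omega>'. f (?S k \<omega> + \<xi> k \<omega>') \<partial>M) \<partial>M)"
      by (rule chain_step[OF ind _ f fB]) simp
    also have "\<dots> = (\<integral>\<omega>. (\<integral>z. f (?S k \<omega> + z) \<partial>\<gamma>) \<partial>M)"
      unfolding law[of k, symmetric] by (simp add: integral_distr)
    finally show ?thesis .
  qed
  have "(\<integral>\<omega>. exp (g (?S k \<omega>)) \<partial>M) \<le> exp ((\<integral>\<omega>. g (?S k \<omega>) \<partial>M) + real k * c)"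
    using g
  proof (induction k arbitrary: g)
    case 0
    then show ?case by (simp add: prob_space)
  next
    case (Suc k)
    have gB: "\<bar>g x\<bar> \<le> B" for x using Suc.prems by (simp add: taylor_bounded_def)
    have [measurable]: "g \<in> borel_measurable borel"
      using Suc.prems lipschitz_measurable unfolding taylor_bounded_def by blast
    define Rg where "Rg x = (\<integral>z. g (x + z) \<partial>\<gamma>)" for x
    have Rg: "taylor_bounded L K B Rg"
      unfolding Rg_def by (rule taylor_bounded_average[OF p Suc.prems])
    then have RgB: "\<bar>Rg x\<bar> \<le> B" for x by (simp add: taylor_bounded_def)
    have [measurable]: "Rg \<in> borel_measurable borel"
      using Rg lipschitz_measurable unfolding taylor_bounded_def by blast
    have one: "(\<integral>z. exp (g (x + z)) \<partial>\<gamma>) \<le> exp (Rg x) * exp c" for x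
      using isotropic_one_step[OF mom h Suc.prems K, of x] by (simp add: Rg_def c_def C exp_add)
    interpret \<gamma>: prob_space \<gamma> by (rule p)
    note [measurable_cong] = p(2)
    have eB: "\<bar>exp (g x)\<bar> \<le> exp B" for x using gB[of x] by (simp add: abs_le_iff)
    have "(\<integral>\<omega>. exp (g (?S (Suc k) \<omega>)) \<partial>M) = (\<integral>\<omega>. (\<integral>z. exp (g (?S k \<omega> + z)) \<partial>\<gamma>) \<partial>M)"
      by (rule step[OF _ eB]) measurable
    also have "\<dots> \<le> (\<integral>\<omega>. exp (Rg (?S k \<omega>)) * exp c \<partial>M)"
    proof (rule integral_mono[OF _ _ one])
      have "\<bar>\<integral>z. exp (g (x + z)) \<partial>\<gamma>\<bar> \<le> exp B * exp c" for x
      proof -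
        have "0 \<le> (\<integral>z. exp (g (x + z)) \<partial>\<gamma>)" by simp
        moreover have "exp (Rg x) * exp c \<le> exp B * exp c" using RgB[of x] by (simp add: abs_le_iff)
        ultimately show ?thesis using one[of x] by linarith
      qed
      then show "integrable M (\<lambda>\<omega>. \<integral>z. exp (g (?S k \<omega> + z)) \<partial>\<gamma>)"
        by (intro integrable_bounded) measurable
      show "integrable M (\<lambda>\<omega>. exp (Rg (?S k \<omega>)) * exp c)"
        using RgB by (intro integrable_mult_left integrable_bounded[where B = "exp B"]) (auto simp: abs_le_iff)
    qed
    also have "\<dots> = (\<integral>\<omega>. exp (Rg (?S k \<omega>)) \<partial>M) * exp c" by simp
    also have "\<dots> \<le> exp ((\<integral>\<omega>. Rg (?S k \<omega>) \<partial>M) + real k * c) * exp c"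
      by (intro mult_right_mono Suc.IH[OF Rg]) simp
    also have "(\<integral>\<omega>. Rg (?S k \<omega>) \<partial>M) = (\<integral>\<omega>. g (?S (Suc k) \<omega>) \<partial>M)"
      unfolding Rg_def by (rule step[OF _ gB, symmetric]) measurable
    also have "exp ((\<integral>\<omega>. g (?S (Suc k) \<omega>) \<partial>M) + real k * c) * exp c
        = exp ((\<integral>\<omega>. g (?S (Suc k) \<omega>) \<partial>M) + real (Suc k) * c)"
      by (simp only: exp_add[symmetric]) (simp add: algebra_simps)
    finally show ?case .
  qed
  then show ?thesis by (simp add: S c_def)
qed

text \<open>An increment over a time \<open>u\<close> is a sum of \<open>n\<close> increments over \<open>u / n\<close>; the accumulated error is of order
  \<open>n (u / n)\<^sup>3\<^sup>/\<^sup>2\<close> and tends to \<open>0\<close>.\<close>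

lemma increment_concentration:
  assumes s: "0 \<le> s" "s \<le> t"
  shows "lipschitz_concentration ((t - s) / 2) (distr M borel (\<lambda>\<omega>. W t \<omega> - W s \<omega>))"
proof -
  let ?X = "\<lambda>\<omega>. W t \<omega> - W s \<omega>"
  have X [measurable]: "?X \<in> borel_measurable M" using s by (intro borel_measurable_diff W_measurable) auto
  have "GCBS ((t - s) / 2) (distr M borel ?X)"
    unfolding GCBS_def
  proof (intro conjI allI impI; (elim conjE)?)
    show "0 \<le> (t - s) / 2" using s by simp
    fix f :: "real ^ 'n \<Rightarrow> real" assume f: "smooth f" "compact (closure {x. f x \<noteq> 0})"
    define L where "L = lip f"
    have "C_k 1 f" using f(1) by (simp add: smooth_def)
    then have L: "L-lipschitz_on UNIV f"
      using compact_support_lipschitz[OF _ f(2)] lip_is_lipschitz(1) unfolding L_def by metis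
    obtain K B where K: "0 \<le> K" and T: "taylor_bounded L K B f" using smooth_taylor_bounded[OF f L] by blast
    have fB: "\<And>x. \<bar>f x\<bar> \<le> B" using T by (simp add: taylor_bounded_def)
    have fm [measurable]: "f \<in> borel_measurable borel" using L by (rule lipschitz_measurable)
    define C where "C = (K * L + L ^ 3 * exp (2 * B)) * (real CARD('n) + 3 * (real CARD('n))\<^sup>2) / 2"
    have "(\<integral>\<omega>. exp (f (?X \<omega>)) \<partial>M) \<le> exp ((\<integral>\<omega>. f (?X \<omega>) \<partial>M) + (t - s) / 2 * L\<^sup>2)"
    proof (cases "s = t")
      case True
      then show ?thesis by (simp add: prob_space)
    next
      case False
      define u where "u = t - s"
      have u: "0 < u" using False s by (simp add: u_def)
      have "(\<integral>\<omega>. exp (f (?X \<omega>)) \<partial>M) \<le> exp ((\<integral>\<omega>. f (?X \<omega>) \<partial>M) + (u * L\<^sup>2 / 2 + C * u * sqrt (u / real (Suc n))))" for n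
      proof -
        have m: "real (Suc n) * (u / real (Suc n)) = u" by simp
        have "real (Suc n) * (u / real (Suc n) * L\<^sup>2 / 2 + C * (u / real (Suc n) * sqrt (u / real (Suc n))))
            = u * L\<^sup>2 / 2 + C * u * sqrt (u / real (Suc n))" 
          by (simp add: distrib_left del: of_nat_Suc)
        then show ?thesis
          using increment_exp_moment_taylor[OF s(1) _ T K C_def, of "u / real (Suc n)" "Suc n"] u m
          by (simp add: u_def del: of_nat_Suc)
      qed
      moreover have "(\<lambda>n. exp ((\<integral>\<omega>. f (?X \<omega>) \<partial>M) + (u * L\<^sup>2 / 2 + C * u * sqrt (u / real (Suc n)))))
          \<longlonglongrightarrow> exp ((\<integral>\<omega>. f (?X \<omega>) \<partial>M) + (u * L\<^sup>2 / 2 + C * u * sqrt 0))"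
        by (intro tendsto_intros LIMSEQ_Suc[OF lim_const_over_n])
      ultimately have "(\<integral>\<omega>. exp (f (?X \<omega>)) \<partial>M) \<le> exp ((\<integral>\<omega>. f (?X \<omega>) \<partial>M) + (u * L\<^sup>2 / 2 + C * u * sqrt 0))"
        by (intro LIMSEQ_le_const) auto
      then show ?thesis by (simp add: u_def)
    qed
    then show "ln (\<integral>x. exp (f x - (\<integral>y. f y \<partial>distr M borel ?X)) \<partial>distr M borel ?X) \<le> (t - s) / 2 * (lip f)\<^sup>2"
      by (subst prob_space.ln_exp_moment_iff[OF prob_space_distr[OF X] _ fB])
         (simp_all add: integral_distr L_def)
  qed
  then show ?thesis
    using GCBS_iff_lipschitz_concentration[of "distr M borel ?X"] prob_space_distr[OF X] by simp
qed

end

context dissipative_drift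
begin

lemma resolvent_measurable: "resolvent h \<in> borel_measurable borel"
  by (intro borel_measurable_continuous_onI continuous_resolvent)

lemma implicit_euler_measurable:
  assumes "0 \<le> t" "\<And>s. 0 \<le> s \<Longrightarrow> (\<lambda>p. v p s) \<in> borel_measurable N" "x \<in> borel_measurable N"
  shows "(\<lambda>p. implicit_euler (v p) t n (x p)) \<in> borel_measurable N"
  unfolding implicit_euler_def using assms
  by (intro chain_measurable resolvent_measurable borel_measurable_diff) auto

lemma flow_measurable:
  assumes "0 \<le> t" "\<And>s. 0 \<le> s \<Longrightarrow> (\<lambda>p. v p s) \<in> borel_measurable N" "x \<in> borel_measurable N"
  shows "(\<lambda>p. flow (v p) t (x p)) \<in> borel_measurable N"
  unfolding flow_def using assms by (intro borel_measurable_lim_metric implicit_euler_measurable)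

lemma flow_cong:
  assumes "0 \<le> t" "\<And>s. 0 \<le> s \<Longrightarrow> v s = v' s"
  shows "flow v t x = flow v' t x"
  unfolding flow_def implicit_euler_def using assms by simp

text \<open>The constants collected by the scheme form a geometric sum, a Riemann sum for
  \<open>\<integral>\<^sub>0\<^sup>t e\<^sup>-\<^sup>2\<^sup>\<kappa>\<^sup>s ds\<close>.\<close>

lemma discount_sum_tendsto:
  "(\<lambda>n. t / real n * (\<Sum>j=1..n. (1 / (1 + t / real n * \<kappa>)) ^ (2 * j))) \<longlonglongrightarrow> exp_factor \<kappa> t"
proof (cases "\<kappa> = 0")
  case True
  have "\<forall>\<^sub>F n in sequentially. t = t / real n * (\<Sum>j=1..n. (1 / (1 + t / real n * \<kappa>)) ^ (2 * j))"
    using eventually_gt_at_top[of 0] by eventually_elim (simp add: True)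
  then show ?thesis using True by (auto simp: exp_factor_def intro: Lim_transform_eventually[OF tendsto_const])
next
  case False
  show ?thesis
  proof (cases "t = 0")
    case True
    then show ?thesis by (simp add: exp_factor_def)
  next
    case t: False
    define q where "q n = 1 / (1 + t / real n * \<kappa>)" for n
    have lim: "(\<lambda>n. (1 - (q n ^ n)\<^sup>2) / (2 * \<kappa> + t / real n * \<kappa>\<^sup>2)) \<longlonglongrightarrow> (1 - (exp (- \<kappa> * t))\<^sup>2) / (2 * \<kappa> + 0 * \<kappa>\<^sup>2)"
      unfolding q_def using False by (intro tendsto_intros contraction_factor_tendsto lim_const_over_n) auto
    have "(\<lambda>n. 2 + t / real n * \<kappa>) \<longlonglongrightarrow> 2 + 0 * \<kappa>"
      by (intro tendsto_intros lim_const_over_n)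
    then have "\<forall>\<^sub>F n in sequentially. 0 < 2 + t / real n * \<kappa>"
      by (rule order_tendstoD) simp
    then have "\<forall>\<^sub>F n in sequentially. (1 - (q n ^ n)\<^sup>2) / (2 * \<kappa> + t / real n * \<kappa>\<^sup>2)
        = t / real n * (\<Sum>j=1..n. q n ^ (2 * j))"
      using eventually_small_step[of t] eventually_gt_at_top[of 0]
    proof eventually_elim
      case (elim n)
      define h where "h = t / real n"
      define r where "r = (q n)\<^sup>2"
      have h: "h \<noteq> 0" using t elim by (simp add: h_def)
      have p: "0 < 1 + h * \<kappa>" "0 < 2 + h * \<kappa>" using elim by (simp_all add: h_def)
      have r_eq: "r = 1 / (1 + h * \<kappa>)\<^sup>2" by (simp add: r_def q_def h_def power_divide)
      have "(1 + h * \<kappa>)\<^sup>2 - 1 = h * \<kappa> * (2 + h * \<kappa>)" by (simp add: power2_eq_square algebra_simps)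
      moreover have "1 - r = r * ((1 + h * \<kappa>)\<^sup>2 - 1)" using p(1) by (simp add: r_eq right_diff_distrib)
      ultimately have r1: "1 - r = r * (h * \<kappa> * (2 + h * \<kappa>))" by (simp only:)
      have ne: "h * \<kappa> * (2 + h * \<kappa>) \<noteq> 0" "r \<noteq> 0" using h False p by (auto simp: r_eq)
      have r_ne: "r \<noteq> 1" using r1 ne by auto
      have "(\<Sum>j=1..n. r ^ j) = r * (\<Sum>j<n. r ^ j)"
        by (simp add: sum_distrib_left sum.atLeast1_atMost_eq)
      also have "\<dots> = r * ((1 - r ^ n) / (1 - r))" using r_ne by (simp add: sum_gp_strict)
      also have "\<dots> = (1 - r ^ n) / (h * \<kappa> * (2 + h * \<kappa>))" unfolding r1 using ne by simp
      finally have "h * (\<Sum>j=1..n. r ^ j) = h * ((1 - r ^ n) / (h * \<kappa> * (2 + h * \<kappa>)))" by simp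
      also have "\<dots> = (1 - r ^ n) / (\<kappa> * (2 + h * \<kappa>))" using h by simp
      also have "\<kappa> * (2 + h * \<kappa>) = 2 * \<kappa> + h * \<kappa>\<^sup>2" by (simp add: power2_eq_square algebra_simps)
      also have "r ^ n = (q n ^ n)\<^sup>2" unfolding r_def by (simp flip: power_mult add: mult.commute)
      finally show ?case unfolding r_def h_def by (simp add: power_mult)
    qed
    then have "(\<lambda>n. t / real n * (\<Sum>j=1..n. q n ^ (2 * j))) \<longlonglongrightarrow> (1 - (exp (- \<kappa> * t))\<^sup>2) / (2 * \<kappa> + 0 * \<kappa>\<^sup>2)"
      by (rule Lim_transform_eventually[OF lim])
    moreover have "(exp (- \<kappa> * t))\<^sup>2 = exp (- 2 * \<kappa> * t)" by (simp flip: exp_double)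
    ultimately show ?thesis using False by (simp add: exp_factor_def q_def)
  qed
qed

end

text \<open>The diffusion matrix enters only through the bound \<open>|\<sigma> u|\<^sup>2 \<le> 2 A |u|\<^sup>2\<close>, where \<open>A\<close> is the operator
  norm of \<open>a\<close>.\<close>

section \<open>Concentration along the Euler scheme\<close>

locale additive_noise = brownian M W + dissipative_drift b \<kappa>
  for M :: "'w measure" and W :: "real \<Rightarrow> 'w \<Rightarrow> real ^ 'n" and b :: "real ^ 'n \<Rightarrow> real ^ 'n" and \<kappa> :: real +
  fixes \<sigma> :: "real ^ 'n ^ 'n" and A :: real
  assumes A: "0 \<le> A" and \<sigma>: "(norm (\<sigma> *v u))\<^sup>2 \<le> 2 * A * (norm u)\<^sup>2"
begin

definition scheme :: "real \<Rightarrow> nat \<Rightarrow> real ^ 'n \<Rightarrow> 'w \<Rightarrow> real ^ 'n" where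
  "scheme t n x \<omega> = implicit_euler (\<lambda>s. \<sigma> *v W s \<omega>) t n x"

text \<open>The solution started at \<open>x\<close>, for all starting points on the same probability space.\<close>

definition sol :: "real \<Rightarrow> real ^ 'n \<Rightarrow> 'w \<Rightarrow> real ^ 'n" where
  "sol t x \<omega> = flow (\<lambda>s. \<sigma> *v W s \<omega>) t x"

text \<open>The transition operator \<open>P\<^sub>t f (x) = E f (X\<^sub>t)\<close> for the solution started at \<open>x\<close>.\<close>

definition markov_op :: "real \<Rightarrow> (real ^ 'n \<Rightarrow> real) \<Rightarrow> real ^ 'n \<Rightarrow> real" where
  "markov_op t f x = (\<integral>\<omega>. f (sol t x \<omega>) \<partial>M)"

lemma noise_measurable [measurable]: "0 \<le> s \<Longrightarrow> (\<lambda>\<omega>. \<sigma> *v W s \<omega>) \<in> borel_measurable M"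
  by (intro borel_measurable_continuous_on[OF linear_continuous_on W_measurable]) auto

lemma noise_continuous: "AE \<omega> in M. \<forall>T. continuous_on {0..T} (\<lambda>s. \<sigma> *v W s \<omega>)"
  using W_continuous
proof eventually_elim
  case (elim \<omega>)
  show ?case
  proof
    fix T
    have "continuous_on {0..T} (\<lambda>s. W s \<omega>)" using elim by (rule continuous_on_subset) auto
    then show "continuous_on {0..T} (\<lambda>s. \<sigma> *v W s \<omega>)"
      by (intro bounded_linear.continuous_on[OF matrix_vector_mul_bounded_linear])
  qed
qed

lemma sol_measurable_pair:
  assumes "0 \<le> t" "x \<in> borel_measurable N" "y \<in> N \<rightarrow>\<^sub>M M"
  shows "(\<lambda>p. sol t (x p) (y p)) \<in> borel_measurable N"
  unfolding sol_def using assms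
  by (intro flow_measurable measurable_compose[OF assms(3)] noise_measurable) auto

lemma scheme_measurable_pair:
  assumes "0 \<le> t" "x \<in> borel_measurable N" "y \<in> N \<rightarrow>\<^sub>M M"
  shows "(\<lambda>p. scheme t n (x p) (y p)) \<in> borel_measurable N"
  unfolding scheme_def using assms
  by (intro implicit_euler_measurable measurable_compose[OF assms(3)] noise_measurable) auto

lemma sol_measurable: "0 \<le> t \<Longrightarrow> sol t x \<in> borel_measurable M"
  using sol_measurable_pair[of t "\<lambda>_. x" M "\<lambda>\<omega>. \<omega>"] by simp

lemma scheme_measurable: "0 \<le> t \<Longrightarrow> scheme t n x \<in> borel_measurable M"
  using scheme_measurable_pair[of t "\<lambda>_. x" M "\<lambda>\<omega>. \<omega>"] by simp

lemma AE_scheme_tendsto: "AE \<omega> in M. \<forall>t\<ge>0. \<forall>x. (\<lambda>n. scheme t n x \<omega>) \<longlonglongrightarrow> sol t x \<omega>"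
  using noise_continuous unfolding scheme_def sol_def
  by eventually_elim (auto intro: implicit_euler_tendsto_flow)

lemma AE_sol_lipschitz:
  "AE \<omega> in M. \<forall>t\<ge>0. \<forall>x y. norm (sol t x \<omega> - sol t y \<omega>) \<le> exp (- \<kappa> * t) * norm (x - y)"
  using noise_continuous unfolding sol_def
  by eventually_elim (intro allI impI flow_lipschitz; blast)

lemma sol_zero: "sol 0 x \<omega> = x" by (simp add: sol_def)

text \<open>Composition with \<open>\<sigma>\<close> multiplies Lipschitz constants by \<open>sqrt (2 A)\<close>, so the constant \<open>(t - s) / 2\<close> of
  the increment of \<open>W\<close> becomes \<open>A (t - s)\<close>.\<close>

lemma noise_concentration:
  assumes "0 \<le> s" "s \<le> t"
  shows "lipschitz_concentration (A * (t - s)) (distr M borel (\<lambda>\<omega>. \<sigma> *v W t \<omega> - \<sigma> *v W s \<omega>))"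
  unfolding lipschitz_concentration_def
proof (intro allI impI, elim conjE)
  fix f :: "real ^ 'n \<Rightarrow> real" and L B
  assume L: "L-lipschitz_on UNIV f" and B: "\<forall>x. \<bar>f x\<bar> \<le> B"
  have L0: "0 \<le> L" using L lipschitz_on_nonneg by blast
  have [measurable]: "f \<in> borel_measurable borel" using L by (rule lipschitz_measurable)
  have m: "(\<lambda>\<omega>. W t \<omega> - W s \<omega>) \<in> borel_measurable M" "(\<lambda>\<omega>. \<sigma> *v W t \<omega> - \<sigma> *v W s \<omega>) \<in> borel_measurable M"
    using assms by (intro borel_measurable_diff W_measurable noise_measurable; simp)+
  have lip: "(L * sqrt (2 * A))-lipschitz_on UNIV (\<lambda>z. f (\<sigma> *v z))"
  proof (rule lipschitz_onI)
    fix x y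
    have "norm (\<sigma> *v (x - y)) \<le> sqrt (2 * A * (norm (x - y))\<^sup>2)" using \<sigma> by (rule real_le_rsqrt)
    then have "norm (\<sigma> *v x - \<sigma> *v y) \<le> sqrt (2 * A) * norm (x - y)"
      by (simp add: real_sqrt_mult matrix_vector_mult_diff_distrib)
    then have "L * norm (\<sigma> *v x - \<sigma> *v y) \<le> L * (sqrt (2 * A) * norm (x - y))" using L0 by (rule mult_left_mono)
    then show "dist (f (\<sigma> *v x)) (f (\<sigma> *v y)) \<le> L * sqrt (2 * A) * dist x y"
      using lipschitz_on_normD[OF L, of "\<sigma> *v x" "\<sigma> *v y"] by (simp add: dist_norm mult.assoc)
  qed (use L0 A in simp)
  have *: "(\<integral>\<omega>. exp (f (\<sigma> *v (W t \<omega> - W s \<omega>))) \<partial>M)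
      \<le> exp ((\<integral>\<omega>. f (\<sigma> *v (W t \<omega> - W s \<omega>)) \<partial>M) + (t - s) / 2 * (L * sqrt (2 * A))\<^sup>2)"
  proof -
    have [measurable]: "(\<lambda>z. f (\<sigma> *v z)) \<in> borel_measurable borel" using lip by (rule lipschitz_measurable)
    have "(\<integral>z. exp (f (\<sigma> *v z)) \<partial>distr M borel (\<lambda>\<omega>. W t \<omega> - W s \<omega>))
        \<le> exp ((\<integral>z. f (\<sigma> *v z) \<partial>distr M borel (\<lambda>\<omega>. W t \<omega> - W s \<omega>)) + (t - s) / 2 * (L * sqrt (2 * A))\<^sup>2)"
      using B by (intro lipschitz_concentrationD[OF increment_concentration[OF assms] lip]) blast
    then show ?thesis by (simp add: integral_distr[OF m(1)])
  qed
  have eq: "(t - s) / 2 * (L * sqrt (2 * A))\<^sup>2 = A * (t - s) * L\<^sup>2" using A by (simp add: power_mult_distrib)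
  show "(\<integral>x. exp (f x) \<partial>distr M borel (\<lambda>\<omega>. \<sigma> *v W t \<omega> - \<sigma> *v W s \<omega>))
      \<le> exp ((\<integral>x. f x \<partial>distr M borel (\<lambda>\<omega>. \<sigma> *v W t \<omega> - \<sigma> *v W s \<omega>)) + A * (t - s) * L\<^sup>2)"
    using *[unfolded eq] m(2) by (simp add: integral_distr matrix_vector_mult_diff_distrib)
qed

lemma noise_increments_indep:
  assumes "0 \<le> \<tau> 0" "mono \<tau>"
  shows "indep_vars (\<lambda>_. borel) (\<lambda>k \<omega>. \<sigma> *v W (\<tau> (Suc k)) \<omega> - \<sigma> *v W (\<tau> k) \<omega>) {..<n}"
proof -
  have "indep_vars (\<lambda>_. borel) (\<lambda>k \<omega>. \<sigma> *v (W (\<tau> (Suc k)) \<omega> - W (\<tau> k) \<omega>)) {..<n}"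
    by (rule indep_vars_compose2[OF increments_indep[OF assms]])
       (auto intro!: borel_measurable_continuous_onI linear_continuous_on)
  then show ?thesis by (simp add: matrix_vector_mult_diff_distrib)
qed

lemma average_lipschitz:
  fixes Y :: "real ^ 'n \<Rightarrow> 'w \<Rightarrow> real ^ 'n" and f :: "real ^ 'n \<Rightarrow> real"
  assumes L: "L-lipschitz_on UNIV f" and B: "\<And>x. \<bar>f x\<bar> \<le> B" and q: "0 \<le> q"
    and Y: "\<And>x. Y x \<in> borel_measurable M" and lip: "\<And>x y. AE \<omega> in M. norm (Y x \<omega> - Y y \<omega>) \<le> q * norm (x - y)"
  shows "(L * q)-lipschitz_on UNIV (\<lambda>x. \<integral>\<omega>. f (Y x \<omega>) \<partial>M)" "\<bar>\<integral>\<omega>. f (Y x \<omega>) \<partial>M\<bar> \<le> B"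
proof -
  have L0: "0 \<le> L" using L lipschitz_on_nonneg by blast
  have [measurable]: "f \<in> borel_measurable borel" using L by (rule lipschitz_measurable)
  note Y[measurable]
  have "(\<lambda>\<omega>. f (Y x \<omega>)) \<in> borel_measurable M" for x by measurable
  then have int: "integrable M (\<lambda>\<omega>. f (Y x \<omega>))" for x using B by (intro integrable_bounded[where B = B])
  have bound: "\<bar>\<integral>\<omega>. g \<omega> \<partial>M\<bar> \<le> C" if "integrable M g" "AE \<omega> in M. \<bar>g \<omega>\<bar> \<le> C" for g :: "'w \<Rightarrow> real" and C
  proof -
    have "\<bar>\<integral>z. g z \<partial>M\<bar> \<le> (\<integral>z. \<bar>g z\<bar> \<partial>M)" by (rule integral_abs_bound)
    also have "\<dots> \<le> (\<integral>z. C \<partial>M)" using that by (intro integral_mono_AE) auto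
    finally show ?thesis by (simp add: prob_space)
  qed
  show "\<bar>\<integral>\<omega>. f (Y x \<omega>) \<partial>M\<bar> \<le> B" using int B by (intro bound) auto
  show "(L * q)-lipschitz_on UNIV (\<lambda>x. \<integral>\<omega>. f (Y x \<omega>) \<partial>M)"
  proof (rule lipschitz_onI)
    fix x y
    have "\<bar>\<integral>\<omega>. f (Y x \<omega>) - f (Y y \<omega>) \<partial>M\<bar> \<le> L * q * dist x y"
    proof (rule bound)
      show "AE \<omega> in M. \<bar>f (Y x \<omega>) - f (Y y \<omega>)\<bar> \<le> L * q * dist x y"
        using lip[of x y]
      proof eventually_elim
        case (elim \<omega>)
        show ?case
          using lipschitz_on_normD[OF L, of "Y x \<omega>" "Y y \<omega>"] mult_left_mono[OF elim L0]
          by (simp add: dist_norm mult.assoc)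
      qed
    qed (use int in auto)
    then show "dist (\<integral>\<omega>. f (Y x \<omega>) \<partial>M) (\<integral>\<omega>. f (Y y \<omega>) \<partial>M) \<le> L * q * dist x y"
      using int by (simp add: dist_real_def)
  qed (use L0 q in simp)
qed

text \<open>One step of the scheme replaces \<open>f\<close> by the average of \<open>f \<circ> J\<^sub>h\<close> over the noise, which has Lipschitz constant
  \<open>L / (1 + h \<kappa>)\<close>, at the price of the factor \<open>exp (A h (L / (1 + h \<kappa>))\<^sup>2)\<close>. Induction over the steps, for all \<open>f\<close>
  at once, sums these contributions.\<close>

lemma euler_exp_moment:
  assumes h: "0 \<le> h" "0 < 1 + h * \<kappa>"
    and L: "L-lipschitz_on UNIV f" and B: "\<And>x. \<bar>f x\<bar> \<le> B"
  defines "\<xi> \<equiv> \<lambda>k \<omega>. \<sigma> *v W (real (Suc k) * h) \<omega> - \<sigma> *v W (real k * h) \<omega>"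
  shows "(\<integral>\<omega>. exp (f (chain (\<lambda>_. resolvent h) (\<lambda>k. \<xi> k \<omega>) x m)) \<partial>M)
    \<le> exp ((\<integral>\<omega>. f (chain (\<lambda>_. resolvent h) (\<lambda>k. \<xi> k \<omega>) x m) \<partial>M)
        + A * h * L\<^sup>2 * (\<Sum>j=1..m. (1 / (1 + h * \<kappa>)) ^ (2 * j)))"
  using L B
proof (induction m arbitrary: f L)
  case 0
  then show ?case by (simp add: prob_space)
next
  case (Suc m)
  define q where "q = 1 / (1 + h * \<kappa>)"
  have q: "0 \<le> q" using h by (simp add: q_def)
  have \<xi>m [measurable]: "\<xi> k \<in> borel_measurable M" for k
    unfolding \<xi>_def using h by (intro borel_measurable_diff noise_measurable) auto
  have ind: "indep_vars (\<lambda>_. borel) \<xi> {..<n}" for n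
    unfolding \<xi>_def using h by (intro noise_increments_indep) (auto simp: mono_def mult_right_mono)
  note [measurable] = resolvent_measurable
  have fm [measurable]: "f \<in> borel_measurable borel" using Suc.prems(1) by (rule lipschitz_measurable)
  let ?S = "\<lambda>\<omega>. chain (\<lambda>_. resolvent h) (\<lambda>k. \<xi> k \<omega>) x"
  have Sm [measurable]: "(\<lambda>\<omega>. ?S \<omega> m) \<in> borel_measurable M" by (intro chain_measurable) auto
  define Tf where "Tf y = (\<integral>\<omega>. f (resolvent h (y + \<xi> m \<omega>)) \<partial>M)" for y
  have Tf: "(L * q)-lipschitz_on UNIV Tf" "\<bar>Tf y\<bar> \<le> B" for y
  proof -
    have "(\<lambda>\<omega>. resolvent h (y + \<xi> m \<omega>)) \<in> borel_measurable M" for y by measurable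
    moreover have "AE \<omega> in M. norm (resolvent h (y + \<xi> m \<omega>) - resolvent h (y' + \<xi> m \<omega>)) \<le> q * norm (y - y')" for y y'
      using resolvent_lipschitz[OF h, of "y + \<xi> m \<omega>" "y' + \<xi> m \<omega>" for \<omega>] by (simp add: q_def)
    ultimately show "(L * q)-lipschitz_on UNIV Tf" "\<bar>Tf y\<bar> \<le> B"
      unfolding Tf_def[abs_def]
      using average_lipschitz[where Y = "\<lambda>y \<omega>. resolvent h (y + \<xi> m \<omega>)", OF Suc.prems q] by blast+
  qed
  have Tfm [measurable]: "Tf \<in> borel_measurable borel" using Tf(1) by (rule lipschitz_measurable)
  have conc: "lipschitz_concentration (A * h) (distr M borel (\<xi> m))"
    using noise_concentration[of "real m * h" "real (Suc m) * h"] h by (simp add: \<xi>_def algebra_simps)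
  have one: "(\<integral>\<omega>. exp (f (resolvent h (y + \<xi> m \<omega>))) \<partial>M) \<le> exp (Tf y) * exp (A * h * (L * q)\<^sup>2)" for y
  proof -
    have lip: "(L * q)-lipschitz_on UNIV (\<lambda>z. f (resolvent h (y + z)))"
    proof (rule lipschitz_onI)
      fix z z'
      have "L * norm (resolvent h (y + z) - resolvent h (y + z')) \<le> L * (norm (z - z') * q)"
        using resolvent_lipschitz[OF h, of "y + z" "y + z'"] lipschitz_on_nonneg[OF Suc.prems(1)]
        by (intro mult_left_mono) (simp_all add: q_def)
      then show "dist (f (resolvent h (y + z))) (f (resolvent h (y + z'))) \<le> L * q * dist z z'"
        using lipschitz_on_normD[OF Suc.prems(1), of "resolvent h (y + z)" "resolvent h (y + z')"]
        by (simp add: dist_norm mult_ac)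
    qed (use q lipschitz_on_nonneg[OF Suc.prems(1)] in simp)
    have "(\<integral>z. exp (f (resolvent h (y + z))) \<partial>distr M borel (\<xi> m))
        \<le> exp ((\<integral>z. f (resolvent h (y + z)) \<partial>distr M borel (\<xi> m)) + A * h * (L * q)\<^sup>2)"
      by (rule lipschitz_concentrationD[OF conc lip Suc.prems(2)])
    then show ?thesis by (simp add: integral_distr Tf_def exp_add)
  qed
  have fB: "\<bar>exp (f x)\<bar> \<le> exp B" for x using Suc.prems(2)[of x] by (simp add: abs_le_iff)
  have "(\<integral>\<omega>. exp (f (?S \<omega> (Suc m))) \<partial>M) = (\<integral>\<omega>. (\<integral>\<omega>'. exp (f (resolvent h (?S \<omega> m + \<xi> m \<omega>'))) \<partial>M) \<partial>M)"
    by (rule chain_step[OF ind resolvent_measurable _ fB]) measurable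
  also have "\<dots> \<le> (\<integral>\<omega>. exp (Tf (?S \<omega> m)) * exp (A * h * (L * q)\<^sup>2) \<partial>M)"
  proof (rule integral_mono[OF _ _ one])
    have "\<bar>\<integral>\<omega>'. exp (f (resolvent h (y + \<xi> m \<omega>'))) \<partial>M\<bar> \<le> exp B * exp (A * h * (L * q)\<^sup>2)" for y
    proof -
      have "0 \<le> (\<integral>\<omega>'. exp (f (resolvent h (y + \<xi> m \<omega>'))) \<partial>M)" by simp
      moreover have "exp (Tf y) * exp (A * h * (L * q)\<^sup>2) \<le> exp B * exp (A * h * (L * q)\<^sup>2)"
        using Tf(2)[of y] by (simp add: abs_le_iff)
      ultimately show ?thesis using one[of y] by linarith
    qed
    then show "integrable M (\<lambda>\<omega>. \<integral>\<omega>'. exp (f (resolvent h (?S \<omega> m + \<xi> m \<omega>'))) \<partial>M)"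
      by (intro integrable_bounded) measurable
    show "integrable M (\<lambda>\<omega>. exp (Tf (?S \<omega> m)) * exp (A * h * (L * q)\<^sup>2))"
      using Tf(2) by (intro integrable_mult_left integrable_bounded[where B = "exp B"]) (auto simp: abs_le_iff)
  qed
  also have "\<dots> = (\<integral>\<omega>. exp (Tf (?S \<omega> m)) \<partial>M) * exp (A * h * (L * q)\<^sup>2)" by simp
  also have "\<dots> \<le> exp ((\<integral>\<omega>. Tf (?S \<omega> m) \<partial>M) + A * h * (L * q)\<^sup>2 * (\<Sum>j=1..m. q ^ (2 * j))) * exp (A * h * (L * q)\<^sup>2)"
    using Suc.IH[OF Tf] by (intro mult_right_mono) (simp_all add: q_def)
  also have "(\<integral>\<omega>. Tf (?S \<omega> m) \<partial>M) = (\<integral>\<omega>. f (?S \<omega> (Suc m)) \<partial>M)"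
    unfolding Tf_def by (rule chain_step[OF ind resolvent_measurable fm Suc.prems(2), symmetric])
  also have "exp ((\<integral>\<omega>. f (?S \<omega> (Suc m)) \<partial>M) + A * h * (L * q)\<^sup>2 * (\<Sum>j=1..m. q ^ (2 * j))) * exp (A * h * (L * q)\<^sup>2)
      = exp ((\<integral>\<omega>. f (?S \<omega> (Suc m)) \<partial>M) + A * h * L\<^sup>2 * (q\<^sup>2 * (\<Sum>j=1..m. q ^ (2 * j)) + q\<^sup>2))"
    by (simp only: exp_add[symmetric]) (simp add: power_mult_distrib algebra_simps)
  also have "q\<^sup>2 * (\<Sum>j=1..m. q ^ (2 * j)) + q\<^sup>2 = (\<Sum>j=1..Suc m. q ^ (2 * j))"
    by (induction m) (simp_all add: algebra_simps power2_eq_square)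
  finally show ?case by (simp add: q_def)
qed

lemma sol_exp_moment:
  assumes t: "0 \<le> t" and L: "L-lipschitz_on UNIV f" and B: "\<And>x. \<bar>f x\<bar> \<le> B"
  shows "markov_op t (\<lambda>x. exp (f x)) x \<le> exp (markov_op t f x + A * exp_factor \<kappa> t * L\<^sup>2)"
  unfolding markov_op_def
proof (rule exp_moment_bound_limit[where f = "\<lambda>n \<omega>. f (scheme t n x \<omega>)" and B = B
      and c = "\<lambda>n. A * (t / real n * (\<Sum>j=1..n. (1 / (1 + t / real n * \<kappa>)) ^ (2 * j))) * L\<^sup>2"])
  have fm: "f \<in> borel_measurable borel" using L by (rule lipschitz_measurable)
  show "(\<lambda>\<omega>. f (scheme t n x \<omega>)) \<in> borel_measurable M" for n
    using scheme_measurable[OF t] fm by (rule measurable_compose)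
  show "(\<lambda>\<omega>. f (sol t x \<omega>)) \<in> borel_measurable M"
    using sol_measurable[OF t] fm by (rule measurable_compose)
  show "AE \<omega> in M. (\<lambda>n. f (scheme t n x \<omega>)) \<longlonglongrightarrow> f (sol t x \<omega>)"
    using AE_scheme_tendsto
  proof eventually_elim
    case (elim \<omega>)
    then show ?case
      using t by (intro continuous_on_tendsto_compose[OF lipschitz_on_continuous_on[OF L]]) auto
  qed
  show "(\<lambda>n. A * (t / real n * (\<Sum>j=1..n. (1 / (1 + t / real n * \<kappa>)) ^ (2 * j))) * L\<^sup>2)
      \<longlonglongrightarrow> A * exp_factor \<kappa> t * L\<^sup>2"
    by (intro tendsto_intros discount_sum_tendsto)
  show "\<forall>\<^sub>F n in sequentially. (\<integral>\<omega>. exp (f (scheme t n x \<omega>)) \<partial>M) \<le> exp ((\<integral>\<omega>. f (scheme t n x \<omega>) \<partial>M)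
      + A * (t / real n * (\<Sum>j=1..n. (1 / (1 + t / real n * \<kappa>)) ^ (2 * j))) * L\<^sup>2)"
    using eventually_small_step[of t]
  proof eventually_elim
    case (elim n)
    show ?case
      using euler_exp_moment[OF _ elim L B, of x n] t
      by (simp add: scheme_def implicit_euler_def mult_ac)
  qed
qed (use B in auto)

lemma markov_op_lipschitz:
  assumes t: "0 \<le> t" and L: "L-lipschitz_on UNIV f" and B: "\<And>x. \<bar>f x\<bar> \<le> B"
  shows "(L * exp (- \<kappa> * t))-lipschitz_on UNIV (markov_op t f)" "\<bar>markov_op t f x\<bar> \<le> B"
proof -
  have "AE \<omega> in M. norm (sol t x \<omega> - sol t y \<omega>) \<le> exp (- \<kappa> * t) * norm (x - y)" for x y
    using AE_sol_lipschitz by eventually_elim (use t in auto)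
  then show "(L * exp (- \<kappa> * t))-lipschitz_on UNIV (markov_op t f)" "\<bar>markov_op t f x\<bar> \<le> B"
    using average_lipschitz[where Y = "sol t", OF L B exp_ge_zero sol_measurable[OF t]]
    unfolding markov_op_def[abs_def] by blast+
qed

end

section \<open>The Markov semigroup of the diffusion\<close>

text \<open>The Markov property of the scheme: the second block of steps may be run with a fresh sequence of increments
  with the same laws.\<close>

lemma (in prob_space) chain_concat:
  fixes \<xi> \<xi>' :: "nat \<Rightarrow> 'a \<Rightarrow> 'b::{second_countable_topology, real_normed_vector}"
  assumes ind: "\<And>k. indep_vars (\<lambda>_. borel) \<xi> {..<k}" and ind': "\<And>k. indep_vars (\<lambda>_. borel) \<xi>' {..<k}"
    and law: "\<And>k. k < m \<Longrightarrow> distr M borel (\<xi> (n + k)) = distr M borel (\<xi>' k)"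
    and J: "\<And>k. J k \<in> borel_measurable borel"
    and f: "f \<in> borel_measurable borel" and B: "\<And>x. \<bar>f x :: real\<bar> \<le> B"
  shows "(\<integral>\<omega>. f (chain J (\<lambda>k. \<xi> k \<omega>) x (n + m)) \<partial>M)
    = (\<integral>\<omega>. (\<integral>\<omega>'. f (chain (\<lambda>k. J (n + k)) (\<lambda>k. \<xi>' k \<omega>') (chain J (\<lambda>k. \<xi> k \<omega>) x n) m) \<partial>M) \<partial>M)"
  using law f B
proof (induction m arbitrary: f)
  case 0
  then show ?case by (simp add: prob_space)
next
  case (Suc m)
  have m1 [measurable]: "\<xi> k \<in> borel_measurable M" "\<xi>' k \<in> borel_measurable M" for k
    using ind[of "Suc k"] ind'[of "Suc k"] unfolding indep_vars_def by auto
  note J[measurable] Suc.prems(2)[measurable]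
  define T where "T y = (\<integral>\<omega>. f (J (n + m) (y + \<xi> (n + m) \<omega>)) \<partial>M)" for y
  have "(\<lambda>p. f (J (n + m) (fst p + \<xi> (n + m) (snd p)))) \<in> borel_measurable (borel \<Otimes>\<^sub>M M)" by measurable
  then have Tm: "T \<in> borel_measurable borel"
    unfolding T_def[abs_def]
    using borel_measurable_lebesgue_integral[of "\<lambda>s \<omega>'. f (J (n + m) (s + \<xi> (n + m) \<omega>'))" borel] by (simp add: split_beta')
  have T': "T y = (\<integral>\<omega>. f (J (n + m) (y + \<xi>' m \<omega>)) \<partial>M)" for y
  proof -
    have "T y = (\<integral>z. f (J (n + m) (y + z)) \<partial>distr M borel (\<xi> (n + m)))"
      unfolding T_def by (simp add: integral_distr)
    also have "\<dots> = (\<integral>\<omega>. f (J (n + m) (y + \<xi>' m \<omega>)) \<partial>M)"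
      unfolding Suc.prems(1)[OF lessI] by (simp add: integral_distr)
    finally show ?thesis .
  qed
  have TB: "\<bar>T y\<bar> \<le> B" for y
    unfolding T_def by (rule abs_expectation_le[OF _ Suc.prems(3)]) measurable
  have last: "(\<integral>\<omega>'. T (chain (\<lambda>k. J (n + k)) (\<lambda>k. \<xi>' k \<omega>') y m) \<partial>M)
      = (\<integral>\<omega>'. f (chain (\<lambda>k. J (n + k)) (\<lambda>k. \<xi>' k \<omega>') y (Suc m)) \<partial>M)" for y
    unfolding T' by (rule chain_step[OF ind' J Suc.prems(2,3), symmetric])
  have "(\<integral>\<omega>. f (chain J (\<lambda>k. \<xi> k \<omega>) x (n + Suc m)) \<partial>M) = (\<integral>\<omega>. T (chain J (\<lambda>k. \<xi> k \<omega>) x (n + m)) \<partial>M)"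
    unfolding T_def add_Suc_right by (rule chain_step[OF ind J Suc.prems(2,3)])
  also have "\<dots> = (\<integral>\<omega>. (\<integral>\<omega>'. T (chain (\<lambda>k. J (n + k)) (\<lambda>k. \<xi>' k \<omega>') (chain J (\<lambda>k. \<xi> k \<omega>) x n) m) \<partial>M) \<partial>M)"
    by (rule Suc.IH[OF _ Tm TB]) (use Suc.prems(1) in simp)
  also have "\<dots> = (\<integral>\<omega>. (\<integral>\<omega>'. f (chain (\<lambda>k. J (n + k)) (\<lambda>k. \<xi>' k \<omega>') (chain J (\<lambda>k. \<xi> k \<omega>) x n) (Suc m)) \<partial>M) \<partial>M)"
    by (simp only: last)
  finally show ?case .
qed

context additive_noise
begin

lemma noise_increment_law:
  assumes "0 \<le> s" "s \<le> t" "0 \<le> s'" "s' \<le> t'" "t - s = t' - s'"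
  shows "distr M borel (\<lambda>\<omega>. \<sigma> *v W t \<omega> - \<sigma> *v W s \<omega>) = distr M borel (\<lambda>\<omega>. \<sigma> *v W t' \<omega> - \<sigma> *v W s' \<omega>)"
proof -
  have "distr M borel (\<lambda>\<omega>. \<sigma> *v W t \<omega> - \<sigma> *v W s \<omega>) = distr (distr M borel (\<lambda>\<omega>. W t \<omega> - W s \<omega>)) borel ((*v) \<sigma>)"
    if "0 \<le> s" "s \<le> t" for s t
  proof -
    have "(\<lambda>\<omega>. W t \<omega> - W s \<omega>) \<in> borel_measurable M"
      using that by (intro borel_measurable_diff W_measurable) auto
    moreover have "(*v) \<sigma> \<in> borel_measurable borel"
      by (intro borel_measurable_continuous_onI linear_continuous_on) simp
    ultimately show ?thesis
      by (simp add: distr_distr o_def matrix_vector_mult_diff_distrib)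
  qed
  then show ?thesis using increment_law[OF assms] assms by simp
qed

text \<open>Running the scheme for \<open>n\<close> steps of length \<open>s / n\<close> and then \<open>n\<close> steps of length \<open>t / n\<close> uses increments of
  \<open>W\<close> over consecutive intervals. Those of the second block are independent of the first block and distributed as
  if they started at time \<open>0\<close>.\<close>

lemma scheme_two_blocks:
  assumes s: "0 \<le> s" and t: "0 \<le> t" and n: "0 < n"
    and f: "f \<in> borel_measurable borel" and B: "\<And>x. \<bar>f x :: real\<bar> \<le> B"
  shows "(\<integral>\<omega>. f (implicit_euler (\<lambda>r. \<sigma> *v W (s + r) \<omega>) t n (scheme s n x \<omega>)) \<partial>M)
    = (\<integral>\<omega>. (\<integral>\<omega>'. f (scheme t n (scheme s n x \<omega>) \<omega>') \<partial>M) \<partial>M)"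
proof -
  define h where "h = s / real n"
  define h' where "h' = t / real n"
  have h: "0 \<le> h" "0 \<le> h'" "real n * h = s" using s t n by (auto simp: h_def h'_def)
  \<comment> \<open>The partition of \<open>[0, s + t]\<close> with \<open>n\<close> equal steps on either side of \<open>s\<close>.\<close>
  define \<tau> where "\<tau> k = (if k \<le> n then real k * h else s + real (k - n) * h')" for k
  have \<tau>_add: "\<tau> (n + k) = s + real k * h'" for k using h by (auto simp: \<tau>_def)
  have "mono \<tau>"
  proof (rule incseq_SucI)
    fix k show "\<tau> k \<le> \<tau> (Suc k)"
    proof (cases "k < n")
      case True then show ?thesis using h by (simp add: \<tau>_def algebra_simps)
    next
      case False
      then obtain j where "k = n + j" using le_Suc_ex not_less by blast
      then show ?thesis using h \<tau>_add[of j] \<tau>_add[of "Suc j"] by (simp add: algebra_simps)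
    qed
  qed
  then have \<tau>: "0 \<le> \<tau> k" "\<tau> k \<le> \<tau> (Suc k)" "\<tau> 0 = 0" for k
    using monoD[of \<tau> 0 k] monoD[of \<tau> k "Suc k"] by (auto simp: \<tau>_def)
  define J where "J k = resolvent (if k < n then h else h')" for k
  define \<xi> where "\<xi> k \<omega> = \<sigma> *v W (\<tau> (Suc k)) \<omega> - \<sigma> *v W (\<tau> k) \<omega>" for k \<omega>
  define \<xi>' where "\<xi>' k \<omega> = \<sigma> *v W (real (Suc k) * h') \<omega> - \<sigma> *v W (real k * h') \<omega>" for k \<omega>
  have first: "chain J (\<lambda>k. \<xi> k \<omega>) x n = scheme s n x \<omega>" for \<omega>
    unfolding scheme_def implicit_euler_def h_def[symmetric]
    by (rule chain_cong) (auto simp: J_def \<xi>_def \<tau>_def)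
  have J': "(\<lambda>k. J (n + k)) = (\<lambda>_. resolvent h')" by (auto simp: J_def)
  have second: "chain J (\<lambda>k. \<xi> k \<omega>) x (n + n) = implicit_euler (\<lambda>r. \<sigma> *v W (s + r) \<omega>) t n (scheme s n x \<omega>)" for \<omega>
    unfolding chain_add first J' implicit_euler_def h'_def[symmetric]
    using \<tau>_add[of "Suc k" for k] by (intro chain_cong) (auto simp: \<xi>_def \<tau>_add)
  have "(\<integral>\<omega>. f (chain J (\<lambda>k. \<xi> k \<omega>) x (n + n)) \<partial>M)
    = (\<integral>\<omega>. (\<integral>\<omega>'. f (chain (\<lambda>k. J (n + k)) (\<lambda>k. \<xi>' k \<omega>') (chain J (\<lambda>k. \<xi> k \<omega>) x n) n) \<partial>M) \<partial>M)"
  proof (rule chain_concat[OF _ _ _ _ f B])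
    show "indep_vars (\<lambda>_. borel) \<xi> {..<k}" for k
      unfolding \<xi>_def using \<open>mono \<tau>\<close> \<tau> by (intro noise_increments_indep) auto
    show "indep_vars (\<lambda>_. borel) \<xi>' {..<k}" for k
      unfolding \<xi>'_def using h by (intro noise_increments_indep) (auto simp: mono_def mult_right_mono)
    show "J k \<in> borel_measurable borel" for k unfolding J_def by (rule resolvent_measurable)
    show "distr M borel (\<xi> (n + k)) = distr M borel (\<xi>' k)" for k
    proof -
      have "\<tau> (Suc (n + k)) - \<tau> (n + k) = real (Suc k) * h' - real k * h'"
        using \<tau>_add[of k] \<tau>_add[of "Suc k"] by simp
      then show ?thesis unfolding \<xi>_def \<xi>'_def
        using \<tau> h(2) by (intro noise_increment_law) (auto simp: mult_right_mono)
    qed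
  qed
  then show ?thesis
    unfolding first second J' by (simp add: scheme_def implicit_euler_def \<xi>'_def h'_def)
qed

text \<open>The Markov property at the level of the scheme passes to the limit. On the left the two blocks converge to the
  solution at time \<open>s + t\<close> by the cocycle property of the flow. On the right the inner averages converge
  pointwise and are uniformly Lipschitz, so they may be evaluated at the converging states of the first block.\<close>

lemma markov_op_add:
  assumes s: "0 \<le> s" and t: "0 \<le> t" and L: "L-lipschitz_on UNIV f" and B: "\<And>x. \<bar>f x\<bar> \<le> B"
  shows "markov_op (s + t) f x = markov_op s (markov_op t f) x"
proof -
  have L0: "0 \<le> L" using L lipschitz_on_nonneg by blast
  have cf: "continuous_on UNIV f" using L by (rule lipschitz_on_continuous_on)
  have fm [measurable]: "f \<in> borel_measurable borel" using L by (rule lipschitz_measurable)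
  define c where "c n = (1 / (1 + t / real n * \<kappa>)) ^ n" for n
  have clim: "c \<longlonglongrightarrow> exp (- \<kappa> * t)" unfolding c_def by (rule contraction_factor_tendsto)
  define g where "g n y = (\<integral>\<omega>. f (scheme t n y \<omega>) \<partial>M)" for n y
  define Y where "Y n \<omega> = implicit_euler (\<lambda>r. \<sigma> *v W (s + r) \<omega>) t n (scheme s n x \<omega>)" for n \<omega>
  have gB: "\<bar>g n y\<bar> \<le> B" for n y
  proof -
    have "(\<lambda>\<omega>. f (scheme t n y \<omega>)) \<in> borel_measurable M"
      using scheme_measurable[OF t] fm by (rule measurable_compose)
    then show ?thesis unfolding g_def using B by (rule abs_expectation_le)
  qed
  have gm: "g n \<in> borel_measurable borel" for n
  proof -
    have "(\<lambda>p. f (scheme t n (fst p) (snd p))) \<in> borel_measurable (borel \<Otimes>\<^sub>M M)"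
      by (rule measurable_compose[OF scheme_measurable_pair fm]) (use t in auto)
    then show ?thesis unfolding g_def[abs_def]
      using borel_measurable_lebesgue_integral[of "\<lambda>y \<omega>. f (scheme t n y \<omega>)" borel] by (simp add: split_beta')
  qed
  have glim: "(\<lambda>n. g n y) \<longlonglongrightarrow> markov_op t f y" for y
    unfolding g_def markov_op_def
  proof (rule integral_tendsto_bounded[where B = B])
    show "AE \<omega> in M. (\<lambda>n. f (scheme t n y \<omega>)) \<longlonglongrightarrow> f (sol t y \<omega>)"
      using AE_scheme_tendsto
      by eventually_elim (use t in \<open>auto intro!: continuous_on_tendsto_compose[OF cf]\<close>)
  qed (use B measurable_compose[OF scheme_measurable[OF t] fm] measurable_compose[OF sol_measurable[OF t] fm] in auto)
  have glip: "\<forall>\<^sub>F n in sequentially. \<forall>y z. \<bar>g n y - g n z\<bar> \<le> L * c n * norm (y - z)"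
    using eventually_small_step[of t]
  proof eventually_elim
    case (elim n)
    have cn: "0 \<le> c n" using elim by (simp add: c_def)
    have "(L * c n)-lipschitz_on UNIV (g n)"
      unfolding g_def[abs_def]
    proof (rule average_lipschitz(1)[OF L B cn])
      show "scheme t n y \<in> borel_measurable M" for y by (rule scheme_measurable[OF t])
      show "AE \<omega> in M. norm (scheme t n y \<omega> - scheme t n z \<omega>) \<le> c n * norm (y - z)" for y z
        unfolding scheme_def c_def using implicit_euler_lipschitz[OF t elim] by simp
    qed
    then show ?case using lipschitz_on_normD[of "L * c n" UNIV "g n"] by auto
  qed
  have eq: "\<forall>\<^sub>F n in sequentially. (\<integral>\<omega>. f (Y n \<omega>) \<partial>M) = (\<integral>\<omega>. g n (scheme s n x \<omega>) \<partial>M)"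
    using eventually_gt_at_top[of 0]
    by eventually_elim (simp add: Y_def g_def scheme_two_blocks[OF s t _ fm B])
  have Ym: "Y n \<in> borel_measurable M" for n
    unfolding Y_def using s t
    by (intro implicit_euler_measurable noise_measurable scheme_measurable) auto
  have left: "(\<lambda>n. \<integral>\<omega>. f (Y n \<omega>) \<partial>M) \<longlonglongrightarrow> (\<integral>\<omega>. f (sol (s + t) x \<omega>) \<partial>M)"
  proof (rule integral_tendsto_bounded[where B = B])
    show "AE \<omega> in M. (\<lambda>n. f (Y n \<omega>)) \<longlonglongrightarrow> f (sol (s + t) x \<omega>)"
      using AE_scheme_tendsto noise_continuous
    proof eventually_elim
      case (elim \<omega>)
      let ?v = "\<lambda>r. \<sigma> *v W r \<omega>" and ?v' = "\<lambda>r. \<sigma> *v W (s + r) \<omega>"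
      have v: "continuous_on {0..s + t} ?v" using elim by blast
      have v': "continuous_on {0..t} ?v'"
        by (rule continuous_on_compose2[OF v]) (use s in \<open>auto intro!: continuous_intros\<close>)
      have Slim: "(\<lambda>n. scheme s n x \<omega>) \<longlonglongrightarrow> sol s x \<omega>" using elim s by blast
      have 1: "(\<lambda>n. implicit_euler ?v' t n (sol s x \<omega>)) \<longlonglongrightarrow> sol (s + t) x \<omega>"
        using implicit_euler_tendsto_flow[OF t v', of "sol s x \<omega>"] flow_cocycle[OF s t v, of x]
        by (simp add: sol_def)
      have 2: "(\<lambda>n. Y n \<omega> - implicit_euler ?v' t n (sol s x \<omega>)) \<longlonglongrightarrow> 0"
      proof (rule Lim_null_comparison)
        show "\<forall>\<^sub>F n in sequentially. norm (Y n \<omega> - implicit_euler ?v' t n (sol s x \<omega>)) \<le> c n * norm (scheme s n x \<omega> - sol s x \<omega>)"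
          using eventually_small_step[of t] unfolding Y_def c_def
          by eventually_elim (rule implicit_euler_lipschitz[OF t])
        have "(\<lambda>n. c n * norm (scheme s n x \<omega> - sol s x \<omega>)) \<longlonglongrightarrow> exp (- \<kappa> * t) * norm (sol s x \<omega> - sol s x \<omega>)"
          by (intro tendsto_intros clim Slim)
        then show "(\<lambda>n. c n * norm (scheme s n x \<omega> - sol s x \<omega>)) \<longlonglongrightarrow> 0" by simp
      qed
      have "(\<lambda>n. Y n \<omega>) \<longlonglongrightarrow> sol (s + t) x \<omega>" using tendsto_add[OF 2 1] by simp
      then show ?case by (intro continuous_on_tendsto_compose[OF cf]) auto
    qed
  qed (use B s t measurable_compose[OF Ym fm] measurable_compose[OF sol_measurable fm] in auto)
  have right: "(\<lambda>n. \<integral>\<omega>. g n (scheme s n x \<omega>) \<partial>M) \<longlonglongrightarrow> (\<integral>\<omega>. markov_op t f (sol s x \<omega>) \<partial>M)"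
  proof (rule integral_tendsto_bounded[where B = B])
    show "AE \<omega> in M. (\<lambda>n. g n (scheme s n x \<omega>)) \<longlonglongrightarrow> markov_op t f (sol s x \<omega>)"
      using AE_scheme_tendsto
    proof eventually_elim
      case (elim \<omega>)
      have Slim: "(\<lambda>n. scheme s n x \<omega>) \<longlonglongrightarrow> sol s x \<omega>" using elim s by blast
      have "(\<lambda>n. g n (scheme s n x \<omega>) - g n (sol s x \<omega>)) \<longlonglongrightarrow> 0"
      proof (rule Lim_null_comparison)
        show "\<forall>\<^sub>F n in sequentially. norm (g n (scheme s n x \<omega>) - g n (sol s x \<omega>)) \<le> L * c n * norm (scheme s n x \<omega> - sol s x \<omega>)"
          using glip by eventually_elim simp
        have "(\<lambda>n. L * c n * norm (scheme s n x \<omega> - sol s x \<omega>)) \<longlonglongrightarrow> L * exp (- \<kappa> * t) * norm (sol s x \<omega> - sol s x \<omega>)"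
          by (intro tendsto_intros clim Slim)
        then show "(\<lambda>n. L * c n * norm (scheme s n x \<omega> - sol s x \<omega>)) \<longlonglongrightarrow> 0" by simp
      qed
      from tendsto_add[OF this glim[of "sol s x \<omega>"]] show ?case by simp
    qed
    show "(\<lambda>\<omega>. markov_op t f (sol s x \<omega>)) \<in> borel_measurable M"
      using sol_measurable[OF s] lipschitz_measurable[OF markov_op_lipschitz(1)[OF t L B]] by (rule measurable_compose)
  qed (use gB measurable_compose[OF scheme_measurable[OF s] gm] in auto)
  have "(\<integral>\<omega>. f (sol (s + t) x \<omega>) \<partial>M) = (\<integral>\<omega>. markov_op t f (sol s x \<omega>) \<partial>M)"
    by (rule LIMSEQ_unique[OF Lim_transform_eventually[OF left eq] right])
  then show ?thesis by (simp add: markov_op_def)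
qed

lemma markov_op_zero: "markov_op 0 f x = f x"
  by (simp add: markov_op_def sol_zero prob_space)

lemma AE_solution_eq_sol:
  assumes Y: "sde_solution M W b \<sigma> Y"
  shows "AE \<omega> in M. \<forall>t\<ge>0. Y t \<omega> = sol t (Y 0 \<omega>) \<omega>"
proof -
  have "AE \<omega> in M. continuous_on {0..} (\<lambda>t. Y t \<omega>)"
    "AE \<omega> in M. \<forall>t\<ge>0. Y t \<omega> = Y 0 \<omega> + integral {0..t} (\<lambda>s. b (Y s \<omega>)) + \<sigma> *v (W t \<omega> - W 0 \<omega>)"
    using Y unfolding sde_solution_def by blast+
  then show ?thesis
  proof eventually_elim
    case (elim \<omega>)
    show ?case
    proof (intro allI impI)
      fix t :: real assume t: "0 \<le> t"
      have "solves b (\<lambda>s. \<sigma> *v W s \<omega>) (Y 0 \<omega>) t (\<lambda>t. Y t \<omega>)"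
        unfolding solves_def
      proof (intro conjI ballI)
        show "continuous_on {0..t} (\<lambda>t. Y t \<omega>)" using elim(1) by (rule continuous_on_subset) auto
        fix r assume "r \<in> {0..t}"
        then have "0 \<le> r" by simp
        with elim(2) have "Y r \<omega> = Y 0 \<omega> + integral {0..r} (\<lambda>s. b (Y s \<omega>)) + \<sigma> *v (W r \<omega> - W 0 \<omega>)" by blast
        then show "Y r \<omega> = Y 0 \<omega> + integral {0..r} (\<lambda>s. b (Y s \<omega>)) + (\<sigma> *v W r \<omega> - \<sigma> *v W 0 \<omega>)"
          by (simp only: matrix_vector_mult_diff_distrib)
      qed
      from flow_eq[OF t this] show "Y t \<omega> = sol t (Y 0 \<omega>) \<omega>" by (simp add: sol_def)
    qed
  qed
qed

text \<open>By uniqueness a solution is the flow started at its initial value, and the latter is independent of the path.\<close>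

lemma solution_law:
  assumes Y: "sde_solution M W b \<sigma> Y" and t: "0 \<le> t"
    and f: "f \<in> borel_measurable borel" and B: "\<And>x. \<bar>f x :: real\<bar> \<le> B"
  shows "(\<integral>\<omega>. f (Y t \<omega>) \<partial>M) = (\<integral>x. markov_op t f x \<partial>distr M borel (Y 0))"
proof -
  have Ym: "Y s \<in> borel_measurable M" if "0 \<le> s" for s using Y that by (simp add: sde_solution_def)
  define path where "path \<omega> = (\<lambda>s\<in>{0..}. W s \<omega>)" for \<omega>
  let ?P = "\<Pi>\<^sub>M s\<in>{0::real..}. (borel :: (real ^ 'n) measure)"
  have path: "path \<in> M \<rightarrow>\<^sub>M ?P"
    unfolding path_def by (intro measurable_restrict W_measurable) simp
  define F where "F p = f (flow (\<lambda>s. \<sigma> *v snd p s) t (fst p))" for p :: "(real ^ 'n) \<times> (real \<Rightarrow> real ^ 'n)"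
  have Fm: "F \<in> borel_measurable (borel \<Otimes>\<^sub>M ?P)"
  proof -
    have "(\<lambda>p. \<sigma> *v snd p s) \<in> borel_measurable ((borel :: (real ^ 'n) measure) \<Otimes>\<^sub>M ?P)" if "0 \<le> s" for s
    proof -
      have "(\<lambda>p. snd p s) \<in> borel_measurable ((borel :: (real ^ 'n) measure) \<Otimes>\<^sub>M ?P)"
        using that by (intro measurable_compose[OF measurable_snd measurable_component_singleton]) auto
      from borel_measurable_continuous_on[OF linear_continuous_on this, of "(*v) \<sigma>"] show ?thesis by simp
    qed
    then show ?thesis unfolding F_def
      by (intro measurable_compose[OF flow_measurable f] t) auto
  qed
  have F_path: "F (x, path \<omega>) = f (sol t x \<omega>)" for x \<omega>
  proof -
    have "flow (\<lambda>s. \<sigma> *v path \<omega> s) t x = flow (\<lambda>s. \<sigma> *v W s \<omega>) t x"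
      by (rule flow_cong[OF t]) (simp add: path_def)
    then show ?thesis by (simp add: F_def sol_def)
  qed
  have "(\<integral>\<omega>. f (Y t \<omega>) \<partial>M) = (\<integral>\<omega>. f (sol t (Y 0 \<omega>) \<omega>) \<partial>M)"
  proof (rule integral_cong_AE)
    show "AE \<omega> in M. f (Y t \<omega>) = f (sol t (Y 0 \<omega>) \<omega>)"
      using AE_solution_eq_sol[OF Y]
    proof eventually_elim
      case (elim \<omega>)
      then have "Y t \<omega> = sol t (Y 0 \<omega>) \<omega>" using t by blast
      then show ?case by (rule arg_cong)
    qed
    show "(\<lambda>\<omega>. f (sol t (Y 0 \<omega>) \<omega>)) \<in> borel_measurable M"
      by (rule measurable_compose[OF sol_measurable_pair f]) (use t Ym in auto)
  qed (use measurable_compose[OF Ym[OF t] f] in auto)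
  also have "\<dots> = (\<integral>\<omega>. F (Y 0 \<omega>, path \<omega>) \<partial>M)" by (simp add: F_path)
  also have "\<dots> = (\<integral>x. (\<integral>\<omega>. F (x, path \<omega>) \<partial>M) \<partial>distr M borel (Y 0))"
  proof (rule independent_integral[OF Ym[OF order_refl] path _ Fm])
    show "\<bar>F p\<bar> \<le> B" for p by (simp add: F_def B)
    fix A C assume AC: "A \<in> sets (borel :: (real ^ 'n) measure)" "C \<in> sets ?P"
    have ind: "indep_set (sets (vimage_algebra (space M) (Y 0) borel)) (sets (vimage_algebra (space M) path ?P))"
      using Y unfolding sde_solution_def indep_of_process_def path_def by blast
    have "Y 0 -` A \<inter> space M \<in> sets (vimage_algebra (space M) (Y 0) borel)"
      "path -` C \<inter> space M \<in> sets (vimage_algebra (space M) path ?P)"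
      using AC by (auto intro!: in_vimage_algebra)
    from indep_setD[OF ind this]
    have "prob ((Y 0 -` A \<inter> space M) \<inter> (path -` C \<inter> space M)) = prob (Y 0 -` A \<inter> space M) * prob (path -` C \<inter> space M)" .
    moreover have "(Y 0 -` A \<inter> space M) \<inter> (path -` C \<inter> space M) = (\<lambda>\<omega>. (Y 0 \<omega>, path \<omega>)) -` (A \<times> C) \<inter> space M" by auto
    ultimately show "prob ((\<lambda>\<omega>. (Y 0 \<omega>, path \<omega>)) -` (A \<times> C) \<inter> space M) = prob (Y 0 -` A \<inter> space M) * prob (path -` C \<inter> space M)" by simp
  qed
  finally show ?thesis by (simp add: F_path markov_op_def)
qed

text \<open>A constant initial value generates the trivial \<open>\<sigma>\<close>-algebra and is independent of everything.\<close>

lemma sde_solution_sol: "sde_solution M W b \<sigma> (\<lambda>t. sol t x)"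
  unfolding sde_solution_def
proof (intro conjI allI impI sol_measurable)
  let ?P = "\<Pi>\<^sub>M s\<in>{0::real..}. (borel :: (real ^ 'n) measure)"
  let ?path = "\<lambda>\<omega>. \<lambda>t\<in>{0..}. W t \<omega>"
  have path: "?path \<in> M \<rightarrow>\<^sub>M ?P"
    by (intro measurable_restrict W_measurable) simp
  have c: "sol 0 x = (\<lambda>_. x)" by (auto simp: sol_zero)
  show "indep_of_process M (sol 0 x) W"
    unfolding indep_of_process_def c
  proof (rule indep_setI)
    have trivial: "a = {} \<or> a = space M" if a: "a \<in> sets (vimage_algebra (space M) (\<lambda>_. x) borel)" for a
    proof -
      obtain A where "a = (\<lambda>_. x) -` A \<inter> space M"
        using a by (subst (asm) sets_vimage_algebra2) auto
      then show ?thesis by (cases "x \<in> A") auto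
    qed
    then show "sets (vimage_algebra (space M) (\<lambda>_. x) borel) \<subseteq> events" by auto
    have sub: "a \<in> events" if "a \<in> sets (vimage_algebra (space M) ?path ?P)" for a
      using that measurable_space[OF path] measurable_sets[OF path] by (subst (asm) sets_vimage_algebra2) auto
    then show "sets (vimage_algebra (space M) ?path ?P) \<subseteq> events" by blast
    fix a c assume "a \<in> sets (vimage_algebra (space M) (\<lambda>_. x) borel)" "c \<in> sets (vimage_algebra (space M) ?path ?P)"
    then show "prob (a \<inter> c) = prob a * prob c"
      using trivial[of a] sub[of c] sets.sets_into_space[of c M] by (auto simp: prob_space Int_absorb1)
  qed
  show "AE \<omega> in M. continuous_on {0..} (\<lambda>t. sol t x \<omega>)"
    using noise_continuous
  proof eventually_elim
    case (elim \<omega>)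
    have "continuous_on {0..T} (\<lambda>t. sol t x \<omega>)" if "0 \<le> T" for T
      unfolding sol_def using elim that by (intro continuous_flow) auto
    then have "continuous (at t within {0..}) (\<lambda>t. sol t x \<omega>)" if "0 \<le> t" for t
    proof -
      have "continuous (at t within {0..t + 1}) (\<lambda>t. sol t x \<omega>)"
        using \<open>\<And>T. 0 \<le> T \<Longrightarrow> continuous_on {0..T} (\<lambda>t. sol t x \<omega>)\<close>[of "t + 1"] that
        by (simp add: continuous_on_eq_continuous_within)
      moreover have "at t within {0..t + 1} = at t within {0..}"
        by (rule at_within_nhd[of _ "{..<t + 1}"]) auto
      ultimately show ?thesis by simp
    qed
    then show ?case by (simp add: continuous_on_eq_continuous_within)
  qed
  show "AE \<omega> in M. \<forall>t\<ge>0. sol t x \<omega> = sol 0 x \<omega> + integral {0..t} (\<lambda>s. b (sol s x \<omega>)) + \<sigma> *v (W t \<omega> - W 0 \<omega>)"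
    using noise_continuous
  proof eventually_elim
    case (elim \<omega>)
    show ?case
    proof (intro allI impI)
      fix t :: real assume t: "0 \<le> t"
      have "solves b (\<lambda>s. \<sigma> *v W s \<omega>) x t (\<lambda>t. sol t x \<omega>)"
        unfolding sol_def using elim t by (intro solves_flow) auto
      then show "sol t x \<omega> = sol 0 x \<omega> + integral {0..t} (\<lambda>s. b (sol s x \<omega>)) + \<sigma> *v (W t \<omega> - W 0 \<omega>)"
        using t by (simp add: solves_def sol_zero matrix_vector_mult_diff_distrib)
    qed
  qed
qed

definition markov_kernel :: "real \<Rightarrow> real ^ 'n \<Rightarrow> (real ^ 'n) measure" where
  "markov_kernel t x = distr M borel (sol t x)"

lemma markov_kernel_measurable: "0 \<le> t \<Longrightarrow> markov_kernel t \<in> borel \<rightarrow>\<^sub>M prob_algebra borel"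
  unfolding markov_kernel_def[abs_def]
proof (rule measurable_distr_prob_space2)
  show "(\<lambda>_. M) \<in> borel \<rightarrow>\<^sub>M prob_algebra M"
    by (intro measurable_const) (simp add: space_prob_algebra prob_space_axioms)
  assume t: "0 \<le> t"
  show "(\<lambda>(x, \<omega>). sol t x \<omega>) \<in> borel \<Otimes>\<^sub>M M \<rightarrow>\<^sub>M borel"
    unfolding split_beta' using t by (intro sol_measurable_pair) auto
qed

lemma transition_kernels_kernel: "transition_kernels M W b \<sigma> markov_kernel"
  unfolding transition_kernels_def
proof (intro conjI allI impI markov_kernel_measurable)
  fix x
  show "\<exists>Y. sde_solution M W b \<sigma> Y \<and> (AE \<omega> in M. Y 0 \<omega> = x) \<and> (\<forall>t\<ge>0. markov_kernel t x = distr M borel (Y t))"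
    using sde_solution_sol by (intro exI[of _ "\<lambda>t. sol t x"]) (auto simp: markov_kernel_def sol_zero)
qed

text \<open>Pathwise uniqueness: any other family of solutions on the same space has the same laws.\<close>

lemma transition_kernels_unique:
  assumes "transition_kernels M W b \<sigma> P" "0 \<le> t"
  shows "P t x = markov_kernel t x"
proof -
  obtain Y where Y: "sde_solution M W b \<sigma> Y" "AE \<omega> in M. Y 0 \<omega> = x" "P t x = distr M borel (Y t)"
    using assms unfolding transition_kernels_def by blast
  have "AE \<omega> in M. Y t \<omega> = sol t x \<omega>"
    using AE_solution_eq_sol[OF Y(1)] Y(2)
  proof eventually_elim
    case (elim \<omega>)
    have "Y t \<omega> = sol t (Y 0 \<omega>) \<omega>" using elim(1) assms(2) by blast
    then show ?case by (simp only: elim(2))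
  qed
  then show ?thesis unfolding markov_kernel_def Y(3)
    using Y(1) assms(2) by (intro distr_cong_AE) (auto simp: sde_solution_def sol_measurable)
qed

lemma markov_kernel_integral:
  assumes "0 \<le> t" "f \<in> borel_measurable borel"
  shows "(\<integral>y. f y \<partial>markov_kernel t x) = markov_op t f x"
  unfolding markov_kernel_def markov_op_def using assms by (intro integral_distr sol_measurable)

lemma bind_kernel_integral:
  assumes "prob_space \<nu>" and s: "sets \<nu> = sets borel" and t: "0 \<le> t"
    and f: "f \<in> borel_measurable borel" and B: "\<And>x. \<bar>f x :: real\<bar> \<le> B"
  shows "(\<integral>x. f x \<partial>(\<nu> \<bind> markov_kernel t)) = (\<integral>x. markov_op t f x \<partial>\<nu>)"
proof -
  interpret \<nu>: prob_space \<nu> by fact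
  have k: "markov_kernel t \<in> \<nu> \<rightarrow>\<^sub>M prob_algebra borel" using markov_kernel_measurable[OF t] s measurable_cong_sets by blast
  have "(\<integral>x. f x \<partial>(\<nu> \<bind> markov_kernel t)) = (\<integral>x. (\<integral>y. f y \<partial>markov_kernel t x) \<partial>\<nu>)"
  proof (rule integral_bind[OF f, where B = B and B' = 1])
    show "markov_kernel t \<in> \<nu> \<rightarrow>\<^sub>M subprob_algebra borel" using k by (rule measurable_prob_algebraD)
    show "finite_measure \<nu>" by (rule \<nu>.finite_measure_axioms)
    show "AE x in \<nu>. emeasure (markov_kernel t x) (space (markov_kernel t x)) \<le> ennreal 1"
      unfolding markov_kernel_def
      using prob_space.emeasure_space_1[OF prob_space_distr[OF sol_measurable[OF t]]] by simp
  qed (use B in auto)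
  then show ?thesis by (simp add: markov_kernel_integral[OF t f])
qed

end

text \<open>The indicator of a closed set \<open>C\<close> is the limit of the Lipschitz functions \<open>max 0 (1 - k d(x, C))\<close>.\<close>

section \<open>Bounded Lipschitz test functions and weak limits\<close>

lemma measure_eqI_lipschitz:
  fixes \<mu> \<nu> :: "'a::metric_space measure"
  assumes "prob_space \<mu>" "prob_space \<nu>" and s: "sets \<mu> = sets borel" "sets \<nu> = sets borel"
    and eq: "\<And>(f :: 'a \<Rightarrow> real) L B. L-lipschitz_on UNIV f \<Longrightarrow> (\<And>x. \<bar>f x\<bar> \<le> B) \<Longrightarrow> (\<integral>x. f x \<partial>\<mu>) = (\<integral>x. f x \<partial>\<nu>)"
  shows "\<mu> = \<nu>"
proof -
  interpret \<mu>: prob_space \<mu> by fact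
  interpret \<nu>: prob_space \<nu> by fact
  note [measurable_cong] = s
  have "emeasure \<mu> C = emeasure \<nu> C" if C: "closed C" for C
  proof (cases "C = {}")
    case False
    define g where "g k x = max 0 (1 - real k * infdist x C)" for k x
    have g: "0 \<le> g k x" "g k x \<le> 1" for k x by (auto simp: g_def infdist_nonneg)
    have lip: "(real k)-lipschitz_on UNIV (g k)" for k
    proof (rule lipschitz_onI)
      fix x y
      have "\<bar>g k x - g k y\<bar> \<le> \<bar>real k * infdist x C - real k * infdist y C\<bar>" by (auto simp: g_def)
      also have "\<dots> = real k * \<bar>infdist x C - infdist y C\<bar>" by (simp add: abs_mult flip: right_diff_distrib)
      also have "\<dots> \<le> real k * dist x y" by (intro mult_left_mono infdist_triangle_abs) simp
      finally show "dist (g k x) (g k y) \<le> real k * dist x y" by (simp add: dist_real_def)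
    qed simp
    have gm [measurable]: "g k \<in> borel_measurable borel" for k
      using lip[of k] by (intro borel_measurable_continuous_onI lipschitz_on_continuous_on)
    have C' [measurable]: "C \<in> sets borel" using C by simp
    have lim: "(\<lambda>k. g k x) \<longlonglongrightarrow> indicator C x" for x
    proof (cases "x \<in> C")
      case True
      then show ?thesis by (simp add: g_def)
    next
      case x: False
      then have "0 < infdist x C" using C False by (simp add: infdist_pos_not_in_closed)
      then obtain N where N: "1 < real N * infdist x C" using reals_Archimedean3 by blast
      have "g k x = 0" if "k \<ge> N" for k
      proof -
        have "real N * infdist x C \<le> real k * infdist x C" using that infdist_nonneg by (intro mult_right_mono) auto
        then show ?thesis using N by (simp add: g_def)
      qed
      then have "\<forall>\<^sub>F k in sequentially. 0 = g k x" by (auto simp: eventually_sequentially)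
      then show ?thesis using x by (auto intro: Lim_transform_eventually[OF tendsto_const])
    qed
    have "(\<lambda>k. \<integral>x. g k x \<partial>\<mu>) \<longlonglongrightarrow> (\<integral>x. indicator C x \<partial>\<mu>)"
      using g lim by (intro \<mu>.integral_tendsto_bounded[where B = 1]) auto
    moreover have "(\<lambda>k. \<integral>x. g k x \<partial>\<nu>) \<longlonglongrightarrow> (\<integral>x. indicator C x \<partial>\<nu>)"
      using g lim by (intro \<nu>.integral_tendsto_bounded[where B = 1]) auto
    moreover have "(\<integral>x. g k x \<partial>\<mu>) = (\<integral>x. g k x \<partial>\<nu>)" for k
      using g by (intro eq[OF lip, of _ 1]) auto
    ultimately have "(\<integral>x. indicator C x \<partial>\<mu>) = (\<integral>x. indicator C x \<partial>\<nu> :: real)"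
      by (auto intro: LIMSEQ_unique)
    then show ?thesis
      by (simp add: \<mu>.emeasure_eq_measure \<nu>.emeasure_eq_measure sets.Int_space_eq2 s)
  qed simp
  then show ?thesis
    using s by (intro measure_eqI_generator_eq[of "Collect closed" UNIV \<mu> \<nu> "\<lambda>_. UNIV"])
      (auto simp: Int_stable_def borel_eq_closed \<mu>.emeasure_eq_measure)
qed

text \<open>The infimal convolution of \<open>f\<close> with \<open>k\<close> times the distance.\<close>

lemma lipschitz_lower_approximation:
  fixes f :: "'a::metric_space \<Rightarrow> real"
  assumes f: "continuous_on UNIV f" and B: "\<And>x. \<bar>f x\<bar> \<le> B"
  obtains g where "\<And>k. (real k)-lipschitz_on UNIV (g k)" "\<And>k x. \<bar>g k x\<bar> \<le> B" "\<And>k x. g k x \<le> f x"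
    "\<And>x. (\<lambda>k. g k x) \<longlonglongrightarrow> f x"
proof -
  define g where "g k x = (INF y. f y + real k * dist x y)" for k :: nat and x
  have lower: "- B \<le> f y + real k * dist x y" for k x y
  proof -
    have "- B \<le> f y" using B[of y] by (simp add: abs_le_iff)
    then show ?thesis by (intro add_increasing2) auto
  qed
  have bdd: "bdd_below (range (\<lambda>y. f y + real k * dist x y))" for k x
    using lower by (intro bdd_belowI[of _ "- B"]) auto
  have le: "g k x \<le> f y + real k * dist x y" for k x y
    unfolding g_def by (rule cINF_lower[OF bdd]) simp
  have ge: "c \<le> g k x" if "\<And>y. c \<le> f y + real k * dist x y" for c k x
    unfolding g_def using that by (intro cINF_greatest) auto
  show ?thesis
  proof (rule that[of g])
    show gf: "g k x \<le> f x" for k x using le[of k x x] by simp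
    show "\<bar>g k x\<bar> \<le> B" for k x
      using gf[of k x] B[of x] ge[of "- B" k x, OF lower] by (simp add: abs_le_iff)
    have half: "g k x \<le> g k y + real k * dist x y" for k x y
    proof -
      have "g k x - real k * dist x y \<le> g k y"
      proof (rule ge)
        fix z
        have "real k * dist x z \<le> real k * (dist x y + dist y z)" by (intro mult_left_mono dist_triangle) simp
        then show "g k x - real k * dist x y \<le> f z + real k * dist y z"
          using le[of k x z] by (simp add: distrib_left)
      qed
      then show ?thesis by simp
    qed
    show "(real k)-lipschitz_on UNIV (g k)" for k
    proof (rule lipschitz_onI)
      fix x y show "dist (g k x) (g k y) \<le> real k * dist x y"
        using half[of k x y] half[of k y x] by (simp add: dist_real_def dist_commute abs_le_iff)
    qed simp
    show "(\<lambda>k. g k x) \<longlonglongrightarrow> f x" for x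
    proof (rule LIMSEQ_I)
      fix e :: real assume e: "0 < e"
      have "continuous (at x) f" using f by (simp add: continuous_on_eq_continuous_at)
      then obtain d where d: "0 < d" "\<And>y. dist y x < d \<Longrightarrow> \<bar>f y - f x\<bar> < e / 2"
        using e unfolding continuous_at_eps_delta dist_real_def by (metis half_gt_zero)
      obtain N where N: "2 * B < real N * d" using d(1) reals_Archimedean3 by blast
      have "norm (g k x - f x) < e" if k: "N \<le> k" for k
      proof -
        have "f x - e / 2 \<le> g k x"
        proof (rule ge)
          fix y
          show "f x - e / 2 \<le> f y + real k * dist x y"
          proof (cases "dist y x < d")
            case True
            have "0 \<le> real k * dist x y" by simp
            then show ?thesis using d(2)[OF True] by linarith
          next
            case False
            have "real N * d \<le> real k * dist x y"
              using False k d(1) by (intro mult_mono) (auto simp: dist_commute)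
            then show ?thesis using N B[of x] B[of y] e by (simp add: abs_le_iff)
          qed
        qed
        then show ?thesis using gf[of k x] e by (simp add: abs_less_iff)
      qed
      then show "\<exists>N. \<forall>k\<ge>N. norm (g k x - f x) < e" by blast
    qed
  qed
qed

text \<open>As in the portmanteau theorem, lower Lipschitz approximations give a lower bound for the limit inferior, and
  applying this to \<open>- f\<close> gives the upper bound.\<close>

lemma weakly_convergesI_lipschitz:
  fixes \<mu> :: "real \<Rightarrow> 'a::metric_space measure"
  assumes \<mu>: "\<forall>\<^sub>F t in at_top. prob_space (\<mu> t) \<and> sets (\<mu> t) = sets borel"
    and "prob_space \<nu>" and s: "sets \<nu> = sets borel"
    and lim: "\<And>(f :: 'a \<Rightarrow> real) L B. L-lipschitz_on UNIV f \<Longrightarrow> (\<And>x. \<bar>f x\<bar> \<le> B) \<Longrightarrow>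
      ((\<lambda>t. \<integral>x. f x \<partial>\<mu> t) \<longlongrightarrow> (\<integral>x. f x \<partial>\<nu>)) at_top"
  shows "weakly_converges \<mu> \<nu>"
  unfolding weakly_converges_def
proof (intro allI impI, elim conjE)
  interpret \<nu>: prob_space \<nu> by fact
  note [measurable_cong] = s
  have lower: "\<forall>\<^sub>F t in at_top. (\<integral>x. f x \<partial>\<nu>) - e < (\<integral>x. f x \<partial>\<mu> t)"
    if f: "continuous_on UNIV f" and B: "\<And>x. \<bar>f x\<bar> \<le> B" and e: "0 < e" for f :: "'a \<Rightarrow> real" and B e
  proof -
    obtain g where g: "\<And>k. (real k)-lipschitz_on UNIV (g k)" "\<And>k x. \<bar>g k x\<bar> \<le> B" "\<And>k x. g k x \<le> f x"
      "\<And>x. (\<lambda>k. g k x) \<longlonglongrightarrow> f x"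
      using lipschitz_lower_approximation[OF f B] by blast
    have gm [measurable]: "g k \<in> borel_measurable borel" for k
      using g(1)[of k] by (intro borel_measurable_continuous_onI lipschitz_on_continuous_on)
    have fm [measurable]: "f \<in> borel_measurable borel" using f by (rule borel_measurable_continuous_onI)
    have "(\<lambda>k. \<integral>x. g k x \<partial>\<nu>) \<longlonglongrightarrow> (\<integral>x. f x \<partial>\<nu>)"
      using g by (intro \<nu>.integral_tendsto_bounded[where B = B]) auto
    then have "\<forall>\<^sub>F k in sequentially. (\<integral>x. f x \<partial>\<nu>) - e < (\<integral>x. g k x \<partial>\<nu>)"
      using e by (intro order_tendstoD) auto
    then obtain k where k: "(\<integral>x. f x \<partial>\<nu>) - e < (\<integral>x. g k x \<partial>\<nu>)"
      by (auto simp: eventually_sequentially)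
    have "\<forall>\<^sub>F t in at_top. (\<integral>x. f x \<partial>\<nu>) - e < (\<integral>x. g k x \<partial>\<mu> t)"
      using lim[OF g(1) g(2), of k] k by (intro order_tendstoD) auto
    then show ?thesis using \<mu>
    proof eventually_elim
      case (elim t)
      interpret \<mu>: prob_space "\<mu> t" using elim by blast
      have [measurable_cong]: "sets (\<mu> t) = sets borel" using elim by blast
      have "(\<integral>x. g k x \<partial>\<mu> t) \<le> (\<integral>x. f x \<partial>\<mu> t)"
        using g B by (intro integral_mono \<mu>.integrable_bounded[where B = B]) auto
      then show ?case using elim by linarith
    qed
  qed
  fix f :: "'a \<Rightarrow> real" assume f: "continuous_on UNIV f" and "bounded (range f)"
  then obtain B where B: "\<And>x. \<bar>f x\<bar> \<le> B" unfolding bounded_iff by auto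
  show "((\<lambda>t. \<integral>x. f x \<partial>\<mu> t) \<longlongrightarrow> (\<integral>x. f x \<partial>\<nu>)) at_top"
  proof (rule tendstoI)
    fix e :: real assume e: "0 < e"
    have "\<forall>\<^sub>F t in at_top. (\<integral>x. - f x \<partial>\<nu>) - e < (\<integral>x. - f x \<partial>\<mu> t)"
      using B by (intro lower[OF continuous_on_minus[OF f] _ e]) simp
    with lower[OF f B e] show "\<forall>\<^sub>F t in at_top. dist (\<integral>x. f x \<partial>\<mu> t) (\<integral>x. f x \<partial>\<nu>) < e"
      by eventually_elim (simp add: dist_real_def abs_less_iff)
  qed
qed

lemma lipschitz_concentration_weak_limit:
  fixes \<mu> :: "real \<Rightarrow> 'a::metric_space measure"
  assumes w: "weakly_converges \<mu> \<nu>" and conc: "\<forall>\<^sub>F t in at_top. lipschitz_concentration (D t) (\<mu> t)"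
    and D: "(D \<longlongrightarrow> D') at_top"
  shows "lipschitz_concentration D' \<nu>"
  unfolding lipschitz_concentration_def
proof (intro allI impI, elim conjE)
  fix f :: "'a \<Rightarrow> real" and L B assume L: "L-lipschitz_on UNIV f" and B: "\<forall>x. \<bar>f x\<bar> \<le> B"
  have cf: "continuous_on UNIV f" using L by (rule lipschitz_on_continuous_on)
  show "(\<integral>x. exp (f x) \<partial>\<nu>) \<le> exp ((\<integral>x. f x \<partial>\<nu>) + D' * L\<^sup>2)"
  proof (rule tendsto_le[OF trivial_limit_at_top_linorder])
    have "bounded (range f)" using B by (auto simp: bounded_iff)
    then have "((\<lambda>t. \<integral>x. f x \<partial>\<mu> t) \<longlongrightarrow> (\<integral>x. f x \<partial>\<nu>)) at_top"
      using w cf unfolding weakly_converges_def by blast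
    then show "((\<lambda>t. exp ((\<integral>x. f x \<partial>\<mu> t) + D t * L\<^sup>2)) \<longlongrightarrow> exp ((\<integral>x. f x \<partial>\<nu>) + D' * L\<^sup>2)) at_top"
      by (intro tendsto_intros D)
    have "norm (exp (f x)) \<le> exp B" for x using B by (simp add: abs_le_iff)
    then have "bounded (range (\<lambda>x. exp (f x)))" unfolding bounded_iff by auto
    then show "((\<lambda>t. \<integral>x. exp (f x) \<partial>\<mu> t) \<longlongrightarrow> (\<integral>x. exp (f x) \<partial>\<nu>)) at_top"
      using w continuous_on_exp[OF cf] unfolding weakly_converges_def by blast
    show "\<forall>\<^sub>F t in at_top. (\<integral>x. exp (f x) \<partial>\<mu> t) \<le> exp ((\<integral>x. f x \<partial>\<mu> t) + D t * L\<^sup>2)"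
      using conc by eventually_elim (rule lipschitz_concentrationD[OF _ L], use B in auto)
  qed
qed

text \<open>Apply concentration to \<open>- min |x| n\<close>. The exponential moment is at least \<open>p = E e\<^sup>-\<^sup>|\<^sup>x\<^sup>| > 0\<close> for every
  \<open>n\<close>, so the means of \<open>min |x| n\<close> are bounded by \<open>D - ln p\<close>, and monotone convergence applies.\<close>

lemma lipschitz_concentration_integrable_norm:
  fixes \<mu> :: "'a::{real_normed_vector, second_countable_topology} measure"
  assumes "prob_space \<mu>" and s: "sets \<mu> = sets borel" and conc: "lipschitz_concentration D \<mu>"
  shows "integrable \<mu> norm"
proof -
  interpret prob_space \<mu> by fact
  note [measurable_cong] = s
  define g where "g n x = min (norm x) (real n)" for n and x :: 'a
  have gB: "\<bar>g n x\<bar> \<le> real n" "0 \<le> g n x" for n x by (auto simp: g_def)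
  have [measurable]: "g n \<in> borel_measurable borel" for n unfolding g_def by measurable
  have int: "integrable \<mu> (g n)" for n by (rule integrable_bounded[OF _ gB(1)]) measurable
  define p where "p = (\<integral>x. exp (- norm x) \<partial>\<mu>)"
  have ie: "integrable \<mu> (\<lambda>x. exp (- norm x))" by (rule integrable_bounded[where B = 1]) auto
  have p: "0 < p"
  proof -
    have "p \<noteq> 0"
    proof
      assume "p = 0"
      then have "AE x in \<mu>. exp (- norm x) = 0"
        unfolding p_def using ie by (subst (asm) integral_nonneg_eq_0_iff_AE) auto
      then have "AE x in \<mu>. False" by simp
      then show False by (simp add: AE_False)
    qed
    moreover have "0 \<le> p" by (simp add: p_def)
    ultimately show ?thesis by simp
  qed
  have bound: "(\<integral>x. g n x \<partial>\<mu>) \<le> D - ln p" for n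
  proof -
    have "1-lipschitz_on UNIV (\<lambda>x. - g n x)"
      unfolding g_def
    proof (rule lipschitz_onI)
      fix x y :: 'a
      show "dist (- min (norm x) (real n)) (- min (norm y) (real n)) \<le> 1 * dist x y"
        using norm_triangle_ineq3[of x y] by (auto simp: dist_norm abs_if min_def split: if_splits)
    qed simp
    from lipschitz_concentrationD[OF conc this, of "real n"] gB
    have "(\<integral>x. exp (- g n x) \<partial>\<mu>) \<le> exp ((\<integral>x. - g n x \<partial>\<mu>) + D)" by simp
    moreover have "p \<le> (\<integral>x. exp (- g n x) \<partial>\<mu>)"
      unfolding p_def using gB by (intro integral_mono[OF ie] integrable_bounded[where B = 1]) (auto simp: g_def)
    ultimately have "p \<le> exp (D - (\<integral>x. g n x \<partial>\<mu>))" by simp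
    then have "ln p \<le> D - (\<integral>x. g n x \<partial>\<mu>)" using p by (metis exp_gt_zero ln_exp ln_le_cancel_iff)
    then show ?thesis by simp
  qed
  have "incseq (\<lambda>n. \<integral>x. g n x \<partial>\<mu>)"
    by (intro incseq_SucI integral_mono[OF int int]) (simp add: g_def)
  then obtain l where "(\<lambda>n. \<integral>x. g n x \<partial>\<mu>) \<longlonglongrightarrow> l"
    using incseq_convergent[of "\<lambda>n. \<integral>x. g n x \<partial>\<mu>" "D - ln p"] bound by blast
  then show ?thesis
  proof (rule integral_monotone_convergence_nonneg(1)[OF int, rotated 3])
    show "AE x in \<mu>. mono (\<lambda>n. g n x)" by (auto simp: mono_def g_def)
    show "AE x in \<mu>. (\<lambda>n. g n x) \<longlonglongrightarrow> norm x"
    proof (intro AE_I2)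
      fix x :: 'a
      obtain N where "norm x \<le> real N" using real_arch_simple by blast
      then have "\<forall>\<^sub>F n in sequentially. norm x = g n x"
        unfolding eventually_sequentially g_def by (intro exI[of _ N]) auto
      then show "(\<lambda>n. g n x) \<longlonglongrightarrow> norm x" by (rule Lim_transform_eventually[OF tendsto_const])
    qed
  qed (use gB in auto)
qed

section \<open>Concentration of the solution\<close>

context additive_noise
begin

lemma exp_factor_nonneg: "0 \<le> t \<Longrightarrow> 0 \<le> exp_factor \<kappa> t"
  by (cases "0 < \<kappa>") (auto simp: exp_factor_def zero_le_divide_iff mult_nonneg_nonneg mult_nonpos_nonneg)

text \<open>Condition on the initial value. The inner exponential moment costs \<open>A (exp_factor \<kappa> t) L\<^sup>2\<close>, and what
  remains is the exponential moment of \<open>P\<^sub>t f\<close> under the initial law, where \<open>P\<^sub>t f\<close> has Lipschitz constant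
  \<open>L e\<^sup>-\<^sup>\<kappa>\<^sup>t\<close>.\<close>

lemma solution_concentration:
  assumes Y: "sde_solution M W b \<sigma> Y" and t: "0 \<le> t"
    and conc: "lipschitz_concentration D (distr M borel (Y 0))"
  shows "lipschitz_concentration (D * exp (- 2 * \<kappa> * t) + A * exp_factor \<kappa> t) (distr M borel (Y t))"
  unfolding lipschitz_concentration_def
proof (intro allI impI, elim conjE)
  fix f :: "real ^ 'n \<Rightarrow> real" and L B assume L: "L-lipschitz_on UNIV f" and B: "\<forall>x. \<bar>f x\<bar> \<le> B"
  have Ym: "Y s \<in> borel_measurable M" if "0 \<le> s" for s using Y that by (simp add: sde_solution_def)
  let ?\<mu> = "distr M borel (Y 0)"
  interpret \<mu>: prob_space ?\<mu> using Ym[of 0] by (intro prob_space_distr) simp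
  have fm [measurable]: "f \<in> borel_measurable borel" using L by (rule lipschitz_measurable)
  have eB: "\<bar>exp (f x)\<bar> \<le> exp B" for x using B by (auto simp: abs_le_iff)
  define g where "g = markov_op t f"
  have g: "(L * exp (- \<kappa> * t))-lipschitz_on UNIV g" "\<bar>g x\<bar> \<le> B" for x
    unfolding g_def using markov_op_lipschitz[OF t L] B by auto
  have gm [measurable]: "g \<in> borel_measurable borel" using g(1) by (rule lipschitz_measurable)
  define c where "c = A * exp_factor \<kappa> t * L\<^sup>2"
  have one: "markov_op t (\<lambda>x. exp (f x)) x \<le> exp (g x) * exp c" for x
    using sol_exp_moment[OF t L, of B x] B by (simp add: g_def c_def exp_add)
  have "(\<integral>x. exp (f x) \<partial>distr M borel (Y t)) = (\<integral>\<omega>. exp (f (Y t \<omega>)) \<partial>M)"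
    using Ym[OF t] by (simp add: integral_distr)
  also have "\<dots> = (\<integral>x. markov_op t (\<lambda>x. exp (f x)) x \<partial>?\<mu>)"
    by (rule solution_law[OF Y t _ eB]) measurable
  also have "\<dots> \<le> (\<integral>x. exp (g x) * exp c \<partial>?\<mu>)"
  proof (rule integral_mono[OF _ _ one])
    have "(\<lambda>p. exp (f (sol t (fst p) (snd p)))) \<in> borel_measurable (borel \<Otimes>\<^sub>M M)"
      by (intro measurable_compose[OF sol_measurable_pair] t) auto
    then have "markov_op t (\<lambda>x. exp (f x)) \<in> borel_measurable borel"
      unfolding markov_op_def[abs_def]
      using borel_measurable_lebesgue_integral[of "\<lambda>x \<omega>. exp (f (sol t x \<omega>))" borel] by (simp add: split_beta')
    moreover have "\<bar>markov_op t (\<lambda>x. exp (f x)) x\<bar> \<le> exp B" for x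
      unfolding markov_op_def
      by (rule abs_expectation_le[OF measurable_compose[OF sol_measurable[OF t]] eB]) measurable
    ultimately show "integrable ?\<mu> (markov_op t (\<lambda>x. exp (f x)))"
      by (intro \<mu>.integrable_bounded) auto
    show "integrable ?\<mu> (\<lambda>x. exp (g x) * exp c)"
      using g(2) by (intro integrable_mult_left \<mu>.integrable_bounded[where B = "exp B"]) (auto simp: abs_le_iff)
  qed
  also have "\<dots> = (\<integral>x. exp (g x) \<partial>?\<mu>) * exp c" by simp
  also have "\<dots> \<le> exp ((\<integral>x. g x \<partial>?\<mu>) + D * (L * exp (- \<kappa> * t))\<^sup>2) * exp c"
    by (intro mult_right_mono lipschitz_concentrationD[OF conc g]) simp
  also have "(\<integral>x. g x \<partial>?\<mu>) = (\<integral>x. f x \<partial>distr M borel (Y t))"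
    using solution_law[OF Y t fm, of B] B Ym[OF t] by (simp add: g_def integral_distr)
  also have "exp ((\<integral>x. f x \<partial>distr M borel (Y t)) + D * (L * exp (- \<kappa> * t))\<^sup>2) * exp c
      = exp ((\<integral>x. f x \<partial>distr M borel (Y t)) + (D * exp (- 2 * \<kappa> * t) + A * exp_factor \<kappa> t) * L\<^sup>2)"
  proof -
    have "(exp (- \<kappa> * t))\<^sup>2 = exp (- 2 * \<kappa> * t)" by (simp flip: exp_double)
    then show ?thesis
      by (simp only: exp_add[symmetric] c_def power_mult_distrib) (simp add: algebra_simps)
  qed
  finally show "(\<integral>x. exp (f x) \<partial>distr M borel (Y t))
      \<le> exp ((\<integral>x. f x \<partial>distr M borel (Y t)) + (D * exp (- 2 * \<kappa> * t) + A * exp_factor \<kappa> t) * L\<^sup>2)" .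
qed

lemma point_mass_concentration: "lipschitz_concentration 0 (distr M borel (\<lambda>_. x :: real ^ 'n))"
  unfolding lipschitz_concentration_def
proof (intro allI impI, elim conjE)
  fix f :: "real ^ 'n \<Rightarrow> real" and L B assume "L-lipschitz_on UNIV f"
  then have [measurable]: "f \<in> borel_measurable borel" by (rule lipschitz_measurable)
  have "(\<integral>y. exp (f y) \<partial>distr M borel (\<lambda>_. x)) = exp (f x)" "(\<integral>y. f y \<partial>distr M borel (\<lambda>_. x)) = f x"
    by (subst integral_distr; simp add: prob_space)+
  then show "(\<integral>y. exp (f y) \<partial>distr M borel (\<lambda>_. x)) \<le> exp ((\<integral>y. f y \<partial>distr M borel (\<lambda>_. x)) + 0 * L\<^sup>2)"
    by simp
qed

text \<open>A point mass satisfies the concentration inequality with constant \<open>0\<close>, so the law of the solution started at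
  a point satisfies one as well and has a first moment.\<close>

lemma integrable_sol: "0 \<le> t \<Longrightarrow> integrable M (\<lambda>\<omega>. norm (sol t x \<omega>))"
proof -
  assume t: "0 \<le> t"
  have "sol 0 x = (\<lambda>_. x)" by (auto simp: sol_zero)
  then have "lipschitz_concentration (0 * exp (- 2 * \<kappa> * t) + A * exp_factor \<kappa> t) (distr M borel (sol t x))"
    using solution_concentration[OF sde_solution_sol t, of 0 x] point_mass_concentration by simp
  then have "integrable (distr M borel (sol t x)) norm"
    by (rule lipschitz_concentration_integrable_norm[rotated 2])
       (auto intro: prob_space_distr sol_measurable[OF t])
  then show ?thesis using sol_measurable[OF t] by (subst (asm) integrable_distr_eq) auto
qed

end

section \<open>The invariant measure of a contractive diffusion\<close>

locale contractive_noise = additive_noise M W b \<kappa> \<sigma> A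
  for M :: "'w measure" and W :: "real \<Rightarrow> 'w \<Rightarrow> real ^ 'n" and b :: "real ^ 'n \<Rightarrow> real ^ 'n"
    and \<kappa> :: real and \<sigma> :: "real ^ 'n ^ 'n" and A :: real +
  assumes \<kappa>: "0 < \<kappa>"
begin

lemma markov_op_contract:
  assumes "0 \<le> t" "L-lipschitz_on UNIV f" "\<And>x. \<bar>f x\<bar> \<le> B"
  shows "\<bar>markov_op t f x - markov_op t f y\<bar> \<le> min (2 * B) (L * exp (- \<kappa> * t) * norm (x - y))"
  using lipschitz_on_normD[OF markov_op_lipschitz(1)[OF assms], of x y]
    markov_op_lipschitz(2)[OF assms, of x] markov_op_lipschitz(2)[OF assms, of y] by auto

text \<open>\<open>P\<^sub>t f\<close> is Lipschitz with constant \<open>L e\<^sup>-\<^sup>\<kappa>\<^sup>t\<close> and bounded, so by dominated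
  convergence its deviation from \<open>P\<^sub>t f (0)\<close> has vanishing mean under any probability measure.\<close>

lemma forgets_initial_law:
  assumes "prob_space \<mu>" and s: "sets \<mu> = sets borel"
    and L: "L-lipschitz_on UNIV f" and B: "\<And>x. \<bar>f x\<bar> \<le> B"
  shows "((\<lambda>t. (\<integral>x. markov_op t f x \<partial>\<mu>) - markov_op t f 0) \<longlongrightarrow> 0) at_top"
proof (rule Lim_null_comparison)
  interpret \<mu>: prob_space \<mu> by fact
  note [measurable_cong] = s
  have L0: "0 \<le> L" using L lipschitz_on_nonneg by blast
  have B0: "0 \<le> B" using B[of 0] by linarith
  define w where "w t x = min (2 * B) (L * exp (- \<kappa> * t) * norm x)" for t and x :: "real ^ 'n"
  have w: "\<bar>w t x\<bar> \<le> 2 * B" for t x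
  proof -
    have "0 \<le> w t x" using B0 L0 by (simp add: w_def)
    moreover have "w t x \<le> 2 * B" by (simp add: w_def)
    ultimately show ?thesis by simp
  qed
  have wm [measurable]: "w t \<in> borel_measurable borel" for t unfolding w_def by measurable
  show "\<forall>\<^sub>F t in at_top. norm ((\<integral>x. markov_op t f x \<partial>\<mu>) - markov_op t f 0) \<le> (\<integral>x. w t x \<partial>\<mu>)"
    using eventually_ge_at_top[of 0]
  proof eventually_elim
    case (elim t)
    note S = markov_op_lipschitz[OF elim L B]
    have [measurable]: "markov_op t f \<in> borel_measurable borel" using S(1) by (rule lipschitz_measurable)
    have int: "integrable \<mu> (markov_op t f)" by (rule \<mu>.integrable_bounded[OF _ S(2)]) measurable
    have "(\<integral>x. markov_op t f x \<partial>\<mu>) - markov_op t f 0 = (\<integral>x. markov_op t f x - markov_op t f 0 \<partial>\<mu>)"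
      using int by (simp add: \<mu>.prob_space)
    also have "norm \<dots> \<le> (\<integral>x. norm (markov_op t f x - markov_op t f 0) \<partial>\<mu>)" by (rule integral_norm_bound)
    also have "\<dots> \<le> (\<integral>x. w t x \<partial>\<mu>)"
    proof (rule integral_mono)
      show "integrable \<mu> (w t)" by (rule \<mu>.integrable_bounded[OF _ w]) measurable
      show "norm (markov_op t f x - markov_op t f 0) \<le> w t x" for x
        using markov_op_contract[OF elim L B, of x 0] by (simp add: w_def)
    qed (use int in auto)
    finally show ?case .
  qed
  have "((\<lambda>t. \<integral>x. w t x \<partial>\<mu>) \<longlongrightarrow> (\<integral>x. 0 \<partial>\<mu>)) at_top"
  proof (rule integral_dominated_convergence_at_top[where w = "\<lambda>_. 2 * B"])
    show "AE x in \<mu>. ((\<lambda>t. w t x) \<longlongrightarrow> 0) at_top"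
    proof (intro AE_I2)
      fix x :: "real ^ 'n"
      have "((\<lambda>t. exp (- \<kappa> * t)) \<longlongrightarrow> 0) at_top"
        using \<kappa> by real_asymp
      then have "((\<lambda>t. w t x) \<longlongrightarrow> min (2 * B) (L * 0 * norm x)) at_top"
        unfolding w_def by (intro tendsto_intros)
      then show "((\<lambda>t. w t x) \<longlongrightarrow> 0) at_top" using B0 by simp
    qed
  qed (use w in auto)
  then show "((\<lambda>t. \<integral>x. w t x \<partial>\<mu>) \<longlongrightarrow> 0) at_top" by simp
qed

text \<open>Independent copies of the time-one map composed in reversed order: the newest copy is applied first, so that
  consecutive values differ only in the innermost argument.\<close>

primrec pullback :: "nat \<Rightarrow> (nat \<Rightarrow> 'w) \<Rightarrow> real ^ 'n" where
  "pullback 0 s = 0"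
| "pullback (Suc k) s = sol 1 (pullback k (\<lambda>i. s (Suc i))) (s 0)"

text \<open>The increment from \<open>pullback k\<close> to \<open>pullback (k + 1)\<close> is contracted by \<open>k\<close> outer maps, hence bounded by
  \<open>q\<^sup>k\<close> times an integrable variable whose law does not depend on \<open>k\<close>; the sequence converges almost surely.
  Splitting off the first copy shows that the law of \<open>pullback (k + 1)\<close> is that of \<open>pullback k\<close> moved by one time
  unit, and in the limit both laws agree.\<close>

lemma invariant_for_unit_time:
  obtains \<nu> where "prob_space \<nu>" "sets \<nu> = sets (borel :: (real ^ 'n) measure)"
    "\<And>f L B. L-lipschitz_on UNIV f \<Longrightarrow> (\<And>x. \<bar>f x\<bar> \<le> B) \<Longrightarrow> (\<integral>x. markov_op 1 f x \<partial>\<nu>) = (\<integral>x. f x \<partial>\<nu>)"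
proof -
  interpret S: sequence_space M ..
  let ?S = "\<Pi>\<^sub>M i\<in>(UNIV :: nat set). M"
  have PS: "prob_space ?S" by (rule prob_space_PiM) (rule prob_space_axioms)
  have shift: "(\<lambda>s i. s (Suc i)) \<in> ?S \<rightarrow>\<^sub>M ?S"
    by (rule measurable_PiM_single') (auto simp: space_PiM PiE_iff)
  have pm [measurable]: "pullback k \<in> borel_measurable ?S" for k
  proof (induction k)
    case (Suc k)
    have "(\<lambda>s. pullback k (\<lambda>i. s (Suc i))) \<in> borel_measurable ?S" using shift Suc by (rule measurable_compose)
    then have "(\<lambda>s. sol 1 (pullback k (\<lambda>i. s (Suc i))) (s 0)) \<in> borel_measurable ?S"
      by (intro sol_measurable_pair) auto
    then show ?case by (simp add: fun_eq_iff[symmetric] cong: measurable_cong)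
  qed simp
  define q where "q = exp (- \<kappa>)"
  have q: "0 < q" "q < 1" using \<kappa> by (auto simp: q_def)
  \<comment> \<open>The time-one map contracts for almost every outcome only; these outcomes are singled out so that the estimate can be iterated.\<close>
  define good where "good \<omega> \<longleftrightarrow> (\<forall>x y. norm (sol 1 x \<omega> - sol 1 y \<omega>) \<le> q * norm (x - y))" for \<omega>
  have "AE \<omega> in M. good \<omega>"
    using AE_sol_lipschitz
  proof eventually_elim
    case (elim \<omega>)
    from elim[rule_format, of 1] show ?case by (simp add: good_def q_def)
  qed
  then have good: "AE s in ?S. \<forall>k. good (s k)"
    by (intro AE_all_countable[THEN iffD2] allI AE_PiM_component prob_space_axioms) auto
  have incr: "norm (pullback (Suc k) s - pullback k s) \<le> q ^ k * norm (sol 1 0 (s k))" if "\<forall>k. good (s k)" for k s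
    using that
  proof (induction k arbitrary: s)
    case (Suc k)
    have "norm (pullback (Suc (Suc k)) s - pullback (Suc k) s)
        \<le> q * norm (pullback (Suc k) (\<lambda>i. s (Suc i)) - pullback k (\<lambda>i. s (Suc i)))"
      using Suc.prems unfolding good_def by (subst (1 2) pullback.simps(2)) blast
    also have "\<dots> \<le> q * (q ^ k * norm (sol 1 0 (s (Suc k))))"
      using Suc.IH[of "\<lambda>i. s (Suc i)"] Suc.prems q by (intro mult_left_mono) auto
    finally show ?case by simp
  qed simp
  have summ: "AE s in ?S. summable (\<lambda>k. q ^ k * norm (sol 1 0 (s k)))"
  proof -
    let ?t = "\<lambda>k s. q ^ k * norm (sol 1 0 (s k))"
    define m where "m = (\<integral>\<omega>. norm (sol 1 0 \<omega>) \<partial>M)"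
    have sm: "(\<lambda>\<omega>. norm (sol 1 0 \<omega>)) \<in> borel_measurable M" using sol_measurable[of 1 0] by simp
    have comp: "distr ?S M (\<lambda>s. s k) = M" for k
      using distr_PiM_component[of UNIV "\<lambda>_. M" k] prob_space_axioms by simp
    have tm [measurable]: "?t k \<in> borel_measurable ?S" for k
      using measurable_compose[OF measurable_component_singleton[of k UNIV "\<lambda>_. M"] sm] by simp
    have int: "(\<integral>\<^sup>+s. ennreal (?t k s) \<partial>?S) = ennreal (q ^ k * m)" for k
    proof -
      have "(\<integral>\<^sup>+s. ennreal (?t k s) \<partial>?S) = (\<integral>\<^sup>+\<omega>. ennreal (q ^ k * norm (sol 1 0 \<omega>)) \<partial>distr ?S M (\<lambda>s. s k))"
        using sm by (subst nn_integral_distr) auto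
      also have "\<dots> = ennreal (\<integral>\<omega>. q ^ k * norm (sol 1 0 \<omega>) \<partial>M)"
        unfolding comp using integrable_sol[of 1 0] q by (intro nn_integral_eq_integral) auto
      finally show ?thesis by (simp add: m_def)
    qed
    have "(\<integral>\<^sup>+s. (\<Sum>k. ennreal (?t k s)) \<partial>?S) = (\<Sum>k. ennreal (q ^ k * m))"
      by (subst nn_integral_suminf) (auto simp: int)
    also have "\<dots> = ennreal (\<Sum>k. q ^ k * m)"
      using q by (intro suminf_ennreal2 summable_mult2 summable_geometric) (auto simp: m_def)
    finally have "(\<integral>\<^sup>+s. (\<Sum>k. ennreal (?t k s)) \<partial>?S) \<noteq> \<infinity>" by simp
    then have "AE s in ?S. (\<Sum>k. ennreal (?t k s)) \<noteq> \<infinity>"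
      by (intro nn_integral_PInf_AE) auto
    then show ?thesis
      by eventually_elim (rule summable_suminf_not_top, use q in auto)
  qed
  have conv: "AE s in ?S. convergent (\<lambda>k. pullback k s)"
    using good summ
  proof eventually_elim
    case (elim s)
    have "summable (\<lambda>k. pullback (Suc k) s - pullback k s)"
      by (rule summable_comparison_test'[OF elim(2)]) (use incr elim(1) in auto)
    then have "convergent (\<lambda>n. \<Sum>k<n. pullback (Suc k) s - pullback k s)"
      by (simp add: summable_iff_convergent)
    then show ?case
      unfolding sum_lessThan_telescope[of "\<lambda>k. pullback k s"] by (simp only: pullback.simps(1) diff_zero)
  qed
  define Z where "Z s = lim (\<lambda>k. pullback k s)" for s
  have Zm [measurable]: "Z \<in> borel_measurable ?S" unfolding Z_def[abs_def] by measurable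
  have Zlim: "AE s in ?S. (\<lambda>k. pullback k s) \<longlonglongrightarrow> Z s"
    using conv by eventually_elim (simp add: Z_def convergent_LIMSEQ_iff)
  show ?thesis
  proof (rule that[of "distr ?S borel Z"])
    show "prob_space (distr ?S borel Z)" by (rule prob_space.prob_space_distr[OF PS Zm])
    fix f :: "real ^ 'n \<Rightarrow> real" and L B assume L: "L-lipschitz_on UNIV f" and B: "\<And>x. \<bar>f x\<bar> \<le> B"
    have cf: "continuous_on UNIV f" using L by (rule lipschitz_on_continuous_on)
    have fm [measurable]: "f \<in> borel_measurable borel" using L by (rule lipschitz_measurable)
    note Pf = markov_op_lipschitz[OF zero_le_one L B]
    have cPf: "continuous_on UNIV (markov_op 1 f)" using Pf(1) by (rule lipschitz_on_continuous_on)
    have Pfm [measurable]: "markov_op 1 f \<in> borel_measurable borel" using Pf(1) by (rule lipschitz_measurable)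
    \<comment> \<open>Product measure is invariant under splitting off the first coordinate, which drives the outermost map.\<close>
    have step: "(\<integral>s. f (pullback (Suc k) s) \<partial>?S) = (\<integral>s. markov_op 1 f (pullback k s) \<partial>?S)" for k
    proof -
      interpret pair_prob_space M ?S ..
      have m1: "(\<lambda>p. f (sol 1 (pullback k (snd p)) (fst p))) \<in> borel_measurable (M \<Otimes>\<^sub>M ?S)"
        by (rule measurable_compose[OF sol_measurable_pair fm]) auto
      have "(\<integral>s. f (pullback (Suc k) s) \<partial>?S)
          = (\<integral>s. f (pullback (Suc k) s) \<partial>distr (M \<Otimes>\<^sub>M ?S) ?S (\<lambda>(a, s). case_nat a s))"
        unfolding S.PiM_iter ..
      also have "\<dots> = (\<integral>p. f (pullback (Suc k) (case_nat (fst p) (snd p))) \<partial>(M \<Otimes>\<^sub>M ?S))"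
      proof -
        have "(\<lambda>(a, s). case_nat a s) \<in> M \<Otimes>\<^sub>M ?S \<rightarrow>\<^sub>M ?S" by measurable
        from integral_distr[OF this measurable_compose[OF pm fm]] show ?thesis by (simp only: split_beta')
      qed
      also have "\<dots> = (\<integral>p. f (sol 1 (pullback k (snd p)) (fst p)) \<partial>(M \<Otimes>\<^sub>M ?S))" by simp
      also have "\<dots> = (\<integral>s. (\<integral>\<omega>. f (sol 1 (pullback k s) \<omega>) \<partial>M) \<partial>?S)"
      proof -
        have "integrable (M \<Otimes>\<^sub>M ?S) (\<lambda>(\<omega>, s). f (sol 1 (pullback k s) \<omega>))"
          using m1 B by (intro P.integrable_bounded[where B = B]) (auto simp: split_beta')
        from integral_snd[OF this] show ?thesis by (simp add: split_beta')
      qed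
      finally show ?thesis by (simp add: markov_op_def)
    qed
    have "(\<lambda>k. \<integral>s. f (pullback (Suc k) s) \<partial>?S) \<longlonglongrightarrow> (\<integral>s. f (Z s) \<partial>?S)"
    proof (rule prob_space.integral_tendsto_bounded[OF PS, where B = B])
      show "AE s in ?S. (\<lambda>k. f (pullback (Suc k) s)) \<longlonglongrightarrow> f (Z s)"
        using Zlim by eventually_elim (intro continuous_on_tendsto_compose[OF cf LIMSEQ_Suc], auto)
    qed (use B in \<open>auto intro: measurable_compose[OF pm fm] measurable_compose[OF Zm fm] simp del: pullback.simps\<close>)
    moreover have "(\<lambda>k. \<integral>s. markov_op 1 f (pullback k s) \<partial>?S) \<longlonglongrightarrow> (\<integral>s. markov_op 1 f (Z s) \<partial>?S)"
    proof (rule prob_space.integral_tendsto_bounded[OF PS, where B = B])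
      show "AE s in ?S. (\<lambda>k. markov_op 1 f (pullback k s)) \<longlonglongrightarrow> markov_op 1 f (Z s)"
        using Zlim by eventually_elim (intro continuous_on_tendsto_compose[OF cPf], auto)
    qed (use Pf(2) in \<open>auto intro: measurable_compose[OF pm Pfm] measurable_compose[OF Zm Pfm]\<close>)
    ultimately have "(\<integral>s. f (Z s) \<partial>?S) = (\<integral>s. markov_op 1 f (Z s) \<partial>?S)"
      unfolding step by (rule LIMSEQ_unique)
    then show "(\<integral>x. markov_op 1 f x \<partial>distr ?S borel Z) = (\<integral>x. f x \<partial>distr ?S borel Z)"
      by (simp add: integral_distr)
  qed simp
qed

lemma markov_op_times_tendsto:
  assumes "prob_space \<nu>" "sets \<nu> = sets borel"
    and unit: "\<And>f L B. L-lipschitz_on UNIV f \<Longrightarrow> (\<And>x. \<bar>f x\<bar> \<le> B) \<Longrightarrow> (\<integral>x. markov_op 1 f x \<partial>\<nu>) = (\<integral>x. f x \<partial>\<nu>)"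
    and L: "L-lipschitz_on UNIV f" and B: "\<And>x. \<bar>f x\<bar> \<le> B"
  shows "(\<lambda>n. markov_op (real n) f 0) \<longlonglongrightarrow> (\<integral>x. f x \<partial>\<nu>)"
proof -
  have n: "(\<integral>x. markov_op (real n) f x \<partial>\<nu>) = (\<integral>x. f x \<partial>\<nu>)" for n
  proof (induction n)
    case (Suc n)
    have "markov_op (real (Suc n)) f x = markov_op 1 (markov_op (real n) f) x" for x
      using markov_op_add[OF zero_le_one of_nat_0_le_iff L B, of n x] by simp
    then have "(\<integral>x. markov_op (real (Suc n)) f x \<partial>\<nu>) = (\<integral>x. markov_op 1 (markov_op (real n) f) x \<partial>\<nu>)"
      by (simp only:)
    also have "\<dots> = (\<integral>x. markov_op (real n) f x \<partial>\<nu>)"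
      by (rule unit[OF markov_op_lipschitz[OF of_nat_0_le_iff L B]])
    finally show ?case using Suc by simp
  qed (simp add: markov_op_zero)
  have "(\<lambda>n. (\<integral>x. markov_op (real n) f x \<partial>\<nu>) - markov_op (real n) f 0) \<longlonglongrightarrow> 0"
    using forgets_initial_law[OF assms(1,2) L B] filterlim_real_sequentially by (rule filterlim_compose)
  then have "(\<lambda>n. (\<integral>x. f x \<partial>\<nu>) - ((\<integral>x. f x \<partial>\<nu>) - markov_op (real n) f 0)) \<longlonglongrightarrow> (\<integral>x. f x \<partial>\<nu>) - 0"
    unfolding n by (intro tendsto_diff tendsto_const)
  then show ?thesis by simp
qed

text \<open>Both integrals are limits of values at the origin: of \<open>P\<^sub>n (P\<^sub>t f)\<close> and of \<open>P\<^sub>n f\<close>. By commutativity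
  \<open>P\<^sub>n (P\<^sub>t f) (0)\<close> is the integral of \<open>P\<^sub>n f\<close> under the law at time \<open>t\<close> of the solution started at \<open>0\<close>, and the
  choice of initial law is forgotten as \<open>n\<close> grows.\<close>

lemma invariant_for_all_times:
  assumes \<nu>: "prob_space \<nu>" and s: "sets \<nu> = sets borel"
    and unit: "\<And>f L B. L-lipschitz_on UNIV f \<Longrightarrow> (\<And>x. \<bar>f x\<bar> \<le> B) \<Longrightarrow> (\<integral>x. markov_op 1 f x \<partial>\<nu>) = (\<integral>x. f x \<partial>\<nu>)"
    and t: "0 \<le> t" and L: "L-lipschitz_on UNIV f" and B: "\<And>x. \<bar>f x\<bar> \<le> B"
  shows "(\<integral>x. markov_op t f x \<partial>\<nu>) = (\<integral>x. f x \<partial>\<nu>)"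
proof (rule LIMSEQ_unique)
  note Pt = markov_op_lipschitz[OF t L B]
  show "(\<lambda>n. markov_op (real n) (markov_op t f) 0) \<longlonglongrightarrow> (\<integral>x. markov_op t f x \<partial>\<nu>)"
    by (rule markov_op_times_tendsto[OF \<nu> s unit Pt])
  have law: "markov_op (real n) (markov_op t f) 0 = (\<integral>x. markov_op (real n) f x \<partial>markov_kernel t 0)" for n
  proof -
    note Pn = markov_op_lipschitz[OF of_nat_0_le_iff L B]
    have "markov_op (real n) (markov_op t f) 0 = markov_op t (markov_op (real n) f) 0"
      using markov_op_add[OF of_nat_0_le_iff t L B, of n 0] markov_op_add[OF t of_nat_0_le_iff L B, of n 0]
      by (simp add: add.commute)
    then show ?thesis using markov_kernel_integral[OF t lipschitz_measurable[OF Pn(1)], of 0] by simp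
  qed
  have "(\<lambda>n. (\<integral>x. markov_op (real n) f x \<partial>markov_kernel t 0) - markov_op (real n) f 0) \<longlonglongrightarrow> 0"
  proof (rule filterlim_compose[OF forgets_initial_law filterlim_real_sequentially])
    show "prob_space (markov_kernel t 0)" unfolding markov_kernel_def by (rule prob_space_distr[OF sol_measurable[OF t]])
    show "sets (markov_kernel t 0) = sets borel" by (simp add: markov_kernel_def)
  qed (rule L B)+
  moreover have "(\<lambda>n. markov_op (real n) f 0) \<longlonglongrightarrow> (\<integral>x. f x \<partial>\<nu>)"
    by (rule markov_op_times_tendsto[OF \<nu> s unit L B])
  ultimately have "(\<lambda>n. (\<integral>x. markov_op (real n) f x \<partial>markov_kernel t 0) - markov_op (real n) f 0 + markov_op (real n) f 0)
      \<longlonglongrightarrow> 0 + (\<integral>x. f x \<partial>\<nu>)"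
    by (rule tendsto_add)
  then show "(\<lambda>n. markov_op (real n) (markov_op t f) 0) \<longlonglongrightarrow> (\<integral>x. f x \<partial>\<nu>)"
    by (simp add: law)
qed

text \<open>The kernels are determined by the equation, so a single family of kernels decides invariance.\<close>

lemma invariant_measure_iff:
  "invariant_measure M W b \<sigma> \<nu> \<longleftrightarrow> prob_space \<nu> \<and> sets \<nu> = sets borel \<and> (\<forall>t\<ge>0. \<nu> \<bind> markov_kernel t = \<nu>)"
proof -
  have "\<nu> \<bind> P t = \<nu> \<bind> markov_kernel t" if "transition_kernels M W b \<sigma> P" "0 \<le> t" for P t
    using transition_kernels_unique[OF that] by (metis ext)
  then show ?thesis
    unfolding invariant_measure_def using transition_kernels_kernel by metis
qed

lemma invariant_measure_lipschitz:
  assumes "invariant_measure M W b \<sigma> \<nu>" "0 \<le> t" and L: "L-lipschitz_on UNIV f" and B: "\<And>x. \<bar>f x\<bar> \<le> B"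
  shows "(\<integral>x. markov_op t f x \<partial>\<nu>) = (\<integral>x. f x \<partial>\<nu>)"
  using assms(1,2) bind_kernel_integral[OF _ _ assms(2) lipschitz_measurable[OF L] B, of \<nu>]
  unfolding invariant_measure_iff by metis

lemma invariant_measure_limit:
  assumes "invariant_measure M W b \<sigma> \<nu>" and L: "L-lipschitz_on UNIV f" and B: "\<And>x. \<bar>f x\<bar> \<le> B"
  shows "((\<lambda>t. markov_op t f 0) \<longlongrightarrow> (\<integral>x. f x \<partial>\<nu>)) at_top"
proof -
  have "((\<lambda>t. (\<integral>x. markov_op t f x \<partial>\<nu>) - markov_op t f 0) \<longlongrightarrow> 0) at_top"
    using assms by (intro forgets_initial_law) (auto simp: invariant_measure_def)
  then have "((\<lambda>t. (\<integral>x. f x \<partial>\<nu>) - ((\<integral>x. markov_op t f x \<partial>\<nu>) - markov_op t f 0)) \<longlongrightarrow> (\<integral>x. f x \<partial>\<nu>) - 0) at_top"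
    by (intro tendsto_diff tendsto_const)
  moreover have "\<forall>\<^sub>F t in at_top. (\<integral>x. f x \<partial>\<nu>) - ((\<integral>x. markov_op t f x \<partial>\<nu>) - markov_op t f 0) = markov_op t f 0"
    using eventually_ge_at_top[of 0]
    by eventually_elim (simp add: invariant_measure_lipschitz[OF assms(1) _ L B])
  ultimately show ?thesis by (simp add: Lim_transform_eventually)
qed

lemma invariant_measure_exists: "\<exists>\<nu>. invariant_measure M W b \<sigma> \<nu>"
proof -
  obtain \<nu> where \<nu>: "prob_space \<nu>" "sets \<nu> = sets (borel :: (real ^ 'n) measure)"
    and unit: "\<And>f L B. L-lipschitz_on UNIV f \<Longrightarrow> (\<And>x. \<bar>f x\<bar> \<le> B) \<Longrightarrow> (\<integral>x. markov_op 1 f x \<partial>\<nu>) = (\<integral>x. f x \<partial>\<nu>)"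
    using invariant_for_unit_time by blast
  have "\<nu> \<bind> markov_kernel t = \<nu>" if t: "0 \<le> t" for t
  proof (rule measure_eqI_lipschitz)
    have k: "markov_kernel t \<in> \<nu> \<rightarrow>\<^sub>M prob_algebra borel" using markov_kernel_measurable[OF t] \<nu>(2) measurable_cong_sets by blast
    have \<nu>_in: "\<nu> \<in> space (prob_algebra \<nu>)" using \<nu>(1) by (simp add: space_prob_algebra)
    show "prob_space (\<nu> \<bind> markov_kernel t)" by (rule prob_space_bind'[OF \<nu>_in k])
    show "sets (\<nu> \<bind> markov_kernel t) = sets borel" by (rule sets_bind'[OF \<nu>_in k])
    fix f :: "real ^ 'n \<Rightarrow> real" and L B assume L: "L-lipschitz_on UNIV f" and B: "\<And>x. \<bar>f x\<bar> \<le> B"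
    show "(\<integral>x. f x \<partial>(\<nu> \<bind> markov_kernel t)) = (\<integral>x. f x \<partial>\<nu>)"
      unfolding bind_kernel_integral[OF \<nu> t lipschitz_measurable[OF L] B]
      by (rule invariant_for_all_times[OF \<nu> unit t L B])
  qed (fact \<nu>)+
  then show ?thesis using \<nu> invariant_measure_iff by blast
qed

lemma invariant_measure_unique:
  assumes "invariant_measure M W b \<sigma> \<nu>" "invariant_measure M W b \<sigma> \<nu>'"
  shows "\<nu>' = \<nu>"
proof (rule measure_eqI_lipschitz)
  fix f :: "real ^ 'n \<Rightarrow> real" and L B assume L: "L-lipschitz_on UNIV f" and B: "\<And>x. \<bar>f x\<bar> \<le> B"
  show "(\<integral>x. f x \<partial>\<nu>') = (\<integral>x. f x \<partial>\<nu>)"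
    using invariant_measure_limit[OF assms(2) L B] invariant_measure_limit[OF assms(1) L B]
    by (rule tendsto_unique[OF trivial_limit_at_top_linorder])
qed (use assms in \<open>auto simp: invariant_measure_def\<close>)

lemma solution_law_converges:
  assumes \<nu>: "invariant_measure M W b \<sigma> \<nu>" and Y: "sde_solution M W b \<sigma> Y"
  shows "weakly_converges (\<lambda>t. distr M borel (Y t)) \<nu>"
proof (rule weakly_convergesI_lipschitz)
  have Ym: "Y t \<in> borel_measurable M" if "0 \<le> t" for t using Y that by (simp add: sde_solution_def)
  show "\<forall>\<^sub>F t in at_top. prob_space (distr M borel (Y t)) \<and> sets (distr M borel (Y t)) = sets borel"
    using eventually_ge_at_top[of 0] by eventually_elim (simp add: prob_space_distr Ym)
  show "prob_space \<nu>" "sets \<nu> = sets borel" using \<nu> by (auto simp: invariant_measure_def)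
  fix f :: "real ^ 'n \<Rightarrow> real" and L B assume L: "L-lipschitz_on UNIV f" and B: "\<And>x. \<bar>f x\<bar> \<le> B"
  have fm: "f \<in> borel_measurable borel" using L by (rule lipschitz_measurable)
  let ?\<mu> = "distr M borel (Y 0)"
  have "((\<lambda>t. (\<integral>x. markov_op t f x \<partial>?\<mu>) - markov_op t f 0) \<longlongrightarrow> 0) at_top"
    using L B by (intro forgets_initial_law prob_space_distr Ym) auto
  from tendsto_add[OF this invariant_measure_limit[OF \<nu> L B]]
  have "((\<lambda>t. \<integral>x. markov_op t f x \<partial>?\<mu>) \<longlongrightarrow> (\<integral>x. f x \<partial>\<nu>)) at_top" by simp
  moreover have "\<forall>\<^sub>F t in at_top. (\<integral>x. markov_op t f x \<partial>?\<mu>) = (\<integral>x. f x \<partial>distr M borel (Y t))"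
    using eventually_ge_at_top[of 0]
    by eventually_elim (simp add: integral_distr[OF Ym fm] solution_law[OF Y _ fm B])
  ultimately show "((\<lambda>t. \<integral>x. f x \<partial>distr M borel (Y t)) \<longlongrightarrow> (\<integral>x. f x \<partial>\<nu>)) at_top"
    by (rule Lim_transform_eventually)
qed

end

lemma exp_factor_tendsto: "0 < \<kappa> \<Longrightarrow> (exp_factor \<kappa> \<longlongrightarrow> 1 / (2 * \<kappa>)) at_top"
proof -
  assume \<kappa>: "0 < \<kappa>"
  have "((\<lambda>t. (1 - exp (- 2 * \<kappa> * t)) / (2 * \<kappa>)) \<longlongrightarrow> 1 / (2 * \<kappa>)) at_top"
    using \<kappa> by real_asymp (simp add: field_simps)
  then show ?thesis using \<kappa> by (simp add: exp_factor_def[abs_def])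
qed

text \<open>As \<open>\<sigma>\<close> is symmetric, \<open>|\<sigma> u|\<^sup>2 = \<langle>\<sigma>\<^sup>2 u, u\<rangle> = 2 \<langle>a u, u\<rangle>\<close>.\<close>

lemma psd_sqrt_norm_bound:
  fixes \<sigma> a :: "real ^ 'n ^ 'n"
  assumes "is_psd_sqrt \<sigma> (2 *\<^sub>R a)"
  shows "(norm (\<sigma> *v u))\<^sup>2 \<le> 2 * onorm ((*v) a) * (norm u)\<^sup>2"
proof -
  have sym: "transpose \<sigma> = \<sigma>" and sq: "\<sigma> ** \<sigma> = 2 *\<^sub>R a" using assms by (auto simp: is_psd_sqrt_def psd_def)
  have "(norm (\<sigma> *v u))\<^sup>2 = (\<sigma> *v u) \<bullet> (\<sigma> *v u)" by (rule power2_norm_eq_inner)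
  also have "\<dots> = (\<sigma> *v (\<sigma> *v u)) \<bullet> u"
    by (metis dot_lmul_matrix transpose_matrix_vector sym)
  also have "\<dots> = ((\<sigma> ** \<sigma>) *v u) \<bullet> u" by (simp only: matrix_vector_mul_assoc)
  also have "\<dots> = 2 * ((a *v u) \<bullet> u)" by (simp add: sq scaleR_matrix_vector_assoc[symmetric])
  also have "(a *v u) \<bullet> u \<le> norm (a *v u) * norm u" by (rule norm_cauchy_schwarz)
  also have "\<dots> \<le> onorm ((*v) a) * norm u * norm u"
    by (intro mult_right_mono onorm) auto
  finally show ?thesis by (simp add: power2_eq_square)
qed

section \<open>Propagation of Gaussian concentration\<close>

theorem theorem4p3:
  fixes M :: "'w measure"
    and W X :: "real \<Rightarrow> 'w \<Rightarrow> real ^ 'n"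
    and b :: "real ^ 'n \<Rightarrow> real ^ 'n"
    and a \<sigma> :: "real ^ 'n ^ 'n"
    and \<kappa> D\<^sub>0 :: real
  assumes "prob_space M"
    and "brownian_motion M W"
    and "psd a"
    and "is_psd_sqrt \<sigma> (2 *\<^sub>R a)"
    and "C1_field b"
    and "sde_standing b \<sigma>"
    and "dissipative \<kappa> b"
    and "sde_solution M W b \<sigma> X"
    and "GCBS D\<^sub>0 (distr M borel (X 0))"
  shows "(\<forall>t>0. GCBS (D\<^sub>0 * exp (- 2 * \<kappa> * t) + onorm ((*v) a) * exp_factor \<kappa> t)
                 (distr M borel (X t)))
    \<and> (\<kappa> > 0 \<longrightarrow>
         (\<exists>\<nu>. invariant_measure M W b \<sigma> \<nu>
            \<and> (\<forall>\<nu>'. invariant_measure M W b \<sigma> \<nu>' \<longrightarrow> \<nu>' = \<nu>)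
            \<and> weakly_converges (\<lambda>t. distr M borel (X t)) \<nu>
            \<and> GCBS (onorm ((*v) a) / (2 * \<kappa>)) \<nu>))
    \<and> (\<forall>U :: real ^ 'n \<Rightarrow> real. C_k 2 U \<longrightarrow>
         (dissipative \<kappa> (\<lambda>x. - grad U x) \<longleftrightarrow>
            (\<forall>x u. (hessian U x *v u) \<bullet> u \<ge> \<kappa> * (norm u)\<^sup>2)))"
proof -
  define A where "A = onorm ((*v) a)"
  have A0: "0 \<le> A" unfolding A_def by (intro onorm_pos_le) simp
  interpret additive_noise M W b \<kappa> \<sigma> A
    by standard (use assms A0 psd_sqrt_norm_bound[OF assms(4)] in \<open>auto simp: A_def\<close>)
  have Xm: "X t \<in> borel_measurable M" if "0 \<le> t" for t using assms(8) that by (simp add: sde_solution_def)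
  have GCBS_iff: "GCBS D (distr M borel (X t)) \<longleftrightarrow> 0 \<le> D \<and> lipschitz_concentration D (distr M borel (X t))"
    if "0 \<le> t" for t D
    by (rule GCBS_iff_lipschitz_concentration) (use prob_space_distr[OF Xm[OF that]] in auto)
  have D0: "0 \<le> D\<^sub>0" "lipschitz_concentration D\<^sub>0 (distr M borel (X 0))"
    using assms(9) by (simp_all add: GCBS_iff)
  define D where "D t = D\<^sub>0 * exp (- 2 * \<kappa> * t) + A * exp_factor \<kappa> t" for t
  have conc: "lipschitz_concentration (D t) (distr M borel (X t))" if "0 \<le> t" for t
    unfolding D_def by (rule solution_concentration[OF assms(8) that D0(2)])
  have "GCBS (D t) (distr M borel (X t))" if "0 \<le> t" for t
    using conc[OF that] D0(1) A0 exp_factor_nonneg[OF that] by (simp add: GCBS_iff[OF that] D_def)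
  moreover have "\<exists>\<nu>. invariant_measure M W b \<sigma> \<nu> \<and> (\<forall>\<nu>'. invariant_measure M W b \<sigma> \<nu>' \<longrightarrow> \<nu>' = \<nu>)
      \<and> weakly_converges (\<lambda>t. distr M borel (X t)) \<nu> \<and> GCBS (A / (2 * \<kappa>)) \<nu>" if \<kappa>: "\<kappa> > 0"
  proof -
    interpret contractive_noise M W b \<kappa> \<sigma> A by standard (rule \<kappa>)
    obtain \<nu> where \<nu>: "invariant_measure M W b \<sigma> \<nu>" using invariant_measure_exists by blast
    have weak: "weakly_converges (\<lambda>t. distr M borel (X t)) \<nu>" by (rule solution_law_converges[OF \<nu> assms(8)])
    have "((\<lambda>t. exp (- 2 * \<kappa> * t)) \<longlongrightarrow> 0) at_top" using \<kappa> by real_asymp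
    then have "(D \<longlongrightarrow> D\<^sub>0 * 0 + A * (1 / (2 * \<kappa>))) at_top"
      unfolding D_def[abs_def] by (intro tendsto_intros exp_factor_tendsto \<kappa>)
    then have "(D \<longlongrightarrow> A / (2 * \<kappa>)) at_top" by simp
    moreover have "\<forall>\<^sub>F t in at_top. lipschitz_concentration (D t) (distr M borel (X t))"
      using eventually_ge_at_top[of 0] by eventually_elim (rule conc)
    ultimately have "lipschitz_concentration (A / (2 * \<kappa>)) \<nu>"
      by (intro lipschitz_concentration_weak_limit[OF weak])
    then have "GCBS (A / (2 * \<kappa>)) \<nu>"
      using \<nu> A0 \<kappa> GCBS_iff_lipschitz_concentration[of \<nu>] by (simp add: invariant_measure_def)
    then show ?thesis using \<nu> weak invariant_measure_unique by blast
  qed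
  ultimately show ?thesis
    using dissipative_grad_iff unfolding D_def A_def by (auto intro: less_imp_le)
qed

end
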